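(* Let $G=\langle \mathcal{A}\,\|\,\mathcal{O}\rangle$ be a group and let $\mathcal{R}=\bigcup_{i\ge 1}\mathcal{R}_i$, $\mathcal{R}^+=\bigcup_{i\ge1}\mathcal{R}_i^+$, $F$, $N$, $N_{\mathcal{R}}$, $\bar N_{\mathcal{R}}$ be as in the context, where every $\mathcal{R}_i$ satisfies condition $( * )$. Suppose that the reduced $G$-graded presentation $\langle \mathcal{A}\,\|\,\mathcal{O}\cup\bigcup_{i=1}^{\infty}\mathcal{R}_i^+\rangle$ of $G(\infty)=G/\bar N_{\mathcal{R}}$ is $G$-aspherical and $G$-atorical. Then: 1) For a word $X\in N_{\mathcal{R}}N$ and any expression $Z\prod_k S_kR_k^{\pm1}S_k^{-1}$ representing $X$ in $F$, where $Z\in N$, $R_k\in\mathcal{R}^+$, $S_k\in F$, the following conditions are equivalent: a) $X\in[N_{\mathcal{R}},F]N$; b) in the expression $Z\prod_k S_kR_k^{\pm1}S_k^{-1}$, for each $R\in\mathcal{R}^+$ the sum of the exponents of $R$ (i.e. the sum of the exponents $\pm1$ over all $k$ with $R_k=R$) is equal to zero. 2) $\bar N_{\mathcal{R}}/[\bar N_{\mathcal{R}},G]\simeq N_{\mathcal{R}}N/[N_{\mathcal{R}},F]N$ is a free Abelian group with basis $\{\bar R\}_{R\in\mathcal{R}^+}$, where $\bar R=R[N_{\mathcal{R}},F]N$.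
   Context: Groups and presentations. $G$ is a group with generating set $\mathcal{A}$, and $\mathcal{O}$ is the set of all relators of $G$ (all words in $\mathcal{A}^{\pm1}$ equal to $1$ in $G$). $F=F(\mathcal{A})$ is the free group on $\mathcal{A}$, $\Phi:F\to G$ is the canonical homomorphism, $N=\ker\Phi$. $\mathcal{R}=\bigcup_{i=1}^\infty\mathcal{R}_i$, where each $\mathcal{R}_i$ (possibly empty) is a symmetrized set of words in $\mathcal{A}^{\pm1}$ (closed under inverses and cyclic permutations), $\mathcal{R}_i\cap\mathcal{R}_j=\emptyset$ for $i\ne j$, and $\mathcal{R}\cap\mathcal{O}=\emptyset$. $N_{\mathcal{R}}$ is the normal closure of $\mathcal{R}$ in $F$ and $\bar N_{\mathcal{R}}=\Phi(N_{\mathcal{R}})$. Put $G_0=G$, $G_k=\langle\mathcal{A}\,\|\,\mathcal{O}\cup\bigcup_{i=1}^k\mathcal{R}_i\rangle$ and $G(\infty)=\langle\mathcal{A}\,\|\,\mathcal{O}\cup\bigcup_{i=1}^\infty\mathcal{R}_i\rangle=G/\bar N_{\mathcal{R}}$; a presentation with such a partition of its relators is called $G$-graded. Condition $( * )$ for $\mathcal{R}_i$: no $R\in\mathcal{R}_i$ is conjugate to $R^{-1}$ in $G_{i-1}$. Reduced presentation. Assume all $\mathcal{R}_i$ satisfy $( * )$. Partition $\mathcal{R}_i$ into the classes of words conjugate to each other in $G_{i-1}$: $\mathcal{R}_i=\bigsqcup_j(\mathcal{R}_{i,j}^+\sqcup\mathcal{R}_{i,j}^-)$ with $\mathcal{R}_{i,j}^-=(\mathcal{R}_{i,j}^+)^{-1}$.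 Fix a representative $r_{i,j}^+$ in each $\mathcal{R}_{i,j}^+$; $\mathcal{R}_i^+$ is the set of all these $r_{i,j}^+$ (for fixed $i$), $\mathcal{R}^+=\bigcup_i\mathcal{R}_i^+$. The presentation $G(\infty)=\langle\mathcal{A}\,\|\,\mathcal{O}\cup\bigcup_{i\ge1}\mathcal{R}_i^+\rangle$ is called reduced. (Also $G_k=\langle\mathcal{A}\,\|\,\mathcal{O}\cup\bigcup_{i=1}^k\mathcal{R}_i^+\rangle$.) Diagrams. A diagram over the reduced presentation is a finite cell decomposition of an oriented surface (here a sphere, a torus, or a disk; disks may be degenerate planar simply connected complexes) whose oriented edges $e$ carry labels $\varphi(e)\in\mathcal{A}^{\pm1}$ with $\varphi(e^{-1})=\varphi(e)^{-1}$ (the label $\varphi(p)$ of a path $p$ is the product of the labels of its edges), such that each face has boundary label either in $\mathcal{O}$ (a $0$-face, of rank $0$) or in $\mathcal{R}_i^*$ for some $i\ge1$ (an $\mathcal{R}_i$-face, of rank $i$), where $\mathcal{R}_i^*$ consists of the elements of $\mathcal{R}_i^+$, their inverses, and all cyclic permutations of these words. The rank of a diagram is the maximum of the ranks of its faces ($0$ if there are no faces). Elementary transformations of a diagram are changes involving only $0$-faces and leaving the $\mathcal{R}$-faces and their labels unchanged: merging two distinct $0$-faces with a common edge into one $0$-face by erasing the edge (or removing an edge hanging inside a $0$-face), the inverse operations (subdividing a $0$-face into $0$-faces), and cutting along an edge or simple path $t$ and pasting in a $0$-face with boundary label $\varphi(t)\varphi(t)^{-1}$. Two different $\mathcal{R}_i$-faces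 $\Pi_1,\Pi_2$ of a diagram are opposite $\mathcal{R}_i$-faces if for their boundary labels $R_1,R_2$, read clockwise starting from some vertices $o_1,o_2$ of their boundaries, one can find (after a series of elementary transformations) a simple path $s$ in the diagram from $o_1$ to $o_2$ with $\varphi(s)^{-1}R_1\varphi(s)R_2=1$ in $G_{i-1}$. The presentation is $G$-aspherical (respectively $G$-atorical) if every diagram of positive rank over it on a sphere (respectively on a torus) contains opposite $\mathcal{R}_i$-faces for some $i>0$. $[A,B]$ denotes the subgroup generated by commutators of elements of $A$ with elements of $B$. *)

theory Defs
  imports
    "HOL-Algebra.Free_Abelian_Groups"
    "HOL-Combinatorics.Orbits"
begin

section \<open>Words and free groups\<close>

text \<open>A letter \<open>(a, True)\<close> stands for \<open>a\<close> and \<open>(a, False)\<close> for its formal inverse.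
  Words need not be freely reduced; the element of the free group represented by a word \<open>w\<close>
  is \<open>red w\<close>.\<close>

type_synonym 'a letter = "'a \<times> bool"
type_synonym 'a word = "'a letter list"

definition inv_letter :: "'a letter \<Rightarrow> 'a letter"
  where "inv_letter x = (fst x, \<not> snd x)"

definition inv_word :: "'a word \<Rightarrow> 'a word"
  where "inv_word w = rev (map inv_letter w)"

definition words :: "'a set \<Rightarrow> 'a word set"
  where "words \<A> = lists (\<A> \<times> UNIV)"

definition freely_reduced :: "'a word \<Rightarrow> bool"
  where "freely_reduced w \<longleftrightarrow> successively (\<lambda>x y. y \<noteq> inv_letter x) w"

definition cons_red :: "'a letter \<Rightarrow> 'a word \<Rightarrow> 'a word"
  where "cons_red x w = (if w \<noteq> [] \<and> hd w = inv_letter x then tl w else x # w)"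

definition red :: "'a word \<Rightarrow> 'a word"
  where "red w = foldr cons_red w []"

definition free_group :: "'a set \<Rightarrow> 'a word monoid"
  where "free_group \<A> =
    \<lparr>carrier = {w \<in> words \<A>. freely_reduced w}, monoid.mult = (\<lambda>u v. red (u @ v)), one = []\<rparr>"

lemma inv_letter_inv_letter [simp]: "inv_letter (inv_letter x) = x"
  by (simp add: inv_letter_def)

lemma freely_reduced_Cons:
  "freely_reduced (x # w) \<longleftrightarrow> (w = [] \<or> hd w \<noteq> inv_letter x) \<and> freely_reduced w"
  by (cases w) (auto simp: freely_reduced_def)

lemma freely_reduced_cons_red: "freely_reduced w \<Longrightarrow> freely_reduced (cons_red x w)"
  by (cases w) (auto simp: cons_red_def freely_reduced_Cons)

lemma cons_red_cancel: "freely_reduced w \<Longrightarrow> cons_red x (cons_red (inv_letter x) w) = w"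
  by (cases w) (auto simp: cons_red_def freely_reduced_Cons)

lemma freely_reduced_foldr: "freely_reduced w \<Longrightarrow> freely_reduced (foldr cons_red u w)"
  by (induction u) (auto intro: freely_reduced_cons_red)

lemma freely_reduced_red: "freely_reduced (red w)"
  unfolding red_def by (rule freely_reduced_foldr) (simp add: freely_reduced_def)

lemma red_freely_reduced: "freely_reduced w \<Longrightarrow> red w = w"
  by (induction w) (auto simp: red_def freely_reduced_Cons cons_red_def)

lemma foldr_cons_red_red:
  assumes "freely_reduced w"
  shows "foldr cons_red (red u) w = foldr cons_red u w"
proof (induction u)
  case (Cons x u)
  show ?case
  proof (cases "red u \<noteq> [] \<and> hd (red u) = inv_letter x")
    case True
    then obtain v where v: "red u = inv_letter x # v" by (cases "red u") auto
    have "red (x # u) = v" using v by (simp add: red_def cons_red_def)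
    moreover have "foldr cons_red u w = cons_red (inv_letter x) (foldr cons_red v w)"
      using Cons v by simp
    ultimately show ?thesis
      using cons_red_cancel[OF freely_reduced_foldr[OF assms]] by simp
  next
    case False
    then have "red (x # u) = x # red u" by (auto simp: red_def cons_red_def)
    then show ?thesis using Cons by simp
  qed
qed (simp add: red_def)

lemma red_append: "red (u @ v) = foldr cons_red u (red v)"
  by (simp add: red_def)

lemma red_red_left: "red (red u @ v) = red (u @ v)"
  by (simp add: red_append foldr_cons_red_red freely_reduced_red)

lemma red_red_right: "red (u @ red v) = red (u @ v)"
  by (simp add: red_append red_freely_reduced freely_reduced_red)

lemma red_in_words:
  assumes "w \<in> words \<A>" shows "red w \<in> words \<A>"
proof -
  have "set (red w) \<subseteq> set w"
  proof (induction w)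
    case (Cons x w)
    have "set (cons_red x (red w)) \<subseteq> insert x (set (red w))"
      by (cases "red w") (auto simp: cons_red_def)
    then show ?case using Cons by (auto simp: red_def)
  qed (simp add: red_def)
  then show ?thesis using assms by (auto simp: words_def in_lists_conv_set)
qed

lemma red_inv_word: "red (inv_word w @ w) = []"
proof (induction w)
  case (Cons x w)
  have "foldr cons_red (inv_word w) (cons_red (inv_letter x) (cons_red x (red w))) = red (inv_word w @ w)"
    using cons_red_cancel[OF freely_reduced_red[of w], of "inv_letter x"] by (simp add: red_append)
  then show ?case using Cons by (simp add: red_def inv_word_def)
qed (simp add: red_def inv_word_def)

lemma group_free_group: "group (free_group \<A>)"
proof (rule groupI)
  fix x assume x: "x \<in> carrier (free_group \<A>)"
  then have "inv_word x \<in> words \<A>"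
    by (auto simp: free_group_def words_def inv_word_def inv_letter_def in_lists_conv_set)
  then have "red (inv_word x) \<in> carrier (free_group \<A>)"
    by (simp add: free_group_def freely_reduced_red red_in_words)
  moreover have "red (inv_word x) \<otimes>\<^bsub>free_group \<A>\<^esub> x = \<one>\<^bsub>free_group \<A>\<^esub>"
    by (simp add: free_group_def red_red_left red_inv_word)
  ultimately show "\<exists>y\<in>carrier (free_group \<A>). y \<otimes>\<^bsub>free_group \<A>\<^esub> x = \<one>\<^bsub>free_group \<A>\<^esub>" by blast
next
  fix x y assume "x \<in> carrier (free_group \<A>)" "y \<in> carrier (free_group \<A>)"
  then show "x \<otimes>\<^bsub>free_group \<A>\<^esub> y \<in> carrier (free_group \<A>)"
    by (auto simp: free_group_def freely_reduced_red words_def intro!: red_in_words[unfolded words_def])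
qed (auto simp: free_group_def red_red_left red_red_right red_freely_reduced words_def freely_reduced_def)


section \<open>Subgroups\<close>

definition normal_closure :: "('g, 'm) monoid_scheme \<Rightarrow> 'g set \<Rightarrow> 'g set"
  where "normal_closure K S = \<Inter>{H. H \<lhd> K \<and> S \<subseteq> H}"

definition commutator_subgroup :: "('g, 'm) monoid_scheme \<Rightarrow> 'g set \<Rightarrow> 'g set \<Rightarrow> 'g set"
  where "commutator_subgroup K A B =
    generate K (\<Union>a\<in>A. \<Union>b\<in>B. {a \<otimes>\<^bsub>K\<^esub> b \<otimes>\<^bsub>K\<^esub> inv\<^bsub>K\<^esub> a \<otimes>\<^bsub>K\<^esub> inv\<^bsub>K\<^esub> b})"

definition conjugate_in :: "('g, 'm) monoid_scheme \<Rightarrow> 'g \<Rightarrow> 'g \<Rightarrow> bool"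
  where "conjugate_in K x y \<longleftrightarrow> (\<exists>g\<in>carrier K. y = g \<otimes>\<^bsub>K\<^esub> x \<otimes>\<^bsub>K\<^esub> inv\<^bsub>K\<^esub> g)"

definition free_abelian_with_basis ::
    "('g, 'm) monoid_scheme \<Rightarrow> 'i set \<Rightarrow> ('i \<Rightarrow> 'g) \<Rightarrow> bool"
  where "free_abelian_with_basis K I b \<longleftrightarrow>
    comm_group K \<and> (\<exists>h \<in> iso (free_Abelian_group I) K. \<forall>i\<in>I. h (frag_of i) = b i)"


section \<open>Graded presentations\<close>

text \<open>The generators are given by a map \<open>\<gamma>\<close> from the alphabet \<open>\<A>\<close> to the group; for a
  generating subset take the identity. The grading \<open>\<R>\<close> is indexed by the natural numbers
  \<open>\<ge> 1\<close>; the value \<open>\<R> 0\<close> is never used.\<close>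

definition eval_word :: "('g, 'm) monoid_scheme \<Rightarrow> ('a \<Rightarrow> 'g) \<Rightarrow> 'a word \<Rightarrow> 'g"
  where "eval_word G \<gamma> w =
    foldr (\<lambda>(a, s) g. (if s then \<gamma> a else inv\<^bsub>G\<^esub> (\<gamma> a)) \<otimes>\<^bsub>G\<^esub> g) w \<one>\<^bsub>G\<^esub>"

definition relators :: "('g, 'm) monoid_scheme \<Rightarrow> ('a \<Rightarrow> 'g) \<Rightarrow> 'a set \<Rightarrow> 'a word set"
  where "relators G \<gamma> \<A> = {w \<in> words \<A>. eval_word G \<gamma> w = \<one>\<^bsub>G\<^esub>}"

definition symmetrized :: "'a word set \<Rightarrow> bool"
  where "symmetrized S \<longleftrightarrow> (\<forall>w\<in>S. inv_word w \<in> S \<and> (\<forall>n. rotate n w \<in> S))"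

definition graded_relators :: "'a set \<Rightarrow> 'a word set \<Rightarrow> (nat \<Rightarrow> 'a word set) \<Rightarrow> bool"
  where "graded_relators \<A> \<O> \<R> \<longleftrightarrow>
    (\<forall>i\<ge>1. \<R> i \<subseteq> words \<A> \<and> symmetrized (\<R> i) \<and> \<R> i \<inter> \<O> = {}) \<and>
    (\<forall>i\<ge>1. \<forall>j\<ge>1. i \<noteq> j \<longrightarrow> \<R> i \<inter> \<R> j = {})"

definition level_kernel :: "'a set \<Rightarrow> 'a word set \<Rightarrow> (nat \<Rightarrow> 'a word set) \<Rightarrow> nat \<Rightarrow> 'a word set"
  where "level_kernel \<A> \<O> \<R> k =
    normal_closure (free_group \<A>) (red ` (\<O> \<union> (\<Union>i\<in>{1..k}. \<R> i)))"

definition level_group ::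
    "'a set \<Rightarrow> 'a word set \<Rightarrow> (nat \<Rightarrow> 'a word set) \<Rightarrow> nat \<Rightarrow> 'a word set monoid"
  where "level_group \<A> \<O> \<R> k = free_group \<A> Mod level_kernel \<A> \<O> \<R> k"

definition level_elem ::
    "'a set \<Rightarrow> 'a word set \<Rightarrow> (nat \<Rightarrow> 'a word set) \<Rightarrow> nat \<Rightarrow> 'a word \<Rightarrow> 'a word set"
  where "level_elem \<A> \<O> \<R> k w = level_kernel \<A> \<O> \<R> k #>\<^bsub>free_group \<A>\<^esub> red w"

definition conjugate_words ::
    "'a set \<Rightarrow> 'a word set \<Rightarrow> (nat \<Rightarrow> 'a word set) \<Rightarrow> nat \<Rightarrow> 'a word \<Rightarrow> 'a word \<Rightarrow> bool"
  where "conjugate_words \<A> \<O> \<R> k u v \<longleftrightarrow>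
    conjugate_in (level_group \<A> \<O> \<R> k) (level_elem \<A> \<O> \<R> k u) (level_elem \<A> \<O> \<R> k v)"

definition condition_star :: "'a set \<Rightarrow> 'a word set \<Rightarrow> (nat \<Rightarrow> 'a word set) \<Rightarrow> nat \<Rightarrow> bool"
  where "condition_star \<A> \<O> \<R> i \<longleftrightarrow>
    (\<forall>r\<in>\<R> i. \<not> conjugate_words \<A> \<O> \<R> (i - 1) r (inv_word r))"

definition conjugacy_classes ::
    "'a set \<Rightarrow> 'a word set \<Rightarrow> (nat \<Rightarrow> 'a word set) \<Rightarrow> nat \<Rightarrow> 'a word set set"
  where "conjugacy_classes \<A> \<O> \<R> i =
    \<R> i // {(u, v) \<in> \<R> i \<times> \<R> i. conjugate_words \<A> \<O> \<R> (i - 1) u v}"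

text \<open>\<open>P\<close> is the set of the classes chosen to be positive, \<open>rep\<close> picks their representatives.\<close>

definition reduced_relators ::
    "'a set \<Rightarrow> 'a word set \<Rightarrow> (nat \<Rightarrow> 'a word set) \<Rightarrow> nat \<Rightarrow> 'a word set \<Rightarrow> bool"
  where "reduced_relators \<A> \<O> \<R> i S \<longleftrightarrow>
    (\<exists>P rep. conjugacy_classes \<A> \<O> \<R> i = P \<union> (\<lambda>C. inv_word ` C) ` P \<and>
      P \<inter> (\<lambda>C. inv_word ` C) ` P = {} \<and>
      (\<forall>C\<in>P. rep C \<in> C) \<and> S = rep ` P)"

definition cyclic_closure :: "'a word set \<Rightarrow> 'a word set"
  where "cyclic_closure S = {rotate n w | n w. w \<in> S \<union> inv_word ` S}"


section \<open>Diagrams\<close>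

text \<open>A finite cell decomposition of a closed connected oriented surface with at least one edge
  is encoded as a combinatorial map on its oriented edges (darts): \<open>opp\<close> reverses an oriented edge
  and \<open>nxt\<close> sends it to its successor on the boundary of the face lying on a fixed (say right) side
  of it. Hence faces are the orbits of \<open>nxt\<close>, all of them read in the same (clockwise) direction,
  and vertices, represented by the sets of outgoing oriented edges, are the orbits of
  \<open>rot = nxt \<circ> opp\<close>. The decomposition of the sphere without edges is not covered: its only face
  has the empty label, so it has rank 0.\<close>

record 'a diagram =
  darts :: "nat set"
  opp :: "nat \<Rightarrow> nat"
  nxt :: "nat \<Rightarrow> nat"
  lab :: "nat \<Rightarrow> 'a letter"

definition rot :: "'a diagram \<Rightarrow> nat \<Rightarrow> nat"
  where "rot M d = nxt M (opp M d)"

definition labelled_map :: "'a set \<Rightarrow> 'a diagram \<Rightarrow> bool"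
  where "labelled_map \<A> M \<longleftrightarrow>
    finite (darts M) \<and> darts M \<noteq> {} \<and>
    opp M permutes darts M \<and> nxt M permutes darts M \<and>
    (\<forall>d\<in>darts M. opp M d \<noteq> d \<and> opp M (opp M d) = d) \<and>
    (\<forall>d\<in>darts M. \<forall>e\<in>darts M.
      (d, e) \<in> ({(x, opp M x) | x. x \<in> darts M} \<union> {(x, nxt M x) | x. x \<in> darts M})\<^sup>*) \<and>
    lab M \<in> darts M \<rightarrow>\<^sub>E \<A> \<times> UNIV \<and>
    (\<forall>d\<in>darts M. lab M (opp M d) = inv_letter (lab M d))"

definition face_of :: "'a diagram \<Rightarrow> nat \<Rightarrow> nat set"
  where "face_of M d = orbit (nxt M) d"

definition origin :: "'a diagram \<Rightarrow> nat \<Rightarrow> nat set"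
  where "origin M d = orbit (rot M) d"

definition terminus :: "'a diagram \<Rightarrow> nat \<Rightarrow> nat set"
  where "terminus M d = origin M (opp M d)"

definition faces :: "'a diagram \<Rightarrow> nat set set"
  where "faces M = face_of M ` darts M"

definition vertices :: "'a diagram \<Rightarrow> nat set set"
  where "vertices M = origin M ` darts M"

definition edges :: "'a diagram \<Rightarrow> nat set set"
  where "edges M = (\<lambda>d. {d, opp M d}) ` darts M"

definition euler_char :: "'a diagram \<Rightarrow> int"
  where "euler_char M = int (card (vertices M)) - int (card (edges M)) + int (card (faces M))"

definition on_sphere :: "'a diagram \<Rightarrow> bool"
  where "on_sphere M \<longleftrightarrow> euler_char M = 2"

definition on_torus :: "'a diagram \<Rightarrow> bool"
  where "on_torus M \<longleftrightarrow> euler_char M = 0"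

text \<open>The boundary label of the face of \<open>d\<close>, read from the origin of \<open>d\<close>.\<close>

definition face_label :: "'a diagram \<Rightarrow> nat \<Rightarrow> 'a word"
  where "face_label M d = map (\<lambda>n. lab M ((nxt M ^^ n) d)) [0..<card (face_of M d)]"

definition zero_face :: "'a word set \<Rightarrow> 'a diagram \<Rightarrow> nat set \<Rightarrow> bool"
  where "zero_face \<O> M f \<longleftrightarrow> f \<in> faces M \<and> (\<exists>d\<in>f. face_label M d \<in> \<O>)"

definition rel_face :: "(nat \<Rightarrow> 'a word set) \<Rightarrow> 'a diagram \<Rightarrow> nat \<Rightarrow> nat set \<Rightarrow> bool"
  where "rel_face \<R>p M i f \<longleftrightarrow> f \<in> faces M \<and> (\<exists>d\<in>f. face_label M d \<in> cyclic_closure (\<R>p i))"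

definition diagram_over ::
    "'a set \<Rightarrow> 'a word set \<Rightarrow> (nat \<Rightarrow> 'a word set) \<Rightarrow> 'a diagram \<Rightarrow> bool"
  where "diagram_over \<A> \<O> \<R>p M \<longleftrightarrow>
    labelled_map \<A> M \<and> (\<forall>f\<in>faces M. zero_face \<O> M f \<or> (\<exists>i\<ge>1. rel_face \<R>p M i f))"

definition diagram_rank :: "(nat \<Rightarrow> 'a word set) \<Rightarrow> 'a diagram \<Rightarrow> nat"
  where "diagram_rank \<R>p M = Max (insert 0 {i. i \<ge> 1 \<and> (\<exists>f\<in>faces M. rel_face \<R>p M i f)})"

fun is_path :: "'a diagram \<Rightarrow> nat set \<Rightarrow> nat list \<Rightarrow> nat set \<Rightarrow> bool"
  where
    "is_path M u [] v \<longleftrightarrow> u \<in> vertices M \<and> u = v"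
  | "is_path M u (d # p) v \<longleftrightarrow> d \<in> darts M \<and> origin M d = u \<and> is_path M (terminus M d) p v"

text \<open>No vertex is visited twice; in particular a simple closed path is trivial.\<close>

definition simple_path :: "'a diagram \<Rightarrow> nat set \<Rightarrow> nat list \<Rightarrow> nat set \<Rightarrow> bool"
  where "simple_path M u p v \<longleftrightarrow> is_path M u p v \<and> distinct (u # map (terminus M) p)"

subsection \<open>Elementary transformations\<close>

text \<open>Erasing an edge deletes its two darts from the cyclic orders around the vertices; at most two
  deleted darts follow each other in such a cyclic order. All darts of the faces not incident to
  the edge keep their successors and labels.\<close>

definition erase_edge :: "nat \<Rightarrow> 'a diagram \<Rightarrow> 'a diagram"
  where "erase_edge d M =
    (let D = darts M - {d, opp M d};
         skip = (\<lambda>y. if y \<in> D then y else if rot M y \<in> D then rot M y else rot M (rot M y))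
     in \<lparr>darts = D,
         opp = (\<lambda>x. if x \<in> D then opp M x else x),
         nxt = (\<lambda>x. if x \<in> D then skip (nxt M x) else x),
         lab = restrict (lab M) D\<rparr>)"

text \<open>Either \<open>d\<close> separates two distinct 0-faces, or it hangs inside a 0-face: its terminus has
  degree 1.\<close>

definition erasable :: "'a word set \<Rightarrow> nat \<Rightarrow> 'a diagram \<Rightarrow> bool"
  where "erasable \<O> d M \<longleftrightarrow>
    d \<in> darts M \<and> zero_face \<O> M (face_of M d) \<and> zero_face \<O> M (face_of M (opp M d)) \<and>
    (face_of M d \<noteq> face_of M (opp M d) \<or> nxt M d = opp M d)"

text \<open>\<open>M'\<close> arises from \<open>M\<close> by cutting along \<open>t\<close> and pasting in a face with boundary cycle
  \<open>b @ rev a\<close>: the new dart \<open>a ! k\<close> becomes the reverse of \<open>t ! k\<close>, and \<open>b ! k\<close> that of the former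
  reverse of \<open>t ! k\<close>. When \<open>M'\<close> is a \<open>labelled_map\<close>, this forces the values of \<open>opp M'\<close> and \<open>lab M'\<close> on
  the new darts: \<open>b\<close> carries the label \<open>w\<close> of \<open>t\<close>, and the label of the new face is
  \<open>w @ inv_word w\<close>.\<close>

definition cut_along :: "nat list \<Rightarrow> nat list \<Rightarrow> nat list \<Rightarrow> 'a diagram \<Rightarrow> 'a diagram \<Rightarrow> bool"
  where "cut_along t a b M M' \<longleftrightarrow>
    length a = length t \<and> length b = length t \<and>
    distinct (a @ b) \<and> set (a @ b) \<inter> darts M = {} \<and>
    darts M' = darts M \<union> set (a @ b) \<and>
    (\<forall>x\<in>darts M. nxt M' x = nxt M x \<and> lab M' x = lab M x) \<and>
    (\<forall>x\<in>darts M - (set t \<union> opp M ` set t). opp M' x = opp M x) \<and>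
    (\<forall>k<length t. opp M' (t ! k) = a ! k \<and> opp M' (opp M (t ! k)) = b ! k) \<and>
    (let c = b @ rev a in \<forall>k<length c. nxt M' (c ! k) = c ! (Suc k mod length c))"

inductive elementary ::
    "'a set \<Rightarrow> 'a word set \<Rightarrow> (nat \<Rightarrow> 'a word set) \<Rightarrow> 'a diagram \<Rightarrow> 'a diagram \<Rightarrow> bool"
  for \<A> \<O> \<R>p
  where
    erase: "\<lbrakk>diagram_over \<A> \<O> \<R>p M; erasable \<O> d M; diagram_over \<A> \<O> \<R>p (erase_edge d M)\<rbrakk>
      \<Longrightarrow> elementary \<A> \<O> \<R>p M (erase_edge d M)"
  | subdivide: "\<lbrakk>diagram_over \<A> \<O> \<R>p M; erasable \<O> d M; diagram_over \<A> \<O> \<R>p (erase_edge d M)\<rbrakk>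
      \<Longrightarrow> elementary \<A> \<O> \<R>p (erase_edge d M) M"
  | cut: "\<lbrakk>diagram_over \<A> \<O> \<R>p M; diagram_over \<A> \<O> \<R>p M'; t \<noteq> [];
      (\<exists>u v. simple_path M u t v) \<or> (\<exists>d\<in>darts M. t = [d]); cut_along t a b M M'\<rbrakk>
      \<Longrightarrow> elementary \<A> \<O> \<R>p M M'"

subsection \<open>Asphericity and atoricity\<close>

text \<open>Elementary transformations keep the darts of the \<open>\<R>\<close>-faces, their successors and their
  labels, so \<open>f1\<close> and \<open>f2\<close> are also faces of \<open>M'\<close>, with the same boundary labels.\<close>

definition opposite_faces ::
    "'a set \<Rightarrow> 'a word set \<Rightarrow> (nat \<Rightarrow> 'a word set) \<Rightarrow> (nat \<Rightarrow> 'a word set) \<Rightarrow> nat \<Rightarrow>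
      'a diagram \<Rightarrow> nat set \<Rightarrow> nat set \<Rightarrow> bool"
  where "opposite_faces \<A> \<O> \<R> \<R>p i M f1 f2 \<longleftrightarrow>
    f1 \<noteq> f2 \<and> rel_face \<R>p M i f1 \<and> rel_face \<R>p M i f2 \<and>
    (\<exists>M' d1 d2 s. (elementary \<A> \<O> \<R>p)\<^sup>*\<^sup>* M M' \<and> d1 \<in> f1 \<and> d2 \<in> f2 \<and>
      simple_path M' (origin M' d1) s (origin M' d2) \<and>
      level_elem \<A> \<O> \<R> (i - 1)
        (inv_word (map (lab M') s) @ face_label M' d1 @ map (lab M') s @ face_label M' d2)
      = \<one>\<^bsub>level_group \<A> \<O> \<R> (i - 1)\<^esub>)"

definition aspherical ::
    "'a set \<Rightarrow> 'a word set \<Rightarrow> (nat \<Rightarrow> 'a word set) \<Rightarrow> (nat \<Rightarrow> 'a word set) \<Rightarrow> bool"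
  where "aspherical \<A> \<O> \<R> \<R>p \<longleftrightarrow>
    (\<forall>M. diagram_over \<A> \<O> \<R>p M \<and> on_sphere M \<and> diagram_rank \<R>p M > 0 \<longrightarrow>
      (\<exists>i>0. \<exists>f1 f2. opposite_faces \<A> \<O> \<R> \<R>p i M f1 f2))"

definition atorical ::
    "'a set \<Rightarrow> 'a word set \<Rightarrow> (nat \<Rightarrow> 'a word set) \<Rightarrow> (nat \<Rightarrow> 'a word set) \<Rightarrow> bool"
  where "atorical \<A> \<O> \<R> \<R>p \<longleftrightarrow>
    (\<forall>M. diagram_over \<A> \<O> \<R>p M \<and> on_torus M \<and> diagram_rank \<R>p M > 0 \<longrightarrow>
      (\<exists>i>0. \<exists>f1 f2. opposite_faces \<A> \<O> \<R> \<R>p i M f1 f2))"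


section \<open>Products of conjugates of relators\<close>

text \<open>A triple \<open>(S, R, \<epsilon>)\<close> stands for the factor \<open>S R\<^sup>\<epsilon> S\<^sup>-\<^sup>1\<close>.\<close>

definition conjugate_product :: "'a set \<Rightarrow> ('a word \<times> 'a word \<times> int) list \<Rightarrow> 'a word"
  where "conjugate_product \<A> E =
    foldr (\<lambda>(S, R, e) x. S \<otimes>\<^bsub>free_group \<A>\<^esub> (red R [^]\<^bsub>free_group \<A>\<^esub> e)
        \<otimes>\<^bsub>free_group \<A>\<^esub> inv\<^bsub>free_group \<A>\<^esub> S \<otimes>\<^bsub>free_group \<A>\<^esub> x)
      E \<one>\<^bsub>free_group \<A>\<^esub>"

definition exponent_sum :: "('a word \<times> 'a word \<times> int) list \<Rightarrow> 'a word \<Rightarrow> int"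
  where "exponent_sum E R = (\<Sum>(S, R', e)\<leftarrow>E. if R' = R then e else 0)"

end

theory Submission
  imports Defs "HOL-Library.Multiset"
begin

text \<open>Everything reduces to one claim: in a diagram on a torus, each relator occurs as often with a
  positive as with a negative sign. Then a product of conjugates of relators that is trivial in \<open>G\<close>
  has exponent sums zero, because such a product can be attached as a bouquet of lollipops to a torus
  whose only face has the trivial label \<open>Y Y Y\<^sup>-\<^sup>1 Y\<^sup>-\<^sup>1\<close>.

  The claim is proved by induction on the multiset of the ranks of the faces. By atoricity there are
  opposite faces, of rank \<open>i\<close> and with labels \<open>R\<close> and \<open>R\<^sup>-\<^sup>1\<close> up to cyclic shifts. Joining them
  along the path between them gives a torus in which they are replaced by one face whose label \<open>U\<close> is trivial
  in \<open>G\<^sub>i\<^sub>-\<^sub>1\<close>; it can be filled with faces of rank less than \<open>i\<close>. Since \<open>U\<close> is conjugate to a commutator,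
  the filling can also be put on a torus of its own, so its signed sums vanish by induction.\<close>

section \<open>Cycles of permutations\<close>

text \<open>Disk diagrams are avoided: a face with an arbitrary label is made a 0-face by attaching
  lollipops whose product cancels its value in G. So the face obtained by joining may carry a label
  that is neither in O nor a relator. Neither the signs nor the number of the faces used in the
  filling are controlled. The signs force the second torus; the number forces the multiset order, in
  which two faces of rank i outweigh any number of faces of lower rank. Gluing and pinching amount
  to composing \<open>nxt\<close> with one transposition, and the cycles of \<open>nxt\<close> and
  \<open>rot\<close> give the Euler characteristic. Fillings use representatives only: by induction
  on the level, every element of the kernel for G_k has as value in G a product of conjugates of
  representatives of rank at most k. For the quotient, the vanishing of the sums makes exponent sums
  depend only on the value in G. This gives injectivity of the map from the free abelian group; the
  rest is formal.\<close>

definition cycle :: "('a \<Rightarrow> 'a) \<Rightarrow> 'a list \<Rightarrow> bool"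
  where "cycle p c \<longleftrightarrow> c \<noteq> [] \<and> successively (\<lambda>x y. p x = y) c \<and> p (last c) = hd c"

text \<open>Explicit lists, with an order and starting points, replace the set of orbits, so that
  the effect of a transposition on the cycles becomes a rearrangement of lists. Distinctness is
  required here once for all cycles together, rather than in \<open>cycle\<close>.\<close>

definition cycle_dec :: "('a \<Rightarrow> 'a) \<Rightarrow> 'a set \<Rightarrow> 'a list list \<Rightarrow> bool"
  where "cycle_dec p D cs \<longleftrightarrow> distinct (concat cs) \<and> set (concat cs) = D \<and> (\<forall>c\<in>set cs. cycle p c)"

definition orbs :: "('a \<Rightarrow> 'a) \<Rightarrow> 'a set \<Rightarrow> nat"
  where "orbs p D = card (orbit p ` D)"

lemma cycle_not_Nil: "cycle p c \<Longrightarrow> c \<noteq> []"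
  by (simp add: cycle_def)

lemma cycle_decD:
  assumes "cycle_dec p D cs"
  shows "distinct (concat cs)" "set (concat cs) = D" "\<And>c. c \<in> set cs \<Longrightarrow> cycle p c"
      "\<And>c. c \<in> set cs \<Longrightarrow> c \<noteq> []"
  using assms unfolding cycle_dec_def by (blast dest: cycle_not_Nil)+

lemma cycle_append_commute: "cycle p (us @ vs) \<Longrightarrow> cycle p (vs @ us)"
  by (cases "us = []"; cases "vs = []") (auto simp: cycle_def successively_append_iff)

lemma successively_cong':
  assumes "\<And>x. x \<in> set c \<Longrightarrow> p x = q x"
  shows "successively (\<lambda>x y. p x = y) c \<longleftrightarrow> successively (\<lambda>x y. q x = y) c"
  by (rule successively_cong) (use assms in auto)

lemma cycle_cong:
  assumes "\<And>x. x \<in> set c \<Longrightarrow> p x = q x"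
  shows "cycle p c \<longleftrightarrow> cycle q c"
  unfolding cycle_def using successively_cong'[of c p q] assms by (auto simp: last_in_set)

lemma cycle_dec_cong:
  assumes "\<And>x. x \<in> D \<Longrightarrow> p x = q x"
  shows "cycle_dec p D cs \<longleftrightarrow> cycle_dec q D cs"
proof -
  have "cycle p c = cycle q c" if "c \<in> set cs" "set (concat cs) = D" for c
    by (rule cycle_cong) (use that assms in auto)
  then show ?thesis by (auto simp: cycle_dec_def)
qed

lemma cycle_rotate:
  assumes "x \<in> set c"
  obtains n us where "rotate n c = x # us" "n < length c"
proof -
  obtain ys zs where c: "c = ys @ x # zs" using assms by (meson split_list)
  have "rotate (length ys) c = x # zs @ ys" by (simp add: c rotate_append)
  then show ?thesis using that c by simp
qed

lemma cycle_rotate_iff: "cycle p c \<Longrightarrow> cycle p (rotate n c)"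
proof (induction n)
  case (Suc n)
  then have "cycle p (rotate n c)" by simp
  then have "cycle p (rotate1 (rotate n c))"
    using cycle_append_commute[of p "[hd (rotate n c)]" "tl (rotate n c)"]
    by (cases "rotate n c") (auto simp: cycle_def)
  then show ?case by simp
qed simp

lemma cycle_funpow:
  assumes "cycle p c" "k < length c"
  shows "(p ^^ k) (hd c) = c ! k"
  using assms(2)
proof (induction k)
  case 0 then show ?case using assms by (simp add: hd_conv_nth cycle_def)
next
  case (Suc k)
  have "p (c ! k) = c ! Suc k"
    using assms(1) Suc.prems by (auto simp: cycle_def successively_conv_nth)
  then show ?case using Suc by simp
qed

lemma cycle_orbit_hd:
  assumes "cycle p c"
  shows "orbit p (hd c) = set c"
proof
  have step: "p x \<in> set c" if xc: "x \<in> set c" for x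
  proof -
    obtain k where k: "k < length c" "x = c ! k" using xc by (auto simp: in_set_conv_nth)
    show ?thesis
    proof (cases "Suc k < length c")
      case True
      then have "p x = c ! Suc k" using assms k by (auto simp: cycle_def successively_conv_nth)
      then show ?thesis using True by simp
    next
      case False
      then have "k = length c - 1" "c \<noteq> []" using k by auto
      then have "x = last c" using k by (simp add: last_conv_nth)
      then show ?thesis using assms by (auto simp: cycle_def)
    qed
  qed
  show "orbit p (hd c) \<subseteq> set c"
  proof
    fix y assume "y \<in> orbit p (hd c)"
    then show "y \<in> set c" by induction (use assms step in \<open>auto simp: cycle_def\<close>)
  qed
  show "set c \<subseteq> orbit p (hd c)"
  proof
    fix y assume "y \<in> set c"
    then obtain k where k: "k < length c" "y = c ! k" by (auto simp: in_set_conv_nth)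
    have l: "0 < length c" using k(1) by linarith
    \<comment> \<open>A full turn is added because \<open>orbit\<close> collects only iterates with
      positive exponent, while \<open>k\<close> may be 0.\<close>
    have "(p ^^ length c) (hd c) = hd c"
      using cycle_funpow[OF assms, of "length c - 1"] assms l
      by (cases "length c") (auto simp: cycle_def last_conv_nth)
    then have "y = (p ^^ (k + length c)) (hd c)"
      using cycle_funpow[OF assms k(1)] k by (simp add: funpow_add)
    then show "y \<in> orbit p (hd c)" using l by (auto simp: orbit_altdef)
  qed
qed

lemma cycle_orbit:
  assumes "cycle p c" "x \<in> set c"
  shows "orbit p x = set c"
proof -
  obtain n us where n: "rotate n c = x # us" by (rule cycle_rotate[OF assms(2)])
  have "orbit p (hd (rotate n c)) = set (rotate n c)"
    by (rule cycle_orbit_hd[OF cycle_rotate_iff[OF assms(1)]])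
  moreover have "hd (rotate n c) = x" by (simp only: n list.sel)
  ultimately show ?thesis by (simp only: set_rotate)
qed

lemma cycle_dec_orbit:
  assumes "cycle_dec p D cs" "c \<in> set cs" "x \<in> set c"
  shows "orbit p x = set c"
  by (rule cycle_orbit[OF cycle_decD(3)[OF assms(1,2)] assms(3)])

lemma cycle_dec_orbits:
  assumes "cycle_dec p D cs"
  shows "orbit p ` D = set ` set cs"
proof (intro equalityI subsetI)
  fix A assume "A \<in> orbit p ` D"
  then obtain x where x: "x \<in> D" "A = orbit p x" by blast
  then obtain c where c: "c \<in> set cs" "x \<in> set c" using cycle_decD(2)[OF assms] by auto
  then show "A \<in> set ` set cs" using x(2) cycle_dec_orbit[OF assms c]
      by (intro image_eqI[of _ _ c]) simp_all
next
  fix A assume "A \<in> set ` set cs"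
  then obtain c where c: "c \<in> set cs" "A = set c" by blast
  then have h: "hd c \<in> set c" using cycle_decD(4)[OF assms] by simp
  then have "hd c \<in> D" using c cycle_decD(2)[OF assms] by auto
  moreover have "A = orbit p (hd c)" using c(2) cycle_dec_orbit[OF assms c(1) h] by simp
  ultimately show "A \<in> orbit p ` D" by blast
qed

lemma distinct_map_set:
  "distinct (concat cs) \<Longrightarrow> [] \<notin> set cs \<Longrightarrow> distinct (map set cs)"
proof (induction cs)
  case (Cons c cs)
  obtain x where x: "x \<in> set c" using Cons.prems(2) by (cases c) auto
  have "x \<notin> set d" if "d \<in> set cs" for d using Cons.prems(1) x that by auto
  then have "set c \<notin> set ` set cs" using x by force
  then show ?case using Cons by simp
qed simp

lemma cycle_dec_distinct_sets:
  assumes "cycle_dec p D cs"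
  shows "distinct (map set cs)"
  by (rule distinct_map_set) (use cycle_decD[OF assms] in blast)+

lemma cycle_dec_orbs:
  assumes "cycle_dec p D cs"
  shows "orbs p D = length cs"
proof -
  have "orbs p D = card (set (map set cs))" using cycle_dec_orbits[OF assms] by (simp add: orbs_def)
  then show ?thesis using distinct_card[OF cycle_dec_distinct_sets[OF assms]] by simp
qed

lemma cycle_dec_mset:
  assumes "cycle_dec p D cs" "mset cs' = mset cs"
  shows "cycle_dec p D cs'"
proof -
  have "mset (concat cs') = mset (concat cs)" using assms(2)
      by (metis mset_concat mset_map sum_mset_sum_list)
  then show ?thesis using assms mset_eq_setD[OF assms(2)]
    unfolding cycle_dec_def by (metis mset_eq_imp_distinct_iff set_mset_mset)
qed

lemma cycle_dec_rotate:
  assumes "cycle_dec p D (c # cs)"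
  shows "cycle_dec p D (rotate n c # cs)"
  using assms cycle_rotate_iff[of p c n] by (auto simp: cycle_dec_def)

lemma cycle_dec_append_commute:
  assumes "cycle_dec p D ((us @ vs) # cs)"
  shows "cycle_dec p D ((vs @ us) # cs)"
  using cycle_dec_rotate[OF assms, of "length us"] by (simp add: rotate_append)

text \<open>Normal form used throughout: the cycle of interest stands first and ends in
  \<open>x\<close>. Ending in \<open>x\<close> is the convenient choice because composing with a
  transposition on the right changes what follows \<open>x\<close>.\<close>

lemma cycle_dec_head:
  assumes "cycle_dec p D cs" "x \<in> D"
  obtains us cs' where "cycle_dec p D ((us @ [x]) # cs')" "set (us @ [x]) = orbit p x"
proof -
  obtain c where c: "c \<in> set cs" "x \<in> set c" using assms by (auto simp: cycle_dec_def)
  obtain ys zs where cs: "cs = ys @ c # zs" using c by (meson split_list)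
  obtain us vs where cc: "c = us @ [x] @ vs" using c by (metis append_Cons append_Nil split_list)
  have "cycle_dec p D (((us @ [x]) @ vs) # ys @ zs)"
    by (rule cycle_dec_mset[OF assms(1)]) (simp add: cs cc)
  then have d: "cycle_dec p D ((vs @ us @ [x]) # ys @ zs)" by (rule cycle_dec_append_commute)
  show ?thesis
    by (rule that[of "vs @ us"]) (use d cycle_dec_orbit[OF d, of "vs @ us @ [x]" x] in auto)
qed

lemma cycle_dec_head2:
  assumes "cycle_dec p D cs" "x \<in> D" "y \<in> D" "orbit p x \<noteq> orbit p y"
  obtains us vs cs' where "cycle_dec p D ((us @ [x]) # (vs @ [y]) # cs')"
    "set (us @ [x]) = orbit p x" "set (vs @ [y]) = orbit p y"
proof -
  obtain us cs' where 1: "cycle_dec p D ((us @ [x]) # cs')" "set (us @ [x]) = orbit p x"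
    by (rule cycle_dec_head[OF assms(1,2)])
  then have "y \<notin> set (us @ [x])" using cycle_dec_orbit[OF 1(1), of "us @ [x]" y] assms(4) by auto
  then have "y \<in> set (concat cs')" using 1(1) assms(3) by (auto simp: cycle_dec_def)
  then obtain c where c: "c \<in> set cs'" "y \<in> set c" by auto
  obtain ys zs where cs: "cs' = ys @ c # zs" using c by (meson split_list)
  obtain vs ws where cc: "c = vs @ [y] @ ws" using c by (metis append_Cons append_Nil split_list)
  have "cycle_dec p D (((vs @ [y]) @ ws) # (us @ [x]) # ys @ zs)"
    by (rule cycle_dec_mset[OF 1(1)]) (simp add: cs cc)
  then have "cycle_dec p D ((ws @ vs @ [y]) # (us @ [x]) # ys @ zs)"
      by (rule cycle_dec_append_commute)
  then have d: "cycle_dec p D ((us @ [x]) # (ws @ vs @ [y]) # ys @ zs)"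
    by (rule cycle_dec_mset) simp
  show ?thesis
    by (rule that[of us "ws @ vs"]) (use d 1 cycle_dec_orbit[OF d, of "ws @ vs @ [y]" y] in auto)
qed

lemma cycle_dec_head_same:
  assumes "cycle_dec p D cs" "x \<in> D" "y \<in> D" "orbit p x = orbit p y" "x \<noteq> y"
  obtains us vs cs' where "cycle_dec p D ((us @ [x] @ vs @ [y]) # cs')"
    "set (us @ [x] @ vs @ [y]) = orbit p y"
proof -
  obtain us cs' where 1: "cycle_dec p D ((us @ [y]) # cs')" "set (us @ [y]) = orbit p y"
    by (rule cycle_dec_head[OF assms(1,3)])
  have "x \<in> D" by fact
  then have "x \<in> set (concat ((us @ [y]) # cs'))" using cycle_decD(2)[OF 1(1)] by simp
  then obtain c where c: "c \<in> set ((us @ [y]) # cs')" "x \<in> set c" unfolding set_concat by blast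
  then have "x \<in> orbit p x" using cycle_dec_orbit[OF 1(1)] by metis
  then have "x \<in> set us" using 1 assms by auto
  then obtain u1 u2 where "us = u1 @ [x] @ u2" by (metis append_Cons append_Nil split_list)
  then show ?thesis using that[of u1 u2 cs'] 1 by simp
qed

text \<open>By induction on the number of points. The permutation \<open>?q\<close> short-circuits a
  point \<open>y\<close>: it fixes \<open>y\<close> and sends the predecessor of \<open>y\<close>
  directly to \<open>p y\<close>.\<close>

lemma cycle_dec_exists:
  assumes "finite D" "p permutes D"
  shows "\<exists>cs. cycle_dec p D cs"
  using assms
proof (induction "card D" arbitrary: D p)
  case 0
  then have "D = {}" by simp
  then show ?case by (intro exI[of _ "[]"]) (simp add: cycle_dec_def)
next
  case (Suc n)
  then obtain y where y: "y \<in> D" by fastforce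
  let ?q = "transpose y (p y) \<circ> p"
  have q: "?q permutes (D - {y})"
  proof -
    have "p permutes insert y (D - {y})" using Suc.prems y by (simp add: insert_absorb)
    then show ?thesis by (rule permutes_insert_lemma)
  qed
  have "n = card (D - {y})" "finite (D - {y})" using Suc y by auto
  from Suc(1)[OF this q] obtain cs where cs: "cycle_dec ?q (D - {y}) cs" by blast
  have qp: "?q x = (if p x = y then p y else p x)" if "x \<noteq> y" for x
    using that Suc.prems(2) by (auto simp: transpose_def dest: permutes_inj injD)
  show ?case
  proof (cases "p y = y")
    case True
    have "cycle_dec p (D - {y}) cs" using cs
      by (subst cycle_dec_cong[of _ _ ?q]) (auto simp: True)
    then have "cycle_dec p D ([y] # cs)" using True y by (auto simp: cycle_dec_def cycle_def)
    then show ?thesis by blast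
  next
    case False
    \<comment> \<open>The predecessor of \<open>y\<close>. The cycle of \<open>?q\<close> through it
      is rotated to end in \<open>?x\<close>, and \<open>y\<close> is put back behind it.\<close>
    let ?x = "inv_into UNIV p y"
    have x: "p ?x = y" "?x \<noteq> y" using False Suc.prems(2) by (auto simp: permutes_inverses)
      (metis permutes_inverses(1))
    have "?x \<in> D - {y}" using x y Suc.prems(2)
        by (metis Diff_iff empty_iff insert_iff permutes_in_image)
    then obtain us cs' where d: "cycle_dec ?q (D - {y}) ((us @ [?x]) # cs')"
      using cycle_dec_head[OF cs] by metis
    have nx: "p z \<noteq> y" if "z \<noteq> ?x" for z using that Suc.prems(2) x by (metis permutes_inverses(2))
    have same: "?q z = p z" if "z \<noteq> y" "z \<noteq> ?x" for z using qp[OF that(1)] nx[OF that(2)] by simp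
    have dist: "distinct (concat ((us @ [?x]) # cs'))" "y \<notin> set (concat ((us @ [?x]) # cs'))"
      using d by (auto simp: cycle_dec_def)
    have c1: "cycle p c" if "c \<in> set cs'" for c
    proof -
      have "cycle ?q c" using d that by (auto simp: cycle_dec_def)
      moreover have "?x \<notin> set c" "y \<notin> set c" using dist that by auto
      ultimately show ?thesis using cycle_cong[of c ?q p] same by metis
    qed
    have c: "cycle ?q (us @ [?x])" using d by (auto simp: cycle_dec_def)
    have "?q ?x = p y" using qp[OF x(2)] x by simp
    have su: "successively (\<lambda>x y. p x = y) us"
    proof -
      have "successively (\<lambda>x y. ?q x = y) us" using c
          by (simp add: cycle_def successively_append_iff)
      moreover have "\<And>z. z \<in> set us \<Longrightarrow> ?q z = p z" by (rule same; use dist in auto)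
      ultimately show ?thesis using successively_cong'[of us ?q p] by blast
    qed
    have "us \<noteq> [] \<Longrightarrow> p (last us) = ?q (last us)"
      by (rule same[symmetric]) (use dist last_in_set[of us] in \<open>auto simp del: last_in_set\<close>)
    then have "cycle p (us @ [?x, y])"
      using c su x \<open>?q ?x = p y\<close> by (auto simp: cycle_def successively_append_iff hd_append)
    then have "cycle_dec p D ((us @ [?x, y]) # cs')"
      using c1 dist d y by (auto simp: cycle_dec_def)
    then show ?thesis by blast
  qed
qed

text \<open>After the transposition \<open>x\<close> is followed by \<open>p y\<close>, the head of
  the second cycle, and \<open>y\<close> by \<open>p x\<close>, the head of the first; all other
  points keep their successors.\<close>

lemma swap_append_cycle:
  assumes "cycle_dec p D ((us @ [x]) # (vs @ [y]) # cs)"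
  shows "cycle_dec (p \<circ> transpose x y) D ((us @ [x] @ vs @ [y]) # cs)"
proof -
  let ?q = "p \<circ> transpose x y"
  have dist: "distinct (concat ((us @ [x]) # (vs @ [y]) # cs))" using assms
      by (simp add: cycle_dec_def)
  have same: "?q z = p z" if "z \<noteq> x" "z \<noteq> y" for z using that by (simp add: transpose_def)
  have "cycle ?q c" if "c \<in> set cs" for c
  proof -
    have "cycle p c" using assms that by (auto simp: cycle_dec_def)
    moreover have "x \<notin> set c" "y \<notin> set c" using dist that by auto
    ultimately show ?thesis using cycle_cong[of c ?q p] same by metis
  qed
  moreover have "cycle ?q (us @ [x] @ vs @ [y])"
  proof -
    have c: "cycle p (us @ [x])" "cycle p (vs @ [y])" using assms by (auto simp: cycle_dec_def)
    have uv0: "\<And>z. z \<in> set us \<Longrightarrow> ?q z = p z" "\<And>z. z \<in> set vs \<Longrightarrow> ?q z = p z"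
      by (rule same; use dist in auto)+
    have uv: "successively (\<lambda>x y. ?q x = y) us = successively (\<lambda>x y. p x = y) us"
      "successively (\<lambda>x y. ?q x = y) vs = successively (\<lambda>x y. p x = y) vs"
      using successively_cong'[of us ?q p, OF uv0(1)] successively_cong'[of vs ?q p, OF uv0(2)]
        by blast+
    then have u: "successively (\<lambda>x y. ?q x = y) us" and v: "successively (\<lambda>x y. ?q x = y) vs"
      using c unfolding uv by (auto simp: cycle_def successively_append_iff)
    have lu: "us \<noteq> [] \<Longrightarrow> ?q (last us) = p (last us)"
      by (rule same) (use dist last_in_set[of us] in auto)
    have lv: "vs \<noteq> [] \<Longrightarrow> ?q (last vs) = p (last vs)"
      by (rule same) (use dist last_in_set[of vs] in auto)
    have "?q x = p y" "?q y = p x" by simp_all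
    then show ?thesis using c u v lu lv
      by (cases "us = []"; cases "vs = []") (simp_all add: cycle_def successively_append_iff successively_Cons hd_append del: comp_apply)
  qed
  ultimately show ?thesis using assms by (auto simp: cycle_dec_def)
qed

text \<open>The same exchange inside one cycle: \<open>x\<close> now jumps to \<open>p y\<close>,
  the head of the whole list, and \<open>y\<close> to \<open>p x\<close>, the point after
  \<open>x\<close>, so each of the two segments closes up.\<close>

lemma swap_split_cycle:
  assumes "cycle_dec p D ((us @ [x] @ vs @ [y]) # cs)"
  shows "cycle_dec (p \<circ> transpose x y) D ((us @ [x]) # (vs @ [y]) # cs)"
proof -
  let ?q = "p \<circ> transpose x y"
  have dist: "distinct (concat ((us @ [x] @ vs @ [y]) # cs))" using assms
      by (simp add: cycle_dec_def)
  have same: "?q z = p z" if "z \<noteq> x" "z \<noteq> y" for z using that by (simp add: transpose_def)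
  have "cycle ?q c" if "c \<in> set cs" for c
  proof -
    have "cycle p c" using assms that by (auto simp: cycle_dec_def)
    moreover have "x \<notin> set c" "y \<notin> set c" using dist that by auto
    ultimately show ?thesis using cycle_cong[of c ?q p] same by metis
  qed
  moreover have "cycle ?q (us @ [x])" "cycle ?q (vs @ [y])"
  proof -
    have c: "cycle p (us @ [x] @ vs @ [y])" using assms by (auto simp: cycle_dec_def)
    have uv0: "\<And>z. z \<in> set us \<Longrightarrow> ?q z = p z" "\<And>z. z \<in> set vs \<Longrightarrow> ?q z = p z"
      by (rule same; use dist in auto)+
    have uv: "successively (\<lambda>x y. ?q x = y) us = successively (\<lambda>x y. p x = y) us"
      "successively (\<lambda>x y. ?q x = y) vs = successively (\<lambda>x y. p x = y) vs"
      using successively_cong'[of us ?q p, OF uv0(1)] successively_cong'[of vs ?q p, OF uv0(2)]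
        by blast+
    then have u: "successively (\<lambda>x y. ?q x = y) us" and v: "successively (\<lambda>x y. ?q x = y) vs"
      using c unfolding uv by (auto simp: cycle_def successively_append_iff successively_Cons)
    have lu: "us \<noteq> [] \<Longrightarrow> ?q (last us) = p (last us)"
      by (rule same) (use dist last_in_set[of us] in auto)
    have lv: "vs \<noteq> [] \<Longrightarrow> ?q (last vs) = p (last vs)"
      by (rule same) (use dist last_in_set[of vs] in auto)
    have "?q x = p y" "?q y = p x" by simp_all
    then show "cycle ?q (us @ [x])" "cycle ?q (vs @ [y])" using c u v lu lv
      by (cases "us = []"; cases "vs = []"; simp_all add: cycle_def successively_append_iff successively_Cons hd_append del: comp_apply)+
  qed
  ultimately show ?thesis using assms by (auto simp: cycle_dec_def)
qed

lemma orbs_swap_merge: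
  assumes "finite D" "p permutes D" "x \<in> D" "y \<in> D" "orbit p x \<noteq> orbit p y"
  shows "Suc (orbs (p \<circ> transpose x y) D) = orbs p D"
proof -
  obtain cs where "cycle_dec p D cs" using cycle_dec_exists assms by blast
  then obtain us vs cs' where d: "cycle_dec p D ((us @ [x]) # (vs @ [y]) # cs')"
    using cycle_dec_head2 assms by metis
  show ?thesis using cycle_dec_orbs[OF d] cycle_dec_orbs[OF swap_append_cycle[OF d]] by simp
qed

text \<open>The second conclusion serves for vertices: splitting one vertex leaves all the others
  unchanged as sets of darts.\<close>

lemma orbs_swap_split:
  assumes "finite D" "p permutes D" "x \<in> D" "y \<in> D" "orbit p x = orbit p y" "x \<noteq> y"
  shows "orbs (p \<circ> transpose x y) D = Suc (orbs p D)"
    and "\<And>z. z \<in> D \<Longrightarrow> z \<notin> orbit p x \<Longrightarrow> orbit (p \<circ> transpose x y) z = orbit p z"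
proof -
  obtain cs where "cycle_dec p D cs" using cycle_dec_exists assms by blast
  then obtain us vs cs' where d: "cycle_dec p D ((us @ [x] @ vs @ [y]) # cs')"
    "set (us @ [x] @ vs @ [y]) = orbit p y"
    using cycle_dec_head_same assms by metis
  note e = swap_split_cycle[OF d(1)]
  show "orbs (p \<circ> transpose x y) D = Suc (orbs p D)"
    using cycle_dec_orbs[OF d(1)] cycle_dec_orbs[OF e] by simp
  fix z assume z: "z \<in> D" "z \<notin> orbit p x"
  then have "z \<notin> set (us @ [x] @ vs @ [y])" using d assms by simp
  then obtain c where "c \<in> set cs'" "z \<in> set c" using z d(1) by (auto simp: cycle_dec_def)
  then show "orbit (p \<circ> transpose x y) z = orbit p z"
    using cycle_dec_orbit[OF d(1), of c z] cycle_dec_orbit[OF e, of c z] by simp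
qed

section \<open>Inserting a point into a cycle\<close>

definition insert_after :: "'a \<Rightarrow> 'a \<Rightarrow> ('a \<Rightarrow> 'a) \<Rightarrow> 'a \<Rightarrow> 'a"
  where "insert_after x y p = p(x := y, y := p x)"

text \<open>An insertion is thereby a special merge: the new point is first a cycle of its own,
  which a transposition joins to the cycle of \<open>x\<close>.\<close>

lemma insert_after_eq: "p y = y \<Longrightarrow> x \<noteq> y \<Longrightarrow> insert_after x y p = p \<circ> transpose x y"
  by (auto simp: insert_after_def transpose_def)

lemma cycle_dec_add_fixed:
  assumes "cycle_dec p D cs" "p y = y" "y \<notin> D"
  shows "cycle_dec p (insert y D) ([y] # cs)"
  using assms by (auto simp: cycle_dec_def cycle_def)

lemma cycle_dec_insert_after:
  assumes "cycle_dec p D ((us @ [x]) # cs)" "p y = y" "y \<notin> D"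
  shows "cycle_dec (insert_after x y p) (insert y D) ((us @ [x, y]) # cs)"
proof -
  have "cycle_dec p (insert y D) ((us @ [x]) # ([] @ [y]) # cs)"
    using cycle_dec_mset[OF cycle_dec_add_fixed[OF assms]] by auto
  from swap_append_cycle[OF this] show ?thesis
    using assms by (subst insert_after_eq) (auto simp: cycle_dec_def)
qed

lemma permutes_insert_after:
  assumes "p permutes D" "y \<notin> D" "x \<in> D"
  shows "insert_after x y p permutes (insert y D)"
proof -
  have "transpose x y permutes insert y D" using assms by (simp add: permutes_swap_id)
  moreover have "p permutes insert y D" using assms(1) by (rule permutes_subset) auto
  ultimately show ?thesis using assms permutes_compose
    by (subst insert_after_eq) (auto simp: permutes_not_in)
qed

lemma orbs_add_fixed:
  assumes "finite D" "p permutes D" "y \<notin> D"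
  shows "orbs p (insert y D) = Suc (orbs p D)"
proof -
  obtain cs where cs: "cycle_dec p D cs" using cycle_dec_exists assms by blast
  have "p y = y" using assms by (simp add: permutes_not_in)
  show ?thesis
    using cycle_dec_orbs[OF cs] cycle_dec_orbs[OF cycle_dec_add_fixed[OF cs \<open>p y = y\<close> assms(3)]]
    by simp
qed

lemma orbs_insert_after:
  assumes "finite D" "p permutes D" "x \<in> D" "y \<notin> D"
  shows "orbs (insert_after x y p) (insert y D) = orbs p D"
    and "\<And>z. z \<in> D \<Longrightarrow> orbit (insert_after x y p) z = (if x \<in> orbit p z then insert y (orbit p z) else orbit p z)"
proof -
  obtain cs0 where cs0: "cycle_dec p D cs0" using cycle_dec_exists assms by blast
  obtain us cs where d: "cycle_dec p D ((us @ [x]) # cs)" using cycle_dec_head[OF cs0 assms(3)]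
      by metis
  have "p y = y" using assms by (simp add: permutes_not_in)
  note e = cycle_dec_insert_after[OF d this assms(4)]
  show "orbs (insert_after x y p) (insert y D) = orbs p D"
    using cycle_dec_orbs[OF d] cycle_dec_orbs[OF e] by simp
  fix z assume z: "z \<in> D"
  then consider "z \<in> set (us @ [x])" | c where "c \<in> set cs" "z \<in> set c" using d
      by (auto simp: cycle_dec_def)
  then show "orbit (insert_after x y p) z = (if x \<in> orbit p z then insert y (orbit p z) else orbit p z)"
  proof cases
    case 1
    have "orbit p z = set (us @ [x])" using cycle_dec_orbit[OF d, of "us @ [x]" z] 1 by simp
    moreover have "orbit (insert_after x y p) z = set (us @ [x,y])"
      using cycle_dec_orbit[OF e, of "us @ [x,y]" z] 1 by auto
    ultimately show ?thesis by auto
  next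
    case 2
    have "orbit p z = set c" "orbit (insert_after x y p) z = set c"
      using cycle_dec_orbit[OF d, of c z] cycle_dec_orbit[OF e, of c z] 2 by auto
    moreover have "x \<notin> set c" using d 2 by (auto simp: cycle_dec_def)
    ultimately show ?thesis by simp
  qed
qed

section \<open>Formal inverses of words\<close>

lemma inv_word_Nil [simp]: "inv_word [] = []"
  by (simp add: inv_word_def)

lemma inv_word_Cons: "inv_word (l # w) = inv_word w @ [inv_letter l]"
  by (simp add: inv_word_def)

lemma inv_word_append: "inv_word (u @ v) = inv_word v @ inv_word u"
  by (simp add: inv_word_def)

lemma inv_word_inv_word [simp]: "inv_word (inv_word w) = w"
  by (simp add: inv_word_def rev_map comp_def)

lemma inv_word_eq_Nil [simp]: "inv_word w = [] \<longleftrightarrow> w = []"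
  by (simp add: inv_word_def)

lemma words_append [simp]: "u @ v \<in> words A \<longleftrightarrow> u \<in> words A \<and> v \<in> words A"
  by (auto simp: words_def)

lemma words_Cons [simp]: "l # v \<in> words A \<longleftrightarrow> l \<in> A \<times> UNIV \<and> v \<in> words A"
  by (auto simp: words_def)

lemma words_Nil [simp]: "[] \<in> words A"
  by (auto simp: words_def)

lemma inv_letter_in [simp]: "inv_letter l \<in> A \<times> UNIV \<longleftrightarrow> l \<in> A \<times> UNIV"
  by (auto simp: inv_letter_def mem_Times_iff)

lemma inv_word_in_words [simp]: "inv_word w \<in> words A \<longleftrightarrow> w \<in> words A"
  by (induction w) (auto simp: inv_word_Cons)

section \<open>Combinatorial maps\<close>

definition premap :: "'a diagram \<Rightarrow> bool"
  where "premap M \<longleftrightarrow> finite (darts M) \<and> opp M permutes darts M \<and> nxt M permutes darts M \<and>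
    (\<forall>d\<in>darts M. opp M d \<noteq> d \<and> opp M (opp M d) = d)"

text \<open>Connectedness is expressed through invariant sets instead of chains of darts: to
  transfer it through an operation, it suffices to turn an invariant set of the new map into one of
  the old map.\<close>

definition conn :: "'a diagram \<Rightarrow> bool"
  where "conn M \<longleftrightarrow> (\<forall>S\<subseteq>darts M. S \<noteq> {} \<longrightarrow> opp M ` S \<subseteq> S \<longrightarrow> nxt M ` S \<subseteq> S \<longrightarrow> S = darts M)"

lemma conn_iff:
  assumes "premap M"
  shows "conn M \<longleftrightarrow> (\<forall>d\<in>darts M. \<forall>e\<in>darts M.
      (d, e) \<in> ({(x, opp M x) | x. x \<in> darts M} \<union> {(x, nxt M x) | x. x \<in> darts M})\<^sup>*)"
    (is "_ \<longleftrightarrow> (\<forall>d\<in>_. \<forall>e\<in>_. (d, e) \<in> ?r\<^sup>*)")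
proof
  assume c: "conn M"
  show "\<forall>d\<in>darts M. \<forall>e\<in>darts M. (d, e) \<in> ?r\<^sup>*"
  proof (intro ballI)
    fix d e assume d: "d \<in> darts M" "e \<in> darts M"
    let ?S = "{z \<in> darts M. (d, z) \<in> ?r\<^sup>*}"
    have in_darts: "opp M z \<in> darts M" "nxt M z \<in> darts M" if "z \<in> darts M" for z
      using assms that by (auto simp: premap_def permutes_in_image)
    have st: "(d, opp M z) \<in> ?r\<^sup>*" "(d, nxt M z) \<in> ?r\<^sup>*" if "(d, z) \<in> ?r\<^sup>*" "z \<in> darts M" for z
      using that by (auto intro: rtrancl_into_rtrancl)
    have "opp M ` ?S \<subseteq> ?S" "nxt M ` ?S \<subseteq> ?S" using in_darts st by blast+
    moreover have "d \<in> ?S" using d by simp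
    moreover have "?S \<subseteq> darts M" by blast
    ultimately have "?S = darts M" using c unfolding conn_def by blast
    then show "(d, e) \<in> ?r\<^sup>*" using d by blast
  qed
next
  assume r: "\<forall>d\<in>darts M. \<forall>e\<in>darts M. (d, e) \<in> ?r\<^sup>*"
  show "conn M" unfolding conn_def
  proof (intro allI impI)
    fix S assume S: "S \<subseteq> darts M" "S \<noteq> {}" "opp M ` S \<subseteq> S" "nxt M ` S \<subseteq> S"
    then obtain d where d: "d \<in> S" by blast
    have "e \<in> S" if e: "e \<in> darts M" for e
    proof -
      have "(d, e) \<in> ?r\<^sup>*" using r d S e by blast
      then show ?thesis by induction (use d S in auto)
    qed
    then show "S = darts M" using S by blast
  qed
qed

lemma labelled_map_iff:
  "labelled_map A M \<longleftrightarrow> premap M \<and> darts M \<noteq> {} \<and> conn M \<and> lab M \<in> darts M \<rightarrow>\<^sub>E A \<times> UNIV \<and>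
    (\<forall>d\<in>darts M. lab M (opp M d) = inv_letter (lab M d))"
proof (cases "premap M")
  case True
  show ?thesis unfolding labelled_map_def conn_iff[OF True, symmetric] using True
    unfolding premap_def by blast
next
  case False then show ?thesis by (auto simp: labelled_map_def premap_def)
qed

lemma premapD:
  assumes "premap M"
  shows "finite (darts M)" "opp M permutes darts M" "nxt M permutes darts M"
      "rot M permutes darts M"
    "opp M (opp M d) = d" "d \<in> darts M \<Longrightarrow> opp M d \<noteq> d" "opp M d \<in> darts M \<longleftrightarrow> d \<in> darts M"
    "nxt M d \<in> darts M \<longleftrightarrow> d \<in> darts M" "opp M d = opp M e \<longleftrightarrow> d = e"
proof -
  show p: "finite (darts M)" "opp M permutes darts M" "nxt M permutes darts M"
    "d \<in> darts M \<Longrightarrow> opp M d \<noteq> d" using assms by (auto simp: premap_def)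
  show "opp M d \<in> darts M \<longleftrightarrow> d \<in> darts M" "nxt M d \<in> darts M \<longleftrightarrow> d \<in> darts M"
    using p by (simp_all add: permutes_in_image)
  show "opp M (opp M d) = d" using assms p
    by (cases "d \<in> darts M") (auto simp: premap_def permutes_not_in)
  show "opp M d = opp M e \<longleftrightarrow> d = e" using permutes_inj[OF p(2)] by (auto dest: injD)
  have "rot M = nxt M \<circ> opp M" by (auto simp: rot_def)
  then show "rot M permutes darts M" using permutes_compose[OF p(2,3)] by simp
qed

lemma permutes_self_in_orbit: "finite D \<Longrightarrow> p permutes D \<Longrightarrow> x \<in> orbit p x"
  by (rule permutation_self_in_orbit) (auto simp: permutation_permutes)

lemma card_edges:
  assumes "premap M"
  shows "2 * card (edges M) = card (darts M)"
proof -
  have "2 * card (edges M) = card (\<Union> (edges M))"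
  proof (rule card_partition)
    show "finite (edges M)" "finite (\<Union> (edges M))"  using premapD(1)[OF assms]
      by (auto simp: edges_def)
    show "card c = 2" if c: "c \<in> edges M" for c
    proof -
      obtain d where d: "d \<in> darts M" "c = {d, opp M d}" using c by (auto simp: edges_def)
      then show ?thesis using premapD(6)[OF assms d(1)] by simp
    qed
    show "c1 \<inter> c2 = {}" if c: "c1 \<in> edges M" "c2 \<in> edges M" "c1 \<noteq> c2" for c1 c2
    proof -
      obtain d1 d2 where d: "c1 = {d1, opp M d1}" "c2 = {d2, opp M d2}" using c(1,2)
          by (auto simp: edges_def)
      have o: "opp M (opp M d1) = d1" "opp M (opp M d2) = d2" by (rule premapD(5)[OF assms])+
      show ?thesis
      proof (rule ccontr)
        assume "c1 \<inter> c2 \<noteq> {}"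
        then have "d1 = d2 \<or> d1 = opp M d2 \<or> opp M d1 = d2 \<or> opp M d1 = opp M d2" using d by blast
        then have "d2 = d1 \<or> d2 = opp M d1" using o by metis
        then show False using c(3) d o by auto
      qed
    qed
  qed
  moreover have "\<Union> (edges M) = darts M"
  proof (intro equalityI subsetI)
    fix z assume "z \<in> \<Union> (edges M)"
    then obtain d where "d \<in> darts M" "z = d \<or> z = opp M d" by (auto simp: edges_def)
    then show "z \<in> darts M" using premapD(7)[OF assms] by blast
  next
    fix z assume "z \<in> darts M"
    then show "z \<in> \<Union> (edges M)" unfolding edges_def by blast
  qed
  ultimately show ?thesis by simp
qed

lemma euler_char_eq:
  assumes "premap M"
  shows "euler_char M = int (orbs (rot M) (darts M)) - int (card (darts M) div 2) + int (orbs (nxt M) (darts M))"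
proof -
  have "vertices M = orbit (rot M) ` darts M" "faces M = orbit (nxt M) ` darts M"
    by (auto simp: vertices_def origin_def faces_def face_of_def)
  then show ?thesis unfolding euler_char_def orbs_def using card_edges[OF assms] by simp
qed

section \<open>Operations on maps\<close>

text \<open>Composing \<open>nxt\<close> with the transposition of \<open>x\<close> and \<open>y\<close> composes \<open>rot\<close> with the transposition of
  their reverses: it joins or splits the two faces, and it joins or splits the two end vertices.
  The Euler characteristic is kept exactly if one of the two is a join and the other a split.\<close>

definition swap_nxt :: "nat \<Rightarrow> nat \<Rightarrow> 'a diagram \<Rightarrow> 'a diagram"
  where "swap_nxt x y M = M\<lparr>nxt := nxt M \<circ> transpose x y\<rparr>"

lemma swap_nxt_simps [simp]:
  "darts (swap_nxt x y M) = darts M" "opp (swap_nxt x y M) = opp M" "lab (swap_nxt x y M) = lab M"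
  "nxt (swap_nxt x y M) = nxt M \<circ> transpose x y"
  by (simp_all add: swap_nxt_def)

text \<open>Since \<open>rot\<close> is \<open>nxt\<close> after \<open>opp\<close>, moving the
  transposition past the involution \<open>opp\<close> conjugates it.\<close>

lemma swap_nxt_rot:
  assumes "premap M"
  shows "rot (swap_nxt x y M) = rot M \<circ> transpose (opp M x) (opp M y)"
  by (rule ext) (auto simp: rot_def transpose_def premapD(5)[OF assms])

lemma swap_nxt_premap:
  assumes "premap M" "x \<in> darts M" "y \<in> darts M"
  shows "premap (swap_nxt x y M)"
  using assms permutes_compose[OF permutes_swap_id premapD(3)[OF assms(1)]]
  by (auto simp: premap_def)

lemma orbit_swap_merge:
  assumes "finite D" "p permutes D" "x \<in> D" "y \<in> D" "orbit p x \<noteq> orbit p y"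
  shows "y \<in> orbit (p \<circ> transpose x y) x" "x \<in> orbit (p \<circ> transpose x y) y"
proof -
  obtain cs where cs: "cycle_dec p D cs" using cycle_dec_exists assms by blast
  obtain us vs cs' where d: "cycle_dec p D ((us @ [x]) # (vs @ [y]) # cs')"
    by (rule cycle_dec_head2[OF cs assms(3,4,5)])
  show "y \<in> orbit (p \<circ> transpose x y) x" "x \<in> orbit (p \<circ> transpose x y) y"
    using cycle_dec_orbit[OF swap_append_cycle[OF d], of "us @ [x] @ vs @ [y]"] by auto
qed

lemma orbit_closed:
  assumes "p ` S \<subseteq> S" "x \<in> S"
  shows "orbit p x \<subseteq> S"
proof
  fix y assume "y \<in> orbit p x" then show "y \<in> S" by induction (use assms in auto)
qed

text \<open>If at least one of the two effects is a join, then \<open>x\<close> and \<open>y\<close>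
  lie on a common new cycle of \<open>nxt\<close>, or their reverses on one of \<open>rot\<close>.
  An invariant set therefore contains both or neither, is preserved by the transposition, and so is
  invariant for the old map. With two splits the surface could fall apart.\<close>

lemma swap_nxt_conn:
  assumes "premap M" "conn M" "x \<in> darts M" "y \<in> darts M"
    and m: "orbit (nxt M) x \<noteq> orbit (nxt M) y \<or> orbit (rot M) (opp M x) \<noteq> orbit (rot M) (opp M y)"
  shows "conn (swap_nxt x y M)"
  unfolding conn_def
proof (intro allI impI)
  let ?M = "swap_nxt x y M"
  fix S assume S: "S \<subseteq> darts ?M" "S \<noteq> {}" "opp ?M ` S \<subseteq> S" "nxt ?M ` S \<subseteq> S"
  note pm = premapD[OF assms(1)]
  have o1: "opp M z \<in> S" if "z \<in> S" for z using S(3) that by auto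
  have o: "opp M z \<in> S \<longleftrightarrow> z \<in> S" for z using o1[of z] o1[of "opp M z"] unfolding pm(5) by blast
  have "rot ?M ` S \<subseteq> S" using S by (auto simp: rot_def)
  have xy: "x \<in> S \<longleftrightarrow> y \<in> S"
    using m
  proof
    assume "orbit (nxt M) x \<noteq> orbit (nxt M) y"
    from orbit_swap_merge[OF pm(1,3) assms(3,4) this]
    show ?thesis using orbit_closed[OF S(4)] by auto
  next
    assume m: "orbit (rot M) (opp M x) \<noteq> orbit (rot M) (opp M y)"
    have "opp M x \<in> darts M" "opp M y \<in> darts M" using pm(7) assms by auto
    from orbit_swap_merge[OF pm(1,4) this m, folded swap_nxt_rot[OF assms(1)]]
    have "opp M x \<in> S \<longleftrightarrow> opp M y \<in> S"
      using orbit_closed[OF \<open>rot ?M ` S \<subseteq> S\<close>, of "opp M x"] orbit_closed[OF \<open>rot ?M ` S \<subseteq> S\<close>, of "opp M y"] by blast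
    then show ?thesis using o[of x] o[of y] by blast
  qed
  have "nxt M z \<in> S" if "z \<in> S" for z
  proof -
    have "transpose x y z \<in> S" using that xy unfolding transpose_def by presburger
    from subsetD[OF S(4) imageI[OF this]] show ?thesis
        by (simp only: swap_nxt_simps comp_apply transpose_involutory)
  qed
  then have "nxt M ` S \<subseteq> S" by (rule image_subsetI)
  then show "S = darts ?M"
      using assms(2)[unfolded conn_def, rule_format, of S, OF S(1)[unfolded swap_nxt_simps] S(2) S(3)[unfolded swap_nxt_simps]]
    unfolding swap_nxt_simps by blast
qed

text \<open>\<open>c\<close> is the Euler characteristic, so that \<open>c = 0\<close> means a torus.\<close>

definition chi_map :: "'a set \<Rightarrow> int \<Rightarrow> 'a diagram \<Rightarrow> bool"
  where "chi_map A c M \<longleftrightarrow> labelled_map A M \<and> euler_char M = c"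

lemma chi_map_premap: "chi_map A c M \<Longrightarrow> premap M"
  by (simp add: chi_map_def labelled_map_iff)

lemma swap_nxt_labelled:
  assumes "labelled_map A M" "x \<in> darts M" "y \<in> darts M"
    "orbit (nxt M) x \<noteq> orbit (nxt M) y \<or> orbit (rot M) (opp M x) \<noteq> orbit (rot M) (opp M y)"
  shows "labelled_map A (swap_nxt x y M)"
  using assms(1) swap_nxt_premap[of M x y] swap_nxt_conn[of M x y] assms(2-4)
  unfolding labelled_map_iff swap_nxt_simps by blast

lemma orbs_swap:
  assumes "finite D" "p permutes D" "x \<in> D" "y \<in> D" "x \<noteq> y"
  shows "int (orbs (p \<circ> transpose x y) D) = int (orbs p D) + (if orbit p x = orbit p y then 1 else -1)"
proof (cases "orbit p x = orbit p y")
  case True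
  then show ?thesis using orbs_swap_split(1)[OF assms(1-4) True assms(5)] by simp
next
  case False
  then show ?thesis using orbs_swap_merge[OF assms(1-4) False] by simp
qed

lemma swap_nxt_euler:
  assumes "premap M" "x \<in> darts M" "y \<in> darts M" "x \<noteq> y"
  shows "euler_char (swap_nxt x y M) = euler_char M
     + (if orbit (nxt M) x = orbit (nxt M) y then 1 else -1)
     + (if orbit (rot M) (opp M x) = orbit (rot M) (opp M y) then 1 else -1)"
proof -
  note pm = premapD[OF assms(1)]
  have o: "opp M x \<in> darts M" "opp M y \<in> darts M" "opp M x \<noteq> opp M y" using pm(7,9) assms by auto
  note 1 = orbs_swap[OF pm(1,3) assms(2-4)]
  note 2 = orbs_swap[OF pm(1,4) o, folded swap_nxt_rot[OF assms(1)]]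
  show ?thesis unfolding euler_char_eq[OF assms(1)] euler_char_eq[OF swap_nxt_premap[OF assms(1-3)]]
    using 1 2 by simp
qed

section \<open>Growing edges and paths inside a face\<close>

definition hang :: "nat \<Rightarrow> nat \<Rightarrow> 'a letter \<Rightarrow> nat \<Rightarrow> 'a diagram \<Rightarrow> 'a diagram"
  where "hang e e' l x M = \<lparr>darts = insert e' (insert e (darts M)), opp = (opp M)(e := e', e' := e),
    nxt = insert_after e e' (insert_after x e (nxt M)), lab = (lab M)(e := l, e' := inv_letter l)\<rparr>"

lemma hang_simps [simp]:
  "darts (hang e e' l x M) = insert e' (insert e (darts M))"
    "opp (hang e e' l x M) = (opp M)(e := e', e' := e)"
  "nxt (hang e e' l x M) = insert_after e e' (insert_after x e (nxt M))"
  "lab (hang e e' l x M) = (lab M)(e := l, e' := inv_letter l)"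
  by (simp_all add: hang_def)

lemma permutes_new_pair:
  assumes "p permutes D" "a \<notin> D" "b \<notin> D" "a \<noteq> b"
  shows "p(a := b, b := a) permutes insert b (insert a D)"
proof -
  have "p(a := b, b := a) = p \<circ> transpose a b"
    using assms by (auto simp: transpose_def permutes_not_in)
  moreover have "transpose a b permutes insert b (insert a D)" by (simp add: permutes_swap_id)
  moreover have "p permutes insert b (insert a D)" using assms(1) by (rule permutes_subset) auto
  ultimately show ?thesis using permutes_compose by metis
qed

context
  fixes M :: "'a diagram" and x e e' :: nat and l :: "'a letter"
  assumes pm0: "premap M" and x: "x \<in> darts M" and e: "e \<notin> darts M" "e' \<notin> darts M" "e \<noteq> e'"
begin

lemma hang_premap: "premap (hang e e' l x M)"
proof -
  note pm = premapD[OF pm0]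
  have "insert_after e e' (insert_after x e (nxt M)) permutes insert e' (insert e (darts M))"
    by (intro permutes_insert_after) (use pm x e in auto)
  moreover have "(opp M)(e := e', e' := e) permutes insert e' (insert e (darts M))"
    using permutes_new_pair[OF pm(2) e(1,2,3)] by simp
  moreover have "opp M d \<noteq> e" "opp M d \<noteq> e'" if "d \<in> darts M" for d using e pm(7)[of d] that by auto
  ultimately show ?thesis using pm e unfolding premap_def by auto
qed

text \<open>The corner behind \<open>x\<close> on its face is the corner behind
  \<open>opp M x\<close> at its end vertex, and \<open>e\<close> is inserted there. The reverse
  \<open>e'\<close> stays fixed by \<open>rot\<close>: it is the new vertex of degree one.\<close>

lemma hang_rot: "rot (hang e e' l x M) = insert_after (opp M x) e (rot M)"
proof
  note pm = premapD[OF pm0]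
  fix z
  have n: "nxt M e = e" "nxt M e' = e'" "opp M e = e" "opp M e' = e'"
    using pm(2,3) e by (auto simp: permutes_not_in)
  have "opp M z = e \<longleftrightarrow> z = e" using pm(9)[of z e] n by simp
  moreover have "opp M z = e' \<longleftrightarrow> z = e'" using pm(9)[of z e'] n by simp
  moreover have "opp M z = x \<longleftrightarrow> z = opp M x" using pm(9)[of z "opp M x"] pm(5)[of x] by simp
  moreover have "x \<noteq> e" "x \<noteq> e'" "opp M x \<noteq> e" "opp M x \<noteq> e'" using x e pm(7)[of x] by auto
  ultimately show "rot (hang e e' l x M) z = insert_after (opp M x) e (rot M) z"
    using e(3) n pm(5) by (auto simp: rot_def insert_after_def)
qed

text \<open>One vertex and one edge are added, and the number of faces stays the same.\<close>

lemma hang_euler: "euler_char (hang e e' l x M) = euler_char M"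
proof -
  note pm = premapD[OF pm0]
  have ox: "opp M x \<in> darts M" using pm(7) x by simp
  have "orbs (insert_after e e' (insert_after x e (nxt M))) (insert e' (insert e (darts M)))
    = orbs (insert_after x e (nxt M)) (insert e (darts M))"
    by (rule orbs_insert_after(1)) (use pm permutes_insert_after[OF pm(3) e(1) x] e x in auto)
  also have "\<dots> = orbs (nxt M) (darts M)"
    by (rule orbs_insert_after(1)) (use pm e x in auto)
  finally have f: "orbs (nxt (hang e e' l x M)) (darts (hang e e' l x M)) = orbs (nxt M) (darts M)" by simp
  have "orbs (insert_after (opp M x) e (rot M)) (insert e' (insert e (darts M))) =
    Suc (orbs (insert_after (opp M x) e (rot M)) (insert e (darts M)))"
    by (rule orbs_add_fixed) (use pm e ox permutes_insert_after[OF pm(4) e(1) ox] in auto)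
  also have "orbs (insert_after (opp M x) e (rot M)) (insert e (darts M)) = orbs (rot M) (darts M)"
    by (rule orbs_insert_after(1)) (use pm e ox in auto)
  finally have v: "orbs (rot (hang e e' l x M)) (darts (hang e e' l x M)) = Suc (orbs (rot M) (darts M))"
    unfolding hang_rot by simp
  have "card (darts (hang e e' l x M)) = card (darts M) + 2" using e pm(1) by simp
  then show ?thesis unfolding euler_char_eq[OF hang_premap] euler_char_eq[OF pm0] f v by simp
qed

text \<open>The old darts in an invariant set form an invariant set of the old map, because the
  detour from \<open>x\<close> through \<open>e\<close> and \<open>e'\<close> returns to
  \<open>nxt M x\<close>. The same detour shows that the set cannot consist of new darts
  only.\<close>

lemma hang_conn:
  assumes "conn M" shows "conn (hang e e' l x M)"
  unfolding conn_def
proof (intro allI impI)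
  let ?M = "hang e e' l x M"
  note pm = premapD[OF pm0]
  fix S assume S: "S \<subseteq> darts ?M" "S \<noteq> {}" "opp ?M ` S \<subseteq> S" "nxt ?M ` S \<subseteq> S"
  have ne: "x \<noteq> e" "x \<noteq> e'" using x e by auto
  have nx: "nxt ?M x = e" "nxt ?M e = e'" "nxt ?M e' = nxt M x"
    using e ne by (auto simp: insert_after_def)
  have ns: "nxt ?M z = nxt M z" if "z \<in> darts M" "z \<noteq> x" for z using that e ne
      by (auto simp: insert_after_def)
  let ?T = "S \<inter> darts M"
  have "opp M ` ?T \<subseteq> ?T"
  proof
    fix z assume "z \<in> opp M ` ?T"
    then obtain w where w: "w \<in> S" "w \<in> darts M" "z = opp M w" by blast
    then have "opp ?M w \<in> S" using S(3) by blast
    moreover have "w \<noteq> e" "w \<noteq> e'" using e w by auto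
    ultimately show "z \<in> ?T" using w pm(7) by simp
  qed
  moreover have "nxt M ` ?T \<subseteq> ?T"
  proof
    fix z assume "z \<in> nxt M ` ?T"
    then obtain w where w: "w \<in> S" "w \<in> darts M" "z = nxt M w" by blast
    then have zd: "z \<in> darts M" using pm(8) by simp
    show "z \<in> ?T"
    proof (cases "w = x")
      case True
      then have "e \<in> S" using S(4) w nx(1) by (metis image_subset_iff)
      then have "e' \<in> S" using S(4) w nx(2) by (metis image_subset_iff)
      then have "nxt M x \<in> S" using S(4) w nx(3) by (metis image_subset_iff)
      then show ?thesis using w True zd by simp
    next
      case False
      then have "nxt ?M w = z" using ns w by simp
      then show ?thesis using w S(4) zd by blast
    qed
  qed
  moreover have "?T \<noteq> {}"
  proof -
    have "e' \<in> S \<Longrightarrow> nxt M x \<in> S" using S(4) nx(3) by (metis image_subset_iff)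
    moreover have "e \<in> S \<Longrightarrow> e' \<in> S" using S(4) nx(2) by (metis image_subset_iff)
    moreover have "nxt M x \<in> darts M" using pm(8) x by simp
    ultimately show ?thesis using S(1,2) by auto
  qed
  ultimately have T: "?T = darts M" using assms unfolding conn_def by blast
  then have "x \<in> S" using x by blast
  then have "e \<in> S" using S(4) nx(1) by (metis image_subset_iff)
  then have "e' \<in> S" using S(4) nx(2) by (metis image_subset_iff)
  show "S = darts ?M" using T \<open>e \<in> S\<close> \<open>e' \<in> S\<close> S(1) by auto
qed

end

lemma hang_chi_map:
  assumes "chi_map A c M" "x \<in> darts M" "e \<notin> darts M" "e' \<notin> darts M" "e \<noteq> e'" "l \<in> A \<times> UNIV"
  shows "chi_map A c (hang e e' l x M)"
proof -
  have pm0: "premap M" using assms(1) by (rule chi_map_premap)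
  note pm = premapD[OF pm0]
  have L: "lab M \<in> darts M \<rightarrow>\<^sub>E A \<times> UNIV"
      "\<And>d. d \<in> darts M \<Longrightarrow> lab M (opp M d) = inv_letter (lab M d)" "conn M"
    using assms(1) by (auto simp: chi_map_def labelled_map_iff)
  have "lab (hang e e' l x M) \<in> darts (hang e e' l x M) \<rightarrow>\<^sub>E A \<times> UNIV"
    using L(1) assms(6) by (auto simp: PiE_def extensional_def Pi_def inv_letter_def mem_Times_iff)
  moreover have "lab (hang e e' l x M) (opp (hang e e' l x M) d) = inv_letter (lab (hang e e' l x M) d)"
    if dd: "d \<in> darts (hang e e' l x M)" for d
  proof -
    consider "d = e" | "d = e'" | "d \<in> darts M" "d \<noteq> e" "d \<noteq> e'" using dd assms(3,4) by auto
    then show ?thesis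
    proof cases
      case 3
      then have "opp M d \<noteq> e" "opp M d \<noteq> e'" using pm(7)[of d] assms by auto
      then show ?thesis using 3 L(2) by simp
    qed (use assms in auto)
  qed
  ultimately show ?thesis using hang_premap[OF pm0 assms(2-5)] hang_euler[OF pm0 assms(2-5)]
      hang_conn[OF pm0 assms(2-5) L(3)] assms(1) by (auto simp: chi_map_def labelled_map_iff)
qed

section \<open>Faces as lists of darts\<close>

abbreviation facelist :: "'a diagram \<Rightarrow> nat list list \<Rightarrow> bool"
  where "facelist M fs \<equiv> cycle_dec (nxt M) (darts M) fs"

lemma hang_facelist:
  assumes "premap M" "e \<notin> darts M" "e' \<notin> darts M" "e \<noteq> e'" "facelist M ((us @ [x]) # fs)"
  shows "facelist (hang e e' l x M) ((us @ [x, e, e']) # fs)"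
proof -
  note pm = premapD[OF assms(1)]
  have x: "x \<in> darts M" using cycle_decD(2)[OF assms(5)] by auto
  have "nxt M e = e" "nxt M e' = e'" using pm(3) assms by (auto simp: permutes_not_in)
  have 1: "cycle_dec (insert_after x e (nxt M)) (insert e (darts M)) ((us @ [x, e]) # fs)"
    by (rule cycle_dec_insert_after) (use assms \<open>nxt M e = e\<close> in auto)
  have "insert_after x e (nxt M) e' = e'" using assms x \<open>nxt M e' = e'\<close>
      by (auto simp: insert_after_def)
  from cycle_dec_insert_after[of "insert_after x e (nxt M)" "insert e (darts M)"
      "us @ [x]" e fs e', OF _ this]
  show ?thesis using 1 assms by simp
qed

lemma ex_new_pair:
  assumes "finite D"
  shows "\<exists>a b :: nat. a \<notin> D \<and> b \<notin> D \<and> a \<noteq> b"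
proof -
  obtain a where a: "a \<notin> D" using ex_new_if_finite[OF infinite_UNIV_nat assms] by blast
  obtain b where b: "b \<notin> insert a D"
      using ex_new_if_finite[OF infinite_UNIV_nat, of "insert a D"] assms by blast
  show ?thesis using a b by auto
qed

text \<open>The edges of the path are grown one after another at the current tip, so the face runs
  out along \<open>p\<close> and back along \<open>q\<close>. The equation at the turning point
  records that the tip has degree one, which is needed to close the path to a loop later.\<close>

lemma attach_path:
  assumes "chi_map A c M" "facelist M ((us @ [x]) # fs)" "w \<in> words A"
  shows "\<exists>M' p q. chi_map A c M' \<and> facelist M' ((us @ [x] @ p @ q) # fs) \<and> map (lab M') p = w \<and>
    map (lab M') q = inv_word w \<and> (w \<noteq> [] \<longrightarrow> opp M' (last p) = hd q) \<and>
    (\<forall>z\<in>darts M. lab M' z = lab M z \<and> opp M' z = opp M z)"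
  using assms
proof (induction w arbitrary: M us x)
  case Nil
  then show ?case by (intro exI[of _ M] exI[of _ "[]"]) simp
next
  case (Cons l w)
  note pm = premapD[OF chi_map_premap[OF Cons.prems(1)]]
  obtain e e' where e: "e \<notin> darts M" "e' \<notin> darts M" "e \<noteq> e'" using ex_new_pair[OF pm(1)] by blast
  have x: "x \<in> darts M" using cycle_decD(2)[OF Cons.prems(2)] by auto
  let ?M = "hang e e' l x M"
  have g: "chi_map A c ?M" by (rule hang_chi_map) (use Cons.prems x e in auto)
  have f: "facelist ?M ((us @ [x, e, e']) # fs)"
      by (rule hang_facelist) (use Cons.prems e chi_map_premap in auto)
  have lo: "\<forall>z\<in>darts M. lab ?M z = lab M z \<and> opp ?M z = opp M z" using e by auto
  have l: "lab ?M e = l" "lab ?M e' = inv_letter l" "opp ?M e = e'" using e by auto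
  show ?case
  proof (cases "w = []")
    case True
    then show ?thesis by (intro exI[of _ ?M] exI[of _ "[e]"] exI[of _ "[e']"])
      (use g f lo l in \<open>auto simp: inv_word_Cons\<close>)
  next
    case False
    have "facelist ?M (((us @ [x, e]) @ [e']) # fs)" using f by simp
    \<comment> \<open>The face is rotated to end in \<open>e\<close>, so that the next edge grows at
      the new tip.\<close>
    from cycle_dec_append_commute[OF this] have "facelist ?M ((([e'] @ us @ [x]) @ [e]) # fs)"
        by simp
    from Cons.IH[OF g this] obtain M' p q where
      M': "chi_map A c M'" "facelist M' ((([e'] @ us @ [x]) @ [e] @ p @ q) # fs)"
        "map (lab M') p = w"
      "map (lab M') q = inv_word w" "opp M' (last p) = hd q"
        "\<forall>z\<in>darts ?M. lab M' z = lab ?M z \<and> opp M' z = opp ?M z"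
      using Cons.prems(3) False by auto
    have "facelist M' (([e'] @ us @ [x, e] @ p @ q) # fs)" using M'(2) by simp
    from cycle_dec_append_commute[OF this] have f': "facelist M' ((us @ [x] @ (e # p) @ (q @ [e'])) # fs)" by simp
    have "map (lab M') p \<noteq> []" "map (lab M') q \<noteq> []" unfolding M'(3,4) using False by simp_all
    then have "p \<noteq> []" "q \<noteq> []" by simp_all
    then show ?thesis by (intro exI[of _ M'] exI[of _ "e # p"] exI[of _ "q @ [e']"])
      (use M' f' lo l in \<open>auto simp: inv_word_Cons\<close>)
  qed
qed


lemma facelist_in_darts: "facelist M fs \<Longrightarrow> c \<in> set fs \<Longrightarrow> set c \<subseteq> darts M"
  using cycle_decD(2) by fastforce

lemma facelist_head: "facelist M (c # fs) \<Longrightarrow> set c \<subseteq> darts M"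
  using facelist_in_darts by (metis list.set_intros(1))

lemma facelist_head2: "facelist M (c # c' # fs) \<Longrightarrow> set c' \<subseteq> darts M"
  using facelist_in_darts[of M "c # c' # fs" c'] by simp

lemma facelist_orbit: "facelist M (c # fs) \<Longrightarrow> x \<in> set c \<Longrightarrow> orbit (nxt M) x = set c"
  by (erule cycle_dec_orbit) simp_all

lemma facelist_orbit2: "facelist M (c # c' # fs) \<Longrightarrow> x \<in> set c' \<Longrightarrow> orbit (nxt M) x = set c'"
  by (erule cycle_dec_orbit) simp_all

lemma facelist_nxt: "facelist M ((us @ [x, y] @ vs) # fs) \<Longrightarrow> nxt M x = y"
  by (auto simp: cycle_dec_def cycle_def successively_append_iff)

text \<open>The two different end vertices of \<open>x\<close> and \<open>y\<close> are glued inside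
  their common face, which is pinched into two: one vertex less and one face more.\<close>

lemma split_face:
  assumes "chi_map A c M" "facelist M ((us @ [x] @ vs @ [y]) # fs)"
    "orbit (rot M) (opp M x) \<noteq> orbit (rot M) (opp M y)"
  shows "chi_map A c (swap_nxt x y M)" "facelist (swap_nxt x y M) ((us @ [x]) # (vs @ [y]) # fs)"
proof -
  have d: "x \<in> darts M" "y \<in> darts M" using facelist_head[OF assms(2)] by auto
  have "x \<noteq> y" using assms(3) by auto
  have o: "orbit (nxt M) x = orbit (nxt M) y"
    using facelist_orbit[OF assms(2), of x] facelist_orbit[OF assms(2), of y] by simp
  show "chi_map A c (swap_nxt x y M)" unfolding chi_map_def
    using swap_nxt_euler[OF chi_map_premap[OF assms(1)] d \<open>x \<noteq> y\<close>] assms o swap_nxt_labelled[of A M x y] d by (simp add: chi_map_def)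
  show "facelist (swap_nxt x y M) ((us @ [x]) # (vs @ [y]) # fs)"
    using swap_split_cycle[OF assms(2)] by simp
qed

text \<open>If \<open>x\<close> and \<open>y\<close> end at the same vertex, joining their faces
  splits this vertex and the surface stays the same. If they end at different vertices, these are
  joined as well, which adds a handle; only \<open>commutator_torus\<close> makes use of that
  case.\<close>

lemma merge_faces:
  assumes "chi_map A c M" "facelist M ((us @ [x]) # (vs @ [y]) # fs)"
  shows "chi_map A (if orbit (rot M) (opp M x) = orbit (rot M) (opp M y) then c else c - 2) (swap_nxt x y M)"
    "facelist (swap_nxt x y M) ((us @ [x] @ vs @ [y]) # fs)"
proof -
  have d: "x \<in> darts M" "y \<in> darts M" using facelist_head[OF assms(2)] facelist_head2[OF assms(2)]
      by auto
  have "y \<notin> set (us @ [x])" using cycle_decD(1)[OF assms(2)] by auto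
  moreover have "orbit (nxt M) x = set (us @ [x])" "orbit (nxt M) y = set (vs @ [y])"
    using facelist_orbit[OF assms(2), of x] facelist_orbit2[OF assms(2), of y] by simp_all
  ultimately have "x \<noteq> y" and o: "orbit (nxt M) x \<noteq> orbit (nxt M) y" by auto
  show "chi_map A (if orbit (rot M) (opp M x) = orbit (rot M) (opp M y) then c else c - 2) (swap_nxt x y M)" unfolding chi_map_def
    using swap_nxt_euler[OF chi_map_premap[OF assms(1)] d \<open>x \<noteq> y\<close>] assms(1) o swap_nxt_labelled[of A M x y] d by (simp add: chi_map_def)
  show "facelist (swap_nxt x y M) ((us @ [x] @ vs @ [y]) # fs)"
    using swap_append_cycle[OF assms(2)] by simp
qed

text \<open>The stem \<open>S\<close> is grown into the face, then a path \<open>Q\<close> from its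
  end, and finally the tip of \<open>Q\<close> is glued to the end of the stem. The inside of the
  resulting loop reads \<open>Q\<close>; the outside face passes the loop along \<open>v\<close> and
  so gains the inverse of \<open>Q\<close>.\<close>

lemma attach_lollipop:
  assumes "chi_map A c M" "facelist M (f # fs)" "S \<in> words A" "Q \<in> words A" "Q \<noteq> []"
  shows "\<exists>M' f' d. chi_map A c M' \<and> facelist M' (f' # d # fs) \<and>
    map (lab M') f' = map (lab M) f @ S @ inv_word Q @ inv_word S \<and> map (lab M') d = Q \<and>
    (\<forall>z\<in>darts M. lab M' z = lab M z)"
proof -
  have "f \<noteq> []" using cycle_decD(4)[OF assms(2)] by simp
  then obtain us x where f: "f = us @ [x]" by (metis rev_exhaust)
  obtain M1 p q where 1: "chi_map A c M1" "facelist M1 ((us @ [x] @ p @ q) # fs)"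
      "map (lab M1) p = S"
    "map (lab M1) q = inv_word S" "\<And>z. z \<in> darts M \<Longrightarrow> lab M1 z = lab M z"
    using attach_path[OF assms(1) assms(2)[unfolded f] assms(3)] by blast
  have "facelist M1 (((us @ [x] @ p) @ q) # fs)" using 1(2) by simp
  then have 2: "facelist M1 ((q @ us @ [x] @ p) # fs)" by (rule cycle_dec_append_commute)
  \<comment> \<open>The rotated face ends at the end of the stem: its last dart \<open>z\<close> is
    the last dart of \<open>p\<close>, or \<open>x\<close> if \<open>S\<close> is empty.\<close>
  define b where "b = q @ us @ [x] @ p"
  have "b \<noteq> []" by (simp add: b_def)
  then obtain vs z where b: "b = vs @ [z]" by (metis rev_exhaust)
  obtain M2 u v where 3: "chi_map A c M2" "facelist M2 ((vs @ [z] @ u @ v) # fs)"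
      "map (lab M2) u = Q"
    "map (lab M2) v = inv_word Q" "opp M2 (last u) = hd v" "\<And>z. z \<in> darts M1 \<Longrightarrow> lab M2 z = lab M1 z"
    using attach_path[OF 1(1) 2[folded b_def, unfolded b] assms(4)] assms(5) by blast
  have "map (lab M2) u \<noteq> []" "map (lab M2) v \<noteq> []" unfolding 3(3,4) using assms(5) by simp_all
  then have uv: "u \<noteq> []" "v \<noteq> []" by simp_all
  then obtain u' y h v' where u: "u = u' @ [y]" and v: "v = h # v'"
      by (metis rev_exhaust neq_Nil_conv)
  have "facelist M2 (((vs @ [z] @ u) @ v) # fs)" using 3(2) by simp
  from cycle_dec_append_commute[OF this] have 4: "facelist M2 (((v @ vs) @ [z] @ u' @ [y]) # fs)"
      by (simp add: u)
  have "nxt M2 y = h" by (rule facelist_nxt[of _ "vs @ [z] @ u'" _ _ v' fs]) (use 3(2) u v in simp)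
  have opy: "opp M2 y = h" using 3(5) u v by simp
  note pm = premapD[OF chi_map_premap[OF 3(1)]]
  \<comment> \<open>The tip of \<open>Q\<close> has degree one, so its vertex is a singleton and
    differs from the end of the stem. This is what allows the two to be glued by splitting the
    face.\<close>
  have "rot M2 (opp M2 y) = opp M2 y" using pm(5)[of y] \<open>nxt M2 y = h\<close> by (simp add: opy rot_def)
  then have oy: "orbit (rot M2) (opp M2 y) = {opp M2 y}" by (simp add: orbit_eq_singleton_iff)
  have "z \<noteq> y" using cycle_decD(1)[OF 4] by auto
  moreover have "opp M2 z \<in> orbit (rot M2) (opp M2 z)" by (rule permutes_self_in_orbit[OF pm(1,4)])
  ultimately have ne: "orbit (rot M2) (opp M2 z) \<noteq> orbit (rot M2) (opp M2 y)" using pm(9)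
      by (auto simp: oy)
  note 5 = split_face[OF 3(1) 4 ne]
  let ?M = "swap_nxt z y M2"
  have "facelist ?M (((v @ q) @ (us @ [x] @ p)) # u # fs)" using 5(2) b b_def u by simp
  from cycle_dec_append_commute[OF this] have 6: "facelist ?M ((us @ [x] @ p @ v @ q) # u # fs)"
      by simp
  have dM1: "set (us @ [x] @ p @ q) \<subseteq> darts M1" using facelist_head[OF 1(2)] by auto
  have dM: "set (us @ [x]) \<subseteq> darts M" using facelist_head[OF assms(2)] f by auto
  have l1: "map (lab M2) r = map (lab M1) r" if "set r \<subseteq> darts M1" for r using that 3(6) by auto
  have l0: "map (lab M1) r = map (lab M) r" if "set r \<subseteq> darts M" for r using that 1(5) by auto
  have "map (lab M2) (us @ [x] @ p @ v @ q) = map (lab M) f @ S @ inv_word Q @ inv_word S"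
    using l1[of "us @ [x]"] l0[of "us @ [x]"] l1[of p] l1[of q] dM1 dM 1(3,4) 3(4) by (auto simp: f)
  moreover have "lab M2 z = lab M z" if "z \<in> darts M" for z
  proof -
    have "z \<in> darts M1"
    proof -
      have "z \<in> set (concat (f # fs))" using cycle_decD(2)[OF assms(2)] that by simp
      then have "z \<in> set (concat ((us @ [x] @ p @ q) # fs))" by (auto simp: f)
      then show ?thesis unfolding cycle_decD(2)[OF 1(2)] .
    qed
    then show ?thesis using 3(6) 1(5) that by simp
  qed
  ultimately show ?thesis using 5(1) 6 3(3)
    by (intro exI[of _ ?M] exI[of _ "us @ [x] @ p @ v @ q"] exI[of _ u]) simp
qed

text \<open>The pair \<open>(S, Q)\<close> stands for a path with label \<open>S\<close> ending in a loop that bounds a new face. The new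
  face has the label \<open>Q\<close>, while the surrounding face gains the inverse factor \<open>S Q\<^sup>-\<^sup>1 S\<^sup>-\<^sup>1\<close>.\<close>

definition lollipops :: "('a word \<times> 'a word) list \<Rightarrow> 'a word"
  where "lollipops L = concat (map (\<lambda>(S, Q). S @ inv_word Q @ inv_word S) L)"

lemma attach_lollipops:
  assumes "chi_map A c M" "facelist M (f # fs)"
    "\<And>S Q. (S, Q) \<in> set L \<Longrightarrow> S \<in> words A \<and> Q \<in> words A \<and> Q \<noteq> []"
  shows "\<exists>M' f' ds. chi_map A c M' \<and> facelist M' (f' # ds @ fs) \<and>
    map (lab M') f' = map (lab M) f @ lollipops L \<and> mset (map (map (lab M')) ds) = mset (map snd L) \<and>
    (\<forall>d\<in>set fs. map (lab M') d = map (lab M) d)"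
  using assms
proof (induction L arbitrary: M f fs)
  case Nil
  then show ?case by (intro exI[of _ M] exI[of _ f] exI[of _ "[]"]) (simp add: lollipops_def)
next
  case (Cons SQ L)
  obtain S Q where SQ: "SQ = (S, Q)" by (cases SQ)
  have SQw: "S \<in> words A" "Q \<in> words A" "Q \<noteq> []" using Cons.prems(3)[of S Q] SQ by auto
  obtain M1 f1 d where 1: "chi_map A c M1" "facelist M1 (f1 # d # fs)"
    "map (lab M1) f1 = map (lab M) f @ S @ inv_word Q @ inv_word S" "map (lab M1) d = Q"
    "\<And>z. z \<in> darts M \<Longrightarrow> lab M1 z = lab M z"
    using attach_lollipop[OF Cons.prems(1,2) SQw] by blast
  obtain M' f' ds where 2: "chi_map A c M'" "facelist M' (f' # ds @ d # fs)"
    "map (lab M') f' = map (lab M1) f1 @ lollipops L"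
      "mset (map (map (lab M')) ds) = mset (map snd L)"
    "\<And>e. e \<in> set (d # fs) \<Longrightarrow> map (lab M') e = map (lab M1) e"
    using Cons.IH[OF 1(1,2)] Cons.prems(3) by (metis list.set_intros(2))
  have old: "map (lab M') e = map (lab M) e" if e: "e \<in> set fs" for e
  proof -
    have "set e \<subseteq> darts M" using facelist_in_darts[OF Cons.prems(2), of e] e by simp
    then have "map (lab M1) e = map (lab M) e" using 1(5) by auto
    then show ?thesis using 2(5)[of e] e by simp
  qed
  have d: "map (lab M') d = Q" using 2(5)[of d] 1(4) by simp
  show ?case
  proof (intro exI conjI ballI)
    show "chi_map A c M'" "facelist M' (f' # (ds @ [d]) @ fs)" using 2 by simp_all
    show "map (lab M') f' = map (lab M) f @ lollipops (SQ # L)" using 2(3) 1(3)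
      by (simp add: SQ lollipops_def)
    show "mset (map (map (lab M')) (ds @ [d])) = mset (map snd (SQ # L))" using 2(4) d
      by (simp add: SQ)
  qed (rule old)
qed

section \<open>A torus with one face and a commutator label\<close>

text \<open>The smallest starting point of all constructions, since a map without darts does not
  encode a surface: two vertices, one edge and one face.\<close>

lemma edge_sphere:
  assumes "l \<in> A \<times> UNIV"
  shows "\<exists>M :: 'a diagram. chi_map A 2 M \<and> facelist M [[0, 1]] \<and> lab M 0 = l \<and> lab M 1 = inv_letter l \<and> opp M 0 = 1"
proof -
  define M :: "'a diagram" where "M = \<lparr>darts = {0, 1}, opp = transpose 0 1, nxt = transpose 0 1,
    lab = (\<lambda>d. if d = 0 then l else if d = 1 then inv_letter l else undefined)\<rparr>"
  have D: "darts M = {0, 1}" "opp M = transpose 0 1" "nxt M = transpose 0 1"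
      by (simp_all add: M_def)
  have pm: "premap M" unfolding premap_def D by (auto simp: permutes_swap_id)
  have f: "facelist M [[0, 1]]" unfolding D by (auto simp: cycle_dec_def cycle_def)
  have "rot M = id" by (rule ext) (simp add: rot_def D)
  then have v: "cycle_dec (rot M) (darts M) [[0], [1]]" unfolding D
      by (auto simp: cycle_dec_def cycle_def)
  have "euler_char M = 2" unfolding euler_char_eq[OF pm] cycle_dec_orbs[OF v] cycle_dec_orbs[OF f]
      by (simp add: D)
  moreover have "conn M" unfolding conn_def D
  proof (intro allI impI)
    fix S :: "nat set" assume S: "S \<subseteq> {0, 1}" "S \<noteq> {}" "transpose 0 1 ` S \<subseteq> S"
    have "transpose 0 1 z \<in> S" if "z \<in> S" for z using S(3) that by blast
    from this[of 0] this[of 1] show "S = {0, 1}" using S(1,2) by auto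
  qed
  moreover have L: "lab M 0 = l" "lab M 1 = inv_letter l" "\<And>d. d \<notin> {0, 1} \<Longrightarrow> lab M d = undefined"
      by (simp_all add: M_def)
  have "lab M \<in> darts M \<rightarrow>\<^sub>E A \<times> UNIV"
  proof (rule PiE_I)
    fix d assume "d \<in> darts M"
    then have "d = 0 \<or> d = 1" by (simp add: D)
    then show "lab M d \<in> A \<times> UNIV" using L assms inv_letter_in by metis
  qed (use L D in simp)
  moreover have "lab M (opp M d) = inv_letter (lab M d)" if "d \<in> darts M" for d
  proof -
    have "d = 0 \<or> d = 1" using that by (simp add: D)
    then show ?thesis using L(1,2) by (elim disjE) (simp_all add: D)
  qed
  moreover have "darts M \<noteq> {}" by (simp add: D)
  ultimately have "chi_map A 2 M" unfolding chi_map_def labelled_map_iff using pm by blast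
  then show ?thesis using f L by (intro exI[of _ M]) (simp add: D)
qed

text \<open>On the sphere the paths \<open>X\<close> and \<open>Y\<close> are grown from a common
  base point, giving a single face. Gluing the end of \<open>X\<close> to the base point creates two
  faces; gluing the end of \<open>Y\<close> to it from the other face joins them again and adds a
  handle.\<close>

lemma commutator_torus:
  assumes X: "X \<in> words A" "X \<noteq> []" and Y: "Y \<in> words A" "Y \<noteq> []"
  shows "\<exists>M f. chi_map A 0 M \<and> facelist M [f] \<and> map (lab M) f = X @ Y @ inv_word X @ inv_word Y"
proof -
  obtain l X' where X': "X = l # X'" using X by (cases X) auto
  obtain M0 :: "'a diagram" where 0: "chi_map A 2 M0" "facelist M0 [[0, 1]]" "lab M0 0 = l"
      "lab M0 1 = inv_letter l" "opp M0 0 = 1"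
    using edge_sphere[of l A] X X' by auto
  have D0: "darts M0 = {0, 1}" using cycle_decD(2)[OF 0(2)] by simp
  have "facelist M0 [[0] @ [1]]" using 0(2) by simp
  from attach_path[OF 0(1) cycle_dec_append_commute[OF this], of X'] X X' obtain M1 p q where
    1: "chi_map A 2 M1" "facelist M1 [[1] @ [0] @ p @ q]" "map (lab M1) p = X'"
    "map (lab M1) q = inv_word X'" "X' \<noteq> [] \<longrightarrow> opp M1 (last p) = hd q"
    "\<And>z. z \<in> darts M0 \<Longrightarrow> lab M1 z = lab M0 z \<and> opp M1 z = opp M0 z"
    by auto
  define P Q where "P = [0] @ p" and "Q = q @ [1]"
  have f1: "facelist M1 [P @ Q]" using cycle_dec_append_commute[OF 1(2)] by (simp add: P_def Q_def)
  have PQ: "map (lab M1) P = X" "map (lab M1) Q = inv_word X"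
    using 1 0 D0 X' by (simp_all add: P_def Q_def inv_word_Cons)
  have oPQ: "opp M1 (last P) = hd Q"
  proof (cases "X' = []")
    case True
    then show ?thesis using 1(3,4) 1(6)[of 0] D0 0(5) by (simp add: P_def Q_def)
  next
    case False
    then have "map (lab M1) p \<noteq> []" "map (lab M1) q \<noteq> []" unfolding 1(3,4) by simp_all
    then show ?thesis using 1(5) False by (simp add: P_def Q_def)
  qed
  have ne: "P \<noteq> []" "Q \<noteq> []" by (simp_all add: P_def Q_def)
  have f1': "facelist M1 [(P @ q) @ [1]]" using f1 by (simp add: Q_def)
  from attach_path[OF 1(1) this Y(1)] Y(2) obtain M2 R S where
    2: "chi_map A 2 M2" "facelist M2 [(P @ q) @ [1] @ R @ S]" "map (lab M2) R = Y"
    "map (lab M2) S = inv_word Y" "opp M2 (last R) = hd S"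
    "\<And>z. z \<in> darts M1 \<Longrightarrow> lab M2 z = lab M1 z \<and> opp M2 z = opp M1 z"
    by auto
  have f2: "facelist M2 [P @ Q @ R @ S]" using 2(2) by (simp add: Q_def)
  have "map (lab M2) R \<noteq> []" "map (lab M2) S \<noteq> []" unfolding 2(3,4) using Y(2) by simp_all
  then have ne': "R \<noteq> []" "S \<noteq> []" by simp_all
  have d1: "set P \<subseteq> darts M1" "set Q \<subseteq> darts M1" using facelist_head[OF f1] by auto
  have l2: "map (lab M2) P = X" "map (lab M2) Q = inv_word X"
  proof -
    have "map (lab M2) P = map (lab M1) P" "map (lab M2) Q = map (lab M1) Q"
      by (rule map_cong[OF refl]; use 2(6) d1 in blast)+
    then show "map (lab M2) P = X" "map (lab M2) Q = inv_word X" using PQ by simp_all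
  qed
  have "last P \<in> darts M1" using d1 ne by auto
  then have oPQ2: "opp M2 (last P) = hd Q" using 2(6) oPQ by simp
  obtain P' x where P': "P = P' @ [x]" using ne by (metis rev_exhaust)
  obtain Q' y where Q': "Q = Q' @ [y]" using ne by (metis rev_exhaust)
  obtain R' z where R': "R = R' @ [z]" using ne' by (metis rev_exhaust)
  obtain h S' where S': "S = h # S'" using ne' by (cases S) auto
  obtain k Q'' where Q'': "Q = k # Q''" using ne by (cases Q) auto
  note pm2 = premapD[OF chi_map_premap[OF 2(1)]]
  have "facelist M2 [(P @ Q) @ (R @ S)]" using f2 by simp
  from cycle_dec_append_commute[OF this] have f3: "facelist M2 [(R @ S @ P') @ [x] @ Q' @ [y]]"
      by (simp add: P' Q')
  have "nxt M2 x = k" by (rule facelist_nxt[of _ "P'" _ _ "Q'' @ R @ S"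
      "[]"]) (use f2 P' Q'' in simp)
  have ox: "opp M2 x = k" using oPQ2 P' Q'' by simp
  have "rot M2 (opp M2 x) = opp M2 x" using pm2(5)[of x] \<open>nxt M2 x = k\<close> by (simp add: rot_def ox)
  then have orx: "orbit (rot M2) (opp M2 x) = {opp M2 x}" by (simp add: orbit_eq_singleton_iff)
  have "x \<noteq> y" using cycle_decD(1)[OF f3] by auto
  moreover have "opp M2 y \<in> orbit (rot M2) (opp M2 y)" by (rule permutes_self_in_orbit[OF pm2(1,4)])
  ultimately have "orbit (rot M2) (opp M2 x) \<noteq> orbit (rot M2) (opp M2 y)" using pm2(9)[of y x]
      unfolding orx by blast
  \<comment> \<open>Now \<open>X\<close> is a loop at the base point. One side is the face
    \<open>Q\<close>; the path for \<open>Y\<close> lies in the face on the other side.\<close>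
  note 3 = split_face[OF 2(1) f3 this]
  let ?M3 = "swap_nxt x y M2"
  have "facelist ?M3 [R @ (S @ P), Q]" using 3(2) by (simp add: P' Q')
  from cycle_dec_append_commute[OF this] have f4: "facelist ?M3 [(S @ P @ R') @ [z], Q' @ [y]]"
      by (simp add: R' Q')
  have "facelist ?M3 [(R' @ [z,h] @ (S' @ P)), Q]" using 3(2) by (simp add: P' Q' R' S')
  then have nz: "nxt ?M3 z = h" by (rule facelist_nxt)
  note pm3 = premapD[OF chi_map_premap[OF 3(1)]]
  have oz: "opp ?M3 z = h" using 2(5) R' S' by simp
  then have "rot ?M3 (opp ?M3 z) = opp ?M3 z" using pm3(5)[of z] nz by (simp only: rot_def)
  then have orz: "orbit (rot ?M3) (opp ?M3 z) = {opp ?M3 z}" by (simp add: orbit_eq_singleton_iff)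
  have "z \<noteq> y" using cycle_decD(1)[OF f4] by auto
  moreover have "opp ?M3 y \<in> orbit (rot ?M3) (opp ?M3 y)"
      by (rule permutes_self_in_orbit[OF pm3(1,4)])
  ultimately have "orbit (rot ?M3) (opp ?M3 z) \<noteq> orbit (rot ?M3) (opp ?M3 y)" using pm3(9)[of y z]
      unfolding orz by blast
  \<comment> \<open>Two faces and two different vertices are joined at once, so the Euler
    characteristic drops from 2 to 0. The base point is approached through the face
    \<open>Q\<close>, hence the order of the factors.\<close>
  then have 4: "chi_map A 0 (swap_nxt z y ?M3)"
      "facelist (swap_nxt z y ?M3) [(S @ P @ R') @ [z] @ Q' @ [y]]"
    using merge_faces[OF 3(1) f4] by simp_all
  have "facelist (swap_nxt z y ?M3) [S @ (P @ R @ Q)]" using 4(2) by (simp add: R' Q')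
  from cycle_dec_append_commute[OF this] have "facelist (swap_nxt z y ?M3) [P @ R @ Q @ S]" by simp
  then show ?thesis using 4(1) l2 2(3,4)
      by (intro exI[of _ "swap_nxt z y ?M3"] exI[of _ "P @ R @ Q @ S"]) simp
qed

section \<open>Doubling an edge\<close>

lemma orbit_subset_perm: "p permutes D \<Longrightarrow> x \<in> D \<Longrightarrow> orbit p x \<subseteq> D"
  by (rule permutes_orbit_subset)

lemma orbit_step_eq:
  assumes "finite D" "p permutes D" "p x = y"
  shows "orbit p x = orbit p y"
proof -
  have "permutation p" using assms by (auto simp: permutation_permutes)
  then show ?thesis using permutation_orbit_step[of p x] assms(3) by simp
qed

lemma orbit_insert_after_eq_iff:
  assumes "finite D" "p permutes D" "x \<in> D" "y \<notin> D" "z \<in> D" "w \<in> D"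
  shows "orbit (insert_after x y p) z = orbit (insert_after x y p) w \<longleftrightarrow> orbit p z = orbit p w"
proof -
  have "y \<notin> orbit p z" "y \<notin> orbit p w" using orbit_subset_perm[OF assms(2)] assms by auto
  moreover have "x \<in> orbit p z \<longleftrightarrow> x \<in> orbit p w" if "orbit p z = orbit p w" using that by simp
  ultimately show ?thesis
    unfolding orbs_insert_after(2)[OF assms(1-4) assms(5)] orbs_insert_after(2)[OF assms(1-4) assms(6)]
    by (cases "x \<in> orbit p z"; cases "x \<in> orbit p w") (simp_all add: insert_ident, blast+)
qed

lemma orbit_eq_of_mem:
  assumes "finite D" "p permutes D" "u \<in> D" "z \<in> orbit p u"
  shows "orbit p z = orbit p u"
proof -
  obtain cs where cs: "cycle_dec p D cs" using cycle_dec_exists[OF assms(1,2)] by blast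
  obtain us cs' where d: "cycle_dec p D ((us @ [u]) # cs')" "set (us @ [u]) = orbit p u"
    by (rule cycle_dec_head[OF cs assms(3)])
  have "z \<in> set (us @ [u])" unfolding d(2) by fact
  from cycle_dec_orbit[OF d(1) _ this] show ?thesis unfolding d(2) by simp
qed

text \<open>The case of a single edge in \<open>cut_along\<close>, with the same convention:
  \<open>a\<close> becomes the reverse of \<open>t\<close>, and \<open>b\<close> runs parallel to
  \<open>t\<close>. The two copies of the edge bound the digon \<open>[b, a]\<close>.\<close>

definition cut1 :: "nat \<Rightarrow> nat \<Rightarrow> nat \<Rightarrow> 'a diagram \<Rightarrow> 'a diagram"
  where "cut1 a b t M = \<lparr>darts = insert a (insert b (darts M)),
    opp = (opp M)(t := a, a := t, opp M t := b, b := opp M t),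
    nxt = (nxt M)(a := b, b := a), lab = (lab M)(a := inv_letter (lab M t), b := lab M t)\<rparr>"

lemma cut1_simps [simp]:
  "darts (cut1 a b t M) = insert a (insert b (darts M))"
  "opp (cut1 a b t M) = (opp M)(t := a, a := t, opp M t := b, b := opp M t)"
  "nxt (cut1 a b t M) = (nxt M)(a := b, b := a)"
  "lab (cut1 a b t M) = (lab M)(a := inv_letter (lab M t), b := lab M t)"
  by (simp_all add: cut1_def)

context
  fixes M :: "'a diagram" and a b t :: nat
  assumes pm0: "premap M" and t: "t \<in> darts M" and ab: "a \<notin> darts M" "b \<notin> darts M" "a \<noteq> b"
begin

private lemma facts: "opp M t \<in> darts M" "opp M t \<noteq> t" "opp M t \<noteq> a" "opp M t \<noteq> b" "t \<noteq> a" "t \<noteq> b"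
  "opp M (opp M t) = t" "nxt M a = a" "nxt M b = b" "opp M a = a" "opp M b = b" "t \<noteq> opp M t"
  using premapD[OF pm0] premapD(6)[OF pm0 t] premapD(6)[OF pm0 t, symmetric] t ab
    by (auto simp: permutes_not_in)

lemma cut1_opp:
  "opp (cut1 a b t M) t = a" "opp (cut1 a b t M) a = t" "opp (cut1 a b t M) (opp M t) = b"
    "opp (cut1 a b t M) b = opp M t"
  "z \<noteq> t \<Longrightarrow> z \<noteq> opp M t \<Longrightarrow> z \<in> darts M \<Longrightarrow> opp (cut1 a b t M) z = opp M z"
  using facts ab by auto

lemma cut1_premap: "premap (cut1 a b t M)"
proof -
  note pm = premapD[OF pm0]
  let ?M = "cut1 a b t M"
  have inv: "opp ?M d \<noteq> d \<and> opp ?M (opp ?M d) = d \<and> opp ?M d \<in> darts ?M" if d: "d \<in> darts ?M" for d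
  proof -
    consider "d = a" | "d = b" | "d = t" | "d = opp M t" | "d \<in> darts M" "d \<noteq> t" "d \<noteq> opp M t"
      using d by auto
    then show ?thesis
    proof cases
      case 5
      then have "opp M d \<in> darts M" "opp M d \<noteq> d" "opp M (opp M d) = d" using pm(5,6,7)[of d]
          by auto
      moreover have "opp M d \<noteq> t" "opp M d \<noteq> opp M t" using 5 pm(9)[of d t] pm(5)[of d] by auto
      moreover have "opp ?M d = opp M d" using cut1_opp(5) 5 by blast
      ultimately show ?thesis using cut1_opp(5)[of "opp M d"] by auto
    qed (use facts ab cut1_opp(1-4) t in \<open>simp_all only: cut1_simps(1), auto\<close>)
  qed
  have out: "opp ?M d = d" if "d \<notin> darts ?M" for d
  proof -
    have "d \<noteq> a" "d \<noteq> b" "d \<notin> darts M" using that by simp_all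
    moreover from this have "d \<noteq> t" "d \<noteq> opp M t" using t facts(1) by metis+
    ultimately show ?thesis using permutes_not_in[OF pm(2), of d]
        by (simp only: cut1_simps fun_upd_apply if_False not_False_eq_True simp_thms)
  qed
  have "opp ?M permutes darts ?M"
  proof (rule bij_imp_permutes)
    show "bij_betw (opp ?M) (darts ?M) (darts ?M)"
      by (rule bij_betw_byWitness[of _ "opp ?M"]) (use inv in blast)+
  qed (rule out)
  moreover have "nxt ?M permutes darts ?M" using permutes_new_pair[OF pm(3) ab]
      by (simp add: insert_commute)
  ultimately show ?thesis using inv pm(1) unfolding premap_def by simp
qed

text \<open>Each end of the edge gets one more dart: \<open>b\<close> next to \<open>t\<close> at
  the origin, and \<open>a\<close> next to the reverse of \<open>t\<close> at the terminus. No
  vertex is created or split, also if the edge is a loop.\<close>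

lemma cut1_rot: "rot (cut1 a b t M) = insert_after (opp M t) a (insert_after t b (rot M))"
proof
  note pm = premapD[OF pm0]
  fix z
  consider "z = a" | "z = b" | "z = t" | "z = opp M t" | "z \<notin> {a, b, t, opp M t}" by auto
  then show "rot (cut1 a b t M) z = insert_after (opp M t) a (insert_after t b (rot M)) z"
  proof cases
    case 5
    have "opp M z \<noteq> a" "opp M z \<noteq> b" using 5 pm(9)[of z a] pm(9)[of z b] facts by auto
    then show ?thesis using 5 by (auto simp: rot_def insert_after_def)
  qed (use facts ab in \<open>auto simp: rot_def insert_after_def\<close>)
qed

lemma cut1_facelist:
  assumes "facelist M fs"
  shows "facelist (cut1 a b t M) ([b, a] # fs)"
proof -
  have "cycle_dec (nxt (cut1 a b t M)) (darts M) fs"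
    using assms by (subst cycle_dec_cong[of _ _ "nxt M"]) (use ab in auto)
  then show ?thesis using ab by (auto simp: cycle_dec_def cycle_def)
qed

lemma cut1_orbit_eq_iff:
  assumes "z \<in> darts M" "w \<in> darts M"
  shows "orbit (rot (cut1 a b t M)) z = orbit (rot (cut1 a b t M)) w \<longleftrightarrow> orbit (rot M) z = orbit (rot M) w"
proof -
  note pm = premapD[OF pm0]
  have "orbit (insert_after (opp M t) a (insert_after t b (rot M))) z = orbit (insert_after (opp M t) a (insert_after t b (rot M))) w
    \<longleftrightarrow> orbit (insert_after t b (rot M)) z = orbit (insert_after t b (rot M)) w"
    by (rule orbit_insert_after_eq_iff[of "insert b (darts M)"]) (use pm(1) permutes_insert_after[OF pm(4) ab(2) t] facts ab assms in auto)
  also have "\<dots> \<longleftrightarrow> orbit (rot M) z = orbit (rot M) w"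
    by (rule orbit_insert_after_eq_iff[of "darts M"]) (use pm t ab assms in auto)
  finally show ?thesis unfolding cut1_rot .
qed

text \<open>The second copy of the edge and the digon cancel in the count.\<close>

lemma cut1_euler: "euler_char (cut1 a b t M) = euler_char M"
proof -
  note pm = premapD[OF pm0]
  obtain fs where fs: "facelist M fs" using cycle_dec_exists[OF pm(1,3)] by blast
  have f: "orbs (nxt (cut1 a b t M)) (darts (cut1 a b t M)) = Suc (orbs (nxt M) (darts M))"
    unfolding cycle_dec_orbs[OF fs] cycle_dec_orbs[OF cut1_facelist[OF fs]] by simp
  have "orbs (insert_after (opp M t) a (insert_after t b (rot M))) (insert a (insert b (darts M)))
    = orbs (insert_after t b (rot M)) (insert b (darts M))"
    by (rule orbs_insert_after(1)) (use pm(1) permutes_insert_after[OF pm(4) ab(2) t] facts ab in auto)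
  also have "\<dots> = orbs (rot M) (darts M)"
    by (rule orbs_insert_after(1)) (use pm t ab in auto)
  finally have v: "orbs (rot (cut1 a b t M)) (darts (cut1 a b t M)) = orbs (rot M) (darts M)"
    unfolding cut1_rot by simp
  have "card (darts (cut1 a b t M)) = card (darts M) + 2" using ab pm(1) by simp
  then show ?thesis unfolding euler_char_eq[OF cut1_premap] euler_char_eq[OF pm0] f v by simp
qed

lemma cut1_conn:
  assumes "conn M" shows "conn (cut1 a b t M)"
  unfolding conn_def
proof (intro allI impI)
  let ?M = "cut1 a b t M"
  note pm = premapD[OF pm0]
  fix S assume S: "S \<subseteq> darts ?M" "S \<noteq> {}" "opp ?M ` S \<subseteq> S" "nxt ?M ` S \<subseteq> S"
  have o: "opp ?M z \<in> S" if "z \<in> S" for z using S(3) that by blast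
  have n: "nxt ?M z \<in> S" if "z \<in> S" for z using S(4) that by blast
  have na: "nxt ?M a = b" "nxt ?M b = a" using ab by auto
  have tS: "t \<in> S \<longleftrightarrow> a \<in> S" "opp M t \<in> S \<longleftrightarrow> b \<in> S" "a \<in> S \<longleftrightarrow> b \<in> S"
    using o[of t] o[of a] o[of "opp M t"] o[of b] n[of a] n[of b] unfolding cut1_opp na by blast+
  let ?T = "S \<inter> darts M"
  have "opp M w \<in> ?T" if w: "w \<in> ?T" for w
  proof -
    consider "w = t" | "w = opp M t" | "w \<noteq> t" "w \<noteq> opp M t" by blast
    then have "opp M w \<in> S"
    proof cases
      case 3
      then show ?thesis using o[of w] w cut1_opp(5)[of w] by simp
    qed (use w tS facts in auto)
    then show ?thesis using w pm(7) by simp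
  qed
  moreover have "nxt M w \<in> ?T" if w: "w \<in> ?T" for w
  proof -
    have "w \<noteq> a" "w \<noteq> b" using w ab by auto
    then show ?thesis using n[of w] w pm(8)[of w] by simp
  qed
  moreover have "?T \<noteq> {}"
    using S(1,2) tS t by auto
  ultimately have T: "?T = darts M"
    using assms[unfolded conn_def, rule_format, of ?T, OF _ _ image_subsetI image_subsetI] by blast
  then have "a \<in> S" "b \<in> S" using t tS by auto
  then show "S = darts ?M" using T S(1) by auto
qed

lemma cut1_chi_map:
  assumes "chi_map A c M" shows "chi_map A c (cut1 a b t M)"
proof -
  let ?M = "cut1 a b t M"
  note pm = premapD[OF pm0]
  have L: "lab M \<in> darts M \<rightarrow>\<^sub>E A \<times> UNIV"
      "\<And>d. d \<in> darts M \<Longrightarrow> lab M (opp M d) = inv_letter (lab M d)" "conn M"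
    using assms(1) by (auto simp: chi_map_def labelled_map_iff)
  have "lab M t \<in> A \<times> UNIV" using L(1) t by auto
  then have lt: "lab M t \<in> A \<times> UNIV" "inv_letter (lab M t) \<in> A \<times> UNIV"
      by (simp_all only: inv_letter_in)
  have "lab ?M \<in> darts ?M \<rightarrow>\<^sub>E A \<times> UNIV"
  proof (rule PiE_I)
    fix d assume "d \<in> darts ?M"
    then have "d = a \<or> d = b \<or> d \<in> darts M" by auto
    then show "lab ?M d \<in> A \<times> UNIV" using lt PiE_mem[OF L(1)]
        by (simp only: cut1_simps fun_upd_apply split: if_split) blast
  next
    fix d assume "d \<notin> darts ?M"
    then show "lab ?M d = undefined" using PiE_arb[OF L(1)] by simp
  qed
  moreover have "lab ?M (opp ?M d) = inv_letter (lab ?M d)" if d: "d \<in> darts ?M" for d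
  proof -
    consider "d = a" | "d = b" | "d = t" | "d = opp M t" | "d \<in> darts M" "d \<noteq> t" "d \<noteq> opp M t"
      using d by auto
    then show ?thesis
    proof cases
      case 5
      then have "opp M d \<noteq> a" "opp M d \<noteq> b" "d \<noteq> a" "d \<noteq> b" using pm(7)[of d] ab by auto
      then show ?thesis using 5 L(2) cut1_opp(5)[of d] by simp
    qed (use facts ab L(2)[OF t] cut1_opp(1-4) in \<open>simp_all del: cut1_simps(2) fun_upd_apply, auto\<close>)
  qed
  moreover have "euler_char ?M = c" unfolding cut1_euler using assms by (simp add: chi_map_def)
  moreover have "darts ?M \<noteq> {}" by simp
  ultimately show ?thesis using cut1_premap cut1_conn[OF L(3)]
    unfolding chi_map_def labelled_map_iff by blast
qed

end

section \<open>Joining two faces along a simple path\<close>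

text \<open>A simple path in a form fit for induction on its edges. The darts \<open>u\<close> and
  \<open>w\<close> stand for their origins, and each step requires that the vertex being left is not
  entered later; this vertex is the one that gets split.\<close>

fun spath :: "'a diagram \<Rightarrow> nat \<Rightarrow> nat list \<Rightarrow> nat \<Rightarrow> bool"
  where
    "spath M u [] w \<longleftrightarrow> orbit (rot M) u = orbit (rot M) w"
  | "spath M u (t # s) w \<longleftrightarrow> t \<in> darts M \<and> orbit (rot M) u = orbit (rot M) t \<and>
      orbit (rot M) u \<notin> (\<lambda>z. orbit (rot M) (opp M z)) ` set (t # s) \<and> spath M (opp M t) s w"

lemma spath_darts: "spath M u s w \<Longrightarrow> set s \<subseteq> darts M"
  by (induction s arbitrary: u) auto

lemma spath_origins: "spath M u s w \<Longrightarrow> z \<in> set s \<Longrightarrow>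
  orbit (rot M) z = orbit (rot M) u \<or> orbit (rot M) z \<in> (\<lambda>z. orbit (rot M) (opp M z)) ` set s"
  by (induction s arbitrary: u) fastforce+

lemma spath_start_cong: "orbit (rot M) u = orbit (rot M) u' \<Longrightarrow> spath M u s w \<longleftrightarrow> spath M u' s w"
  by (cases s) auto

text \<open>Here \<open>v0\<close> is the vertex being split. The map \<open>M'\<close> needs to
  agree with \<open>M\<close> only away from \<open>v0\<close>, and a simple path that has left
  \<open>v0\<close> does not come back.\<close>

lemma spath_transfer:
  assumes "spath M u s w" "premap M" "u \<in> darts M" "w \<in> darts M"
    and "orbit (rot M) u \<noteq> v0" "v0 \<notin> (\<lambda>z. orbit (rot M) (opp M z)) ` set s"
    and iff: "\<And>z z'. z \<in> darts M \<Longrightarrow> z' \<in> darts M \<Longrightarrow> orbit (rot M) z \<noteq> v0 \<Longrightarrow> orbit (rot M) z' \<noteq> v0 \<Longrightarrow>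
        orbit (rot M') z = orbit (rot M') z' \<longleftrightarrow> orbit (rot M) z = orbit (rot M) z'"
    and opp: "\<And>z. z \<in> darts M \<Longrightarrow> orbit (rot M) z \<noteq> v0 \<Longrightarrow> orbit (rot M) (opp M z) \<noteq> v0 \<Longrightarrow> opp M' z = opp M z"
    and D: "darts M \<subseteq> darts M'"
  shows "spath M' u s w"
  using assms(1,3,5,6)
proof (induction s arbitrary: u)
  case Nil
  then show ?case using iff assms(4) by simp
next
  case (Cons t s)
  note sp = Cons.prems(1)
  have t: "t \<in> darts M" "orbit (rot M) u = orbit (rot M) t" "spath M (opp M t) s w" using sp by auto
  have ot: "opp M t \<in> darts M" using premapD(7)[OF assms(2)] t by simp
  have IH: "spath M' (opp M t) s w" by (rule Cons.IH) (use t ot Cons.prems in auto)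
  have o: "opp M' z = opp M z" if "z \<in> set (t # s)" for z
    using opp[of z] that spath_origins[OF sp that] spath_darts[OF sp] Cons.prems(3,4) by auto
  have "orbit (rot M') u \<noteq> orbit (rot M') (opp M' z)" if z: "z \<in> set (t # s)" for z
  proof -
    have "opp M z \<in> darts M" using spath_darts[OF sp] z premapD(7)[OF assms(2)] by auto
    moreover have "orbit (rot M) u \<noteq> orbit (rot M) (opp M z)" "orbit (rot M) (opp M z) \<noteq> v0"
        using sp Cons.prems(4) z by auto
    ultimately show ?thesis unfolding o[OF z] using iff Cons.prems(2,3) by simp
  qed
  then have "orbit (rot M') u \<notin> (\<lambda>z. orbit (rot M') (opp M' z)) ` set (t # s)" by blast
  moreover have "orbit (rot M') u = orbit (rot M') t" using iff t Cons.prems(2,3) by simp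
  moreover have "spath M' (opp M' t) s w" using o[of t] IH by simp
  moreover have "t \<in> darts M'" using t D by blast
  ultimately show ?case unfolding spath.simps by blast
qed

text \<open>The first face is pushed along the path edge by edge: the edge is doubled, and the new digon is
  joined to the face at the vertex they share. Simplicity of the path guarantees that splitting
  this vertex does not disturb the rest of the path.\<close>

lemma join_faces:
  assumes "chi_map A c M" "facelist M ((d1 # as) # (d2 # bs) # fs)" "spath M d1 s d2"
  shows "\<exists>M' f. chi_map A c M' \<and> facelist M' (f # fs) \<and>
    map (lab M') f = map (lab M) (d1 # as) @ map (lab M) s @ map (lab M) (d2 # bs) @ inv_word (map (lab M) s) \<and>
    (\<forall>d\<in>set fs. map (lab M') d = map (lab M) d)"
  using assms
proof (induction s arbitrary: M d1 as)
  case Nil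
  obtain us x where x: "d1 # as = us @ [x]" by (metis list.distinct(1) rev_exhaust)
  obtain vs y where y: "d2 # bs = vs @ [y]" by (metis list.distinct(1) rev_exhaust)
  note pm = premapD[OF chi_map_premap[OF Nil.prems(1)]]
  have cyc: "cycle (nxt M) (d1 # as)" "cycle (nxt M) (d2 # bs)"
      using cycle_decD(3)[OF Nil.prems(2)] by simp_all
  moreover have "last (d1 # as) = x" "last (d2 # bs) = y" by (simp_all only: x y last_snoc)
  ultimately have n: "nxt M x = d1" "nxt M y = d2" unfolding cycle_def by (simp_all only: list.sel)
  then have "rot M (opp M x) = d1" "rot M (opp M y) = d2" by (simp_all add: rot_def pm(5))
  \<comment> \<open>With an empty path the two faces have corners at the same vertex, where
    \<open>x\<close> and \<open>y\<close> end. Joining the faces there splits this vertex, so the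
    surface is unchanged.\<close>
  then have "orbit (rot M) (opp M x) = orbit (rot M) (opp M y)"
    using orbit_step_eq[OF pm(1,4), of _ d1] orbit_step_eq[OF pm(1,4), of _ d2] Nil.prems(3) by simp
  then have m: "chi_map A c (swap_nxt x y M)"
      "facelist (swap_nxt x y M) ((us @ [x] @ vs @ [y]) # fs)"
    using merge_faces[OF Nil.prems(1) Nil.prems(2)[unfolded x y]] by simp_all
  have e: "us @ [x] @ vs @ [y] = (d1 # as) @ (d2 # bs)" unfolding x y by simp
  show ?case
  proof (intro exI conjI ballI)
    show "chi_map A c (swap_nxt x y M)" by (rule m)
    show "facelist (swap_nxt x y M) (((d1 # as) @ (d2 # bs)) # fs)" using m(2) unfolding e .
  qed simp_all
next
  case (Cons t s)
  have pm0: "premap M" using chi_map_premap[OF Cons.prems(1)] .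
  note pm = premapD[OF pm0]
  obtain a b where ab: "a \<notin> darts M" "b \<notin> darts M" "a \<noteq> b" using ex_new_pair[OF pm(1)] by blast
  have t: "t \<in> darts M" "orbit (rot M) d1 = orbit (rot M) t" "spath M (opp M t) s d2"
    and nt: "orbit (rot M) d1 \<notin> (\<lambda>z. orbit (rot M) (opp M z)) ` set (t # s)" using Cons.prems(3)
      by auto
  let ?M1 = "cut1 a b t M"
  have g1: "chi_map A c ?M1" by (rule cut1_chi_map[OF pm0 t(1) ab Cons.prems(1)])
  have f1: "facelist ?M1 ([b, a] # (d1 # as) # (d2 # bs) # fs)"
      by (rule cut1_facelist[OF pm0 t(1) ab Cons.prems(2)])
  note pm1 = premapD[OF chi_map_premap[OF g1]]
  note o1 = cut1_opp[OF pm0 t(1) ab]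
  obtain us x where x: "d1 # as = us @ [x]" by (metis list.distinct(1) rev_exhaust)
  have dd: "set (d1 # as) \<subseteq> darts M" "set (d2 # bs) \<subseteq> darts M"
    using facelist_head[OF Cons.prems(2)] facelist_head2[OF Cons.prems(2)] by auto
  have xd: "x \<in> set (d1 # as)" unfolding x by simp
  have x_in: "x \<in> darts M" using dd xd by blast
  have f1': "facelist ?M1 ((us @ [x]) # ([b] @ [a]) # (d2 # bs) # fs)"
    by (rule cycle_dec_mset[OF f1]) (simp add: x)
  have "cycle (nxt ?M1) (us @ [x])" using cycle_decD(3)[OF f1'] by simp
  then have "nxt ?M1 x = hd (us @ [x])" by (simp add: cycle_def)
  then have nx: "nxt ?M1 x = d1" using x by (metis list.sel(1))
  have rx: "rot ?M1 (opp ?M1 x) = d1" unfolding rot_def pm1(5) by (rule nx)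
  have ox1: "orbit (rot ?M1) (opp ?M1 x) = orbit (rot ?M1) d1"
      by (rule orbit_step_eq[OF pm1(1,4) rx])
  have d1: "d1 \<in> darts M" "d2 \<in> darts M" using dd by auto
  have iff1: "\<And>z w. z \<in> darts M \<Longrightarrow> w \<in> darts M \<Longrightarrow> orbit (rot ?M1) z = orbit (rot ?M1) w \<longleftrightarrow> orbit (rot M) z = orbit (rot M) w"
    by (rule cut1_orbit_eq_iff[OF pm0 t(1) ab])
  have od1: "orbit (rot ?M1) d1 = orbit (rot ?M1) t" using iff1[OF d1(1) t(1)] t(2) by simp
  \<comment> \<open>The dart \<open>a\<close> is the reverse of \<open>t\<close>, so it ends where
    \<open>t\<close> starts, at the corner of the first face; the digon can be absorbed
    there.\<close>
  have same: "orbit (rot ?M1) (opp ?M1 x) = orbit (rot ?M1) (opp ?M1 a)" unfolding ox1 od1 o1 ..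
  let ?M2 = "swap_nxt x a ?M1"
  have 2: "chi_map A c ?M2" "facelist ?M2 ((us @ [x] @ [b] @ [a]) # (d2 # bs) # fs)"
    using merge_faces[OF g1 f1'] same by simp_all
  have "facelist ?M2 (((us @ [x] @ [b]) @ [a]) # (d2 # bs) # fs)" using 2(2) by simp
  from cycle_dec_append_commute[OF this]
  have f2: "facelist ?M2 ((a # d1 # as @ [b]) # (d2 # bs) # fs)" using x
      by (metis append.assoc append_Cons append_Nil)
  have otd: "opp M t \<in> darts M" using pm(7) t by simp
  have not: "orbit (rot M) (opp M t) \<noteq> orbit (rot M) d1" using nt by auto
  have neq: "opp ?M1 x \<noteq> opp ?M1 a"
  proof -
    have "x \<noteq> a" using x_in ab by auto
    then show ?thesis using pm1(9)[of x a] by blast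
  qed
  have r2: "rot ?M2 = rot ?M1 \<circ> transpose (opp ?M1 x) (opp ?M1 a)"
      by (rule swap_nxt_rot[OF chi_map_premap[OF g1]])
  have in1: "opp ?M1 x \<in> darts ?M1" "opp ?M1 a \<in> darts ?M1" using pm1(7) x_in by auto
  \<comment> \<open>The join splits only the start vertex of the path, so all vertices lying ahead
    survive.\<close>
  have orb2: "orbit (rot ?M2) z = orbit (rot ?M1) z" if z: "z \<in> darts M"
      "orbit (rot M) z \<noteq> orbit (rot M) d1" for z
  proof -
    have "z \<notin> orbit (rot ?M1) (opp ?M1 x)"
    proof
      assume "z \<in> orbit (rot ?M1) (opp ?M1 x)"
      from orbit_eq_of_mem[OF pm1(1,4) in1(1) this] have "orbit (rot ?M1) z = orbit (rot ?M1) d1"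
          unfolding ox1 .
      then show False using iff1[OF z(1) d1(1)] z(2) by simp
    qed
    moreover have "z \<in> darts ?M1" using z by simp
    ultimately show ?thesis unfolding r2 using orbs_swap_split(2)[OF pm1(1,4) in1 same neq] by blast
  qed
  have A1: "orbit (rot M) d1 \<notin> (\<lambda>z. orbit (rot M) (opp M z)) ` set s" using nt by simp
  have A2: "orbit (rot ?M2) z = orbit (rot ?M2) z' \<longleftrightarrow> orbit (rot M) z = orbit (rot M) z'"
    if "z \<in> darts M" "z' \<in> darts M" "orbit (rot M) z \<noteq> orbit (rot M) d1"
      "orbit (rot M) z' \<noteq> orbit (rot M) d1" for z z'
    unfolding orb2[OF that(1,3)] orb2[OF that(2,4)] by (rule iff1[OF that(1,2)])
  have A3: "opp ?M2 z = opp M z" if z: "z \<in> darts M" "orbit (rot M) z \<noteq> orbit (rot M) d1"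
      "orbit (rot M) (opp M z) \<noteq> orbit (rot M) d1" for z
  proof -
    have "z \<noteq> t" using z(2) t(2) by metis
    moreover have "z \<noteq> opp M t" using z(3) t(2) pm(5)[of t] by metis
    ultimately have "opp ?M1 z = opp M z" by (rule o1(5)[OF _ _ z(1)])
    then show ?thesis by (simp only: swap_nxt_simps)
  qed
  have A4: "darts M \<subseteq> darts ?M2" by auto
  have "spath ?M2 (opp M t) s d2"
    by (rule spath_transfer[OF t(3) pm0 otd d1(2) not A1 A2 A3 A4])
  \<comment> \<open>The enlarged face contains \<open>a\<close>, which starts at the end of
    \<open>t\<close>; from there the remaining path leads to the second face.\<close>
  moreover have "orbit (rot ?M2) (opp M t) = orbit (rot ?M2) a"
  proof -
    have "opp M t \<noteq> opp ?M1 x"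
      using not ox1 iff1[OF otd d1(1)] by metis
    moreover have "opp M t \<noteq> opp ?M1 a" using o1(2) pm(6)[OF t(1)] by simp
    ultimately have "transpose (opp ?M1 x) (opp ?M1 a) (opp M t) = opp M t"
        unfolding transpose_def by presburger
    then have "rot ?M2 (opp M t) = rot ?M1 (opp M t)" unfolding r2 comp_apply by (rule arg_cong)
    also have "\<dots> = a" unfolding rot_def o1(3) by (simp add: ab)
    finally have r: "rot ?M2 (opp M t) = a" .
    note pm2 = premapD[OF chi_map_premap[OF 2(1)]]
    show ?thesis by (rule orbit_step_eq[OF pm2(1,4) r])
  qed
  ultimately have sp: "spath ?M2 a s d2" using spath_start_cong by blast
  obtain M' f where M': "chi_map A c M'" "facelist M' (f # fs)"
    "map (lab M') f = map (lab ?M2) (a # d1 # as @ [b]) @ map (lab ?M2) s @ map (lab ?M2) (d2 # bs) @ inv_word (map (lab ?M2) s)"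
    "\<And>d. d \<in> set fs \<Longrightarrow> map (lab M') d = map (lab ?M2) d"
    using Cons.IH[OF 2(1) f2 sp] by blast
  have lold: "map (lab ?M2) r = map (lab M) r" if "set r \<subseteq> darts M" for r using that ab by auto
  have la: "lab ?M2 a = inv_letter (lab M t)" "lab ?M2 b = lab M t" using ab by simp_all
  have ss: "set s \<subseteq> darts M" using spath_darts[OF t(3)] .
  have lf: "map (lab M') f = inv_letter (lab M t) # (map (lab M) (d1 # as) @ lab M t # map (lab M) s @ map (lab M) (d2 # bs) @ inv_word (map (lab M) s))"
  proof -
    have "map (lab ?M2) (a # d1 # as @ [b]) = lab ?M2 a # map (lab ?M2) (d1 # as) @ [lab ?M2 b]"
      by (simp only: list.map map_append append_Cons)
    then show ?thesis unfolding M'(3) lold[OF ss] lold[OF dd(1)] lold[OF dd(2)] la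
      by (simp only: append_Cons append_Nil append_assoc)
  qed
  \<comment> \<open>The face begins with the inverse letter of \<open>t\<close>; moving this dart to
    the end yields the label for the whole path.\<close>
  then obtain h f' where f: "f = h # f'" by (cases f) auto
  have "facelist M' (([h] @ f') # fs)" using M'(2) f by simp
  from cycle_dec_append_commute[OF this] have "facelist M' ((f' @ [h]) # fs)" .
  moreover have "map (lab M') (f' @ [h]) = map (lab M) (d1 # as) @ map (lab M) (t # s) @ map (lab M) (d2 # bs) @ inv_word (map (lab M) (t # s))"
    using lf unfolding f by (auto simp: inv_word_Cons)
  moreover have "map (lab M') d = map (lab M) d" if d: "d \<in> set fs" for d
  proof -
    have "set d \<subseteq> darts M" using facelist_in_darts[OF Cons.prems(2), of d] d by simp
    then show ?thesis using M'(4)[OF d] lold by simp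
  qed
  ultimately show ?case using M'(1) by blast
qed

section \<open>Face labels up to rotation, and sums over faces\<close>

lemma rotate_back: "\<exists>m. rotate m (rotate n w) = w"
proof (cases "w = []")
  case False
  then have "n * length w - n + n = n * length w" by (cases "length w") auto
  then have "rotate (n * length w - n) (rotate n w) = w" by (simp add: rotate_rotate rotate_id)
  then show ?thesis by blast
qed simp

lemma face_label_rotate:
  assumes "facelist M fs" "c \<in> set fs" "d \<in> set c"
  shows "\<exists>n. face_label M d = rotate n (map (lab M) c)"
proof -
  obtain n us where n: "rotate n c = d # us" by (rule cycle_rotate[OF assms(3)])
  have "cycle (nxt M) c" using cycle_decD(3)[OF assms(1,2)] .
  then have cyc: "cycle (nxt M) (rotate n c)" by (rule cycle_rotate_iff)
  have hd: "hd (rotate n c) = d" unfolding n by simp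
  obtain ys zs where fs: "fs = ys @ c # zs" using assms(2) by (meson split_list)
  have dist: "distinct c" using cycle_decD(1)[OF assms(1)] unfolding fs by simp
  have "face_of M d = set c" unfolding face_of_def by (rule cycle_dec_orbit[OF assms])
  then have len: "card (face_of M d) = length (rotate n c)" using distinct_card[OF dist] by simp
  have "face_label M d = map (lab M) (rotate n c)"
    unfolding face_label_def len
    by (rule nth_equalityI) (use cycle_funpow[OF cyc] hd in auto)
  then show ?thesis by (auto simp: rotate_map)
qed

text \<open>For such sets it does not matter from which dart a face is read, so membership of a
  label can be tested on any list representing the face.\<close>

definition rotation_closed :: "'b list set \<Rightarrow> bool"
  where "rotation_closed X \<longleftrightarrow> (\<forall>w n. w \<in> X \<longrightarrow> rotate n w \<in> X)"

lemma rotation_closed_iff: "rotation_closed X \<Longrightarrow> rotate n w \<in> X \<longleftrightarrow> w \<in> X"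
  using rotate_back[of n w] unfolding rotation_closed_def by metis

lemma face_label_in_iff:
  assumes "facelist M fs" "c \<in> set fs" "rotation_closed X"
  shows "d \<in> set c \<Longrightarrow> face_label M d \<in> X \<longleftrightarrow> map (lab M) c \<in> X"
    and "(\<exists>d\<in>set c. face_label M d \<in> X) \<longleftrightarrow> map (lab M) c \<in> X"
proof -
  show *: "face_label M d \<in> X \<longleftrightarrow> map (lab M) c \<in> X" if d: "d \<in> set c" for d
  proof -
    obtain n where n: "face_label M d = rotate n (map (lab M) c)"
        using face_label_rotate[OF assms(1,2) d] by blast
    show ?thesis unfolding n by (rule rotation_closed_iff[OF assms(3)])
  qed
  have "hd c \<in> set c" using cycle_decD(4)[OF assms(1,2)] by simp
  then show "(\<exists>d\<in>set c. face_label M d \<in> X) \<longleftrightarrow> map (lab M) c \<in> X" using * by blast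
qed

lemma faces_eq: "facelist M fs \<Longrightarrow> faces M = set ` set fs"
  using cycle_dec_orbits[of "nxt M" "darts M" fs] by (simp add: faces_def face_of_def)

lemma zero_face_iff:
  assumes "facelist M fs" "c \<in> set fs" "rotation_closed X"
  shows "zero_face X M (set c) \<longleftrightarrow> map (lab M) c \<in> X"
  using face_label_in_iff(2)[OF assms] assms(2) by (simp add: zero_face_def faces_eq[OF assms(1)])

lemma rotation_closed_cyclic_closure: "rotation_closed (cyclic_closure S)"
  unfolding rotation_closed_def
proof (intro allI impI)
  fix w :: "'a word" and n
  assume "w \<in> cyclic_closure S"
  then obtain m v where "w = rotate m v" "v \<in> S \<union> inv_word ` S" unfolding cyclic_closure_def
      by blast
  then have "rotate n w = rotate (n + m) v" "v \<in> S \<union> inv_word ` S" by (simp_all add: rotate_rotate)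
  then show "rotate n w \<in> cyclic_closure S" unfolding cyclic_closure_def by blast
qed

lemma rel_face_iff:
  assumes "facelist M fs" "c \<in> set fs"
  shows "rel_face Rp M i (set c) \<longleftrightarrow> map (lab M) c \<in> cyclic_closure (Rp i)"
  using face_label_in_iff(2)[OF assms rotation_closed_cyclic_closure] assms(2)
    by (simp add: rel_face_def faces_eq[OF assms(1)])

lemma diagram_over_iff:
  assumes "facelist M fs" "rotation_closed X"
  shows "diagram_over A X Rp M \<longleftrightarrow> labelled_map A M \<and>
    (\<forall>c\<in>set fs. map (lab M) c \<in> X \<or> (\<exists>i\<ge>1. map (lab M) c \<in> cyclic_closure (Rp i)))"
  unfolding diagram_over_def faces_eq[OF assms(1)]
  using zero_face_iff[OF assms(1) _ assms(2)] rel_face_iff[OF assms(1)] by simp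

text \<open>One notion for two uses: the multiset of ranks and the signed count of a relator. The
  starting dart is arbitrary, which is harmless for the rotation invariant \<open>g\<close> in
  use.\<close>

definition face_sum :: "('a word \<Rightarrow> 'b::comm_monoid_add) \<Rightarrow> 'a diagram \<Rightarrow> 'b"
  where "face_sum g M = (\<Sum>f\<in>faces M. g (face_label M (SOME d. d \<in> f)))"

lemma face_sum_eq:
  assumes "facelist M fs" and g: "\<And>w n. g (rotate n w) = g w"
  shows "face_sum g M = (\<Sum>c\<leftarrow>fs. g (map (lab M) c))"
proof -
  have ne: "c \<noteq> []" if "c \<in> set fs" for c using cycle_decD(4)[OF assms(1) that] .
  have 1: "g (face_label M (SOME d. d \<in> set c)) = g (map (lab M) c)" if c: "c \<in> set fs" for c
  proof -
    have "(SOME d. d \<in> set c) \<in> set c" using ne[OF c] by (metis hd_in_set someI)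
    then obtain n where "face_label M (SOME d. d \<in> set c) = rotate n (map (lab M) c)"
        using face_label_rotate[OF assms(1) c] by blast
    then show ?thesis using g by simp
  qed
  have dist: "distinct (map set fs)" using cycle_dec_distinct_sets[OF assms(1)] .
  have "face_sum g M = (\<Sum>f\<in>set (map set fs). g (face_label M (SOME d. d \<in> f)))"
    unfolding face_sum_def faces_eq[OF assms(1)] by simp
  also have "\<dots> = (\<Sum>f\<leftarrow>map set fs. g (face_label M (SOME d. d \<in> f)))"
    using sum_list_distinct_conv_sum_set[OF dist] by metis
  also have "\<dots> = (\<Sum>c\<leftarrow>fs. g (map (lab M) c))"
    using 1 by (simp add: comp_def cong: map_cong)
  finally show ?thesis .
qed

section \<open>Erasing an edge\<close>

definition del_point :: "'b \<Rightarrow> ('b \<Rightarrow> 'b) \<Rightarrow> 'b \<Rightarrow> 'b"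
  where "del_point y p x = (if x = y then y else if p x = y then p y else p x)"

text \<open>Bypassing a point shortens its cycle, unless the point was fixed and its cycle
  disappears altogether; hence the correction term.\<close>

lemma cycle_dec_del_point:
  assumes "cycle_dec p D cs" "y \<in> D"
  shows "\<exists>cs'. cycle_dec (del_point y p) (D - {y}) cs' \<and> length cs = length cs' + (if p y = y then 1 else 0)"
proof -
  obtain us cs' where d: "cycle_dec p D ((us @ [y]) # cs')" by (rule cycle_dec_head[OF assms])
  have len: "length cs = Suc (length cs')" using cycle_dec_orbs[OF assms(1)] cycle_dec_orbs[OF d]
      by simp
  have dist: "distinct (concat ((us @ [y]) # cs'))" using cycle_decD(1)[OF d] .
  have cy: "cycle p (us @ [y])" using cycle_decD(3)[OF d] by simp
  have c: "cycle (del_point y p) c" if c: "c \<in> set cs'" for c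
  proof -
    have "cycle p c" using cycle_decD(3)[OF d] c by simp
    have o: "orbit p x = set c" if "x \<in> set c" for x using cycle_dec_orbit[OF d _ that] c by simp
    have "y \<notin> set c" using dist c by auto
    have "p x \<noteq> y" if "x \<in> set c" for x
      using o[OF that] \<open>y \<notin> set c\<close> orbit.base[of p x] by auto
    then have "del_point y p x = p x" if "x \<in> set c" for x
      using that \<open>y \<notin> set c\<close> by (auto simp: del_point_def)
    then show ?thesis using cycle_cong[of c "del_point y p" p] \<open>cycle p c\<close> by blast
  qed
  have D: "D = insert y (set us \<union> set (concat cs'))" using cycle_decD(2)[OF d] by auto
  show ?thesis
  proof (cases "us = []")
    case True
    then have "p y = y" using cy by (simp add: cycle_def)
    have "D - {y} = set (concat cs')" using D dist True by auto
    then have "cycle_dec (del_point y p) (D - {y}) cs'" using c dist unfolding cycle_dec_def by simp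
    then show ?thesis using len \<open>p y = y\<close> by (intro exI[of _ cs']) simp
  next
    case False
    have s: "successively (\<lambda>x y. p x = y) us" "p (last us) = y" "p y = hd us"
      using cy False by (simp_all add: cycle_def successively_append_iff)
    have yu: "y \<notin> set us" "distinct us" using dist by auto
    have "p y \<noteq> y" using s(3) False yu by (metis hd_in_set)
    have "successively (\<lambda>x z. del_point y p x = z) us"
      by (rule successively_mono[OF s(1)]) (use yu in \<open>auto simp: del_point_def\<close>)
    moreover have "last us \<noteq> y" using yu False by (metis last_in_set)
    ultimately have "cycle (del_point y p) us" using s False by (simp add: cycle_def del_point_def)
    moreover have "D - {y} = set (concat (us # cs'))" using D dist by auto
    moreover have "distinct (concat (us # cs'))" using dist by auto
    ultimately have "cycle_dec (del_point y p) (D - {y}) (us # cs')" using c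
        unfolding cycle_dec_def by simp
    then show ?thesis using len \<open>p y \<noteq> y\<close> by (intro exI[of _ "us # cs'"]) simp
  qed
qed

context
  fixes M :: "'a diagram" and d :: nat and d' D skip
  assumes pm0: "premap M" and con: "conn M" and d: "d \<in> darts M"
  defines "d' \<equiv> opp M d" and "D \<equiv> darts M - {d, d'}"
    and "skip \<equiv> (\<lambda>y. if y \<in> D then y else if rot M y \<in> D then rot M y else rot M (rot M y))"
  assumes ne: "D \<noteq> {}"
begin

private lemma pd: "opp M d = d'" "opp M d' = d" "d \<noteq> d'" "d' \<in> darts M" "rot M d = nxt M d'"
  "rot M d' = nxt M d"
  using premapD[OF pm0] d premapD(6)[OF pm0 d, symmetric] by (auto simp: d'_def rot_def)

private lemma er: "darts (erase_edge d M) = D" "x \<in> D \<Longrightarrow> opp (erase_edge d M) x = opp M x"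
  "x \<in> D \<Longrightarrow> nxt (erase_edge d M) x = skip (nxt M x)" "x \<in> D \<Longrightarrow> lab (erase_edge d M) x = lab M x"
  by (simp_all add: erase_edge_def Let_def D_def d'_def skip_def)

text \<open>Otherwise the two darts of the edge would be closed under both permutations and, by
  connectedness, would be the whole map.\<close>

private lemma not_all: "\<not> (nxt M d \<in> {d, d'} \<and> nxt M d' \<in> {d, d'})"
proof
  assume n: "nxt M d \<in> {d, d'} \<and> nxt M d' \<in> {d, d'}"
  have "opp M ` {d, d'} \<subseteq> {d, d'}" using pd by auto
  moreover have "nxt M ` {d, d'} \<subseteq> {d, d'}" using n by auto
  ultimately have "{d, d'} = darts M"
      using con[unfolded conn_def, rule_format, of "{d, d'}"] d pd(4) by blast
  then show False using ne by (simp add: D_def)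
qed

text \<open>Erasing bypasses \<open>d\<close> and then its reverse in the cyclic orders around the
  vertices. A vertex is lost only if the edge hangs: then the reverse of \<open>d\<close> is fixed
  by \<open>rot\<close>.\<close>

lemma erase_rot_orbs:
  assumes "premap (erase_edge d M)" "nxt M d \<noteq> d'  \<and> nxt M d' \<noteq> d \<or> nxt M d = d'"
  shows "orbs (rot M) (darts M) = orbs (rot (erase_edge d M)) D + (if nxt M d = d' then 1 else 0)"
proof -
  note pm = premapD[OF pm0]
  obtain cs where cs: "cycle_dec (rot M) (darts M) cs" using cycle_dec_exists[OF pm(1,4)] by blast
  obtain cs1 where 1: "cycle_dec (del_point d (rot M)) (darts M - {d}) cs1"
    "length cs = length cs1 + (if rot M d = d then 1 else 0)" using cycle_dec_del_point[OF cs d]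
      by blast
  have "d' \<in> darts M - {d}" using pd by simp
  from cycle_dec_del_point[OF 1(1) this] obtain cs2 where
    2: "cycle_dec (del_point d' (del_point d (rot M))) (darts M - {d} - {d'}) cs2"
    "length cs1 = length cs2 + (if del_point d (rot M) d' = d' then 1 else 0)" by blast
  have DD: "darts M - {d} - {d'} = D" unfolding D_def by blast
  have eq: "rot (erase_edge d M) x = del_point d' (del_point d (rot M)) x" if x: "x \<in> D" for x
  proof -
    have xx: "x \<noteq> d" "x \<noteq> d'" "x \<in> darts M" using x unfolding D_def by auto
    have ox: "opp M x \<in> D" using xx pm(7)[of x] pm(9)[of x d] pm(9)[of x d'] pd unfolding D_def
        by auto
    have r: "rot (erase_edge d M) x = skip (rot M x)" using er(2)[OF x] er(3)[OF ox]
        by (simp add: rot_def)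
    have rin: "rot M z \<in> darts M \<longleftrightarrow> z \<in> darts M" for z using pm(4) by (simp add: permutes_in_image)
    have inj: "rot M z = rot M w \<longleftrightarrow> z = w" for z w using permutes_inj[OF pm(4)] by (auto dest: injD)
    have mem: "z \<in> D \<longleftrightarrow> z \<noteq> d \<and> z \<noteq> d'" if "z \<in> darts M" for z using that unfolding D_def by blast
    have m: "rot M x \<in> D \<longleftrightarrow> rot M x \<noteq> d \<and> rot M x \<noteq> d'"
        "rot M (rot M x) \<in> D \<longleftrightarrow> rot M (rot M x) \<noteq> d \<and> rot M (rot M x) \<noteq> d'"
      by (rule mem; use rin xx in simp)+
    have dd: "rot M d = d' \<Longrightarrow> rot M d' \<noteq> d" using not_all pd by auto
    show ?thesis unfolding r skip_def m del_point_def
      using xx pd(3) inj[of x d] inj[of x d'] dd by auto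
  qed
  have "cycle_dec (rot (erase_edge d M)) D cs2" using 2(1) unfolding DD
      using cycle_dec_cong[of D "rot (erase_edge d M)"
      "del_point d' (del_point d (rot M))", OF eq] by blast
  then have o: "orbs (rot (erase_edge d M)) D = length cs2" by (rule cycle_dec_orbs)
  have "rot M d \<noteq> d" using assms(2) pd not_all by auto
  moreover have "del_point d (rot M) d' = d' \<longleftrightarrow> nxt M d = d'"
    unfolding del_point_def pd using assms(2) pd(3) not_all by auto
  ultimately show ?thesis using 1(2) 2(2) o cycle_dec_orbs[OF cs] by simp
qed

private lemma nxt_in: "x \<in> D \<Longrightarrow> nxt M x \<in> D \<Longrightarrow> nxt (erase_edge d M) x = nxt M x"
  using er(3)[of x] by (simp add: skip_def)

private lemma skip_d: "nxt M d' \<in> D \<Longrightarrow> skip d = nxt M d'" "nxt M d' = d' \<Longrightarrow> skip d = nxt M d"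
  "nxt M d \<in> D \<Longrightarrow> skip d' = nxt M d" "nxt M d = d \<Longrightarrow> skip d' = nxt M d'"
  using pd unfolding skip_def by (auto simp: D_def)

private lemma erase_keep:
  assumes "set c \<subseteq> D" "cycle (nxt M) c"
  shows "cycle (nxt (erase_edge d M)) c"
proof -
  have "nxt M x \<in> D" if "x \<in> set c" for x
    using cycle_orbit[OF assms(2) that] orbit.base[of "nxt M" x] assms(1) by auto
  then have "nxt (erase_edge d M) x = nxt M x" if "x \<in> set c" for x using nxt_in assms(1) that
      by blast
  then show ?thesis using cycle_cong[of c] assms(2) by blast
qed

text \<open>A skipped \<open>d\<close> is followed by \<open>rot M d\<close>, which is the successor
  of the reverse dart. So the walk along the first face continues on the second one, and vice
  versa.\<close>

lemma erase_merge_facelist: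
  assumes "face_of M d \<noteq> face_of M d'"
  obtains us vs fs where "facelist M ((d # us) # (d' # vs) # fs)"
      "facelist (erase_edge d M) ((us @ vs) # fs)"
proof -
  note pm = premapD[OF pm0]
  obtain fs0 where "facelist M fs0" using cycle_dec_exists[OF pm(1,3)] by blast
  then obtain us vs fs where f: "facelist M ((us @ [d]) # (vs @ [d']) # fs)"
    by (rule cycle_dec_head2[OF _ d pd(4) assms[unfolded face_of_def]])
  have dist: "distinct (concat ((us @ [d]) # (vs @ [d']) # fs))" using cycle_decD(1)[OF f] .
  have D: "D = set (concat ((us @ vs) # fs))" unfolding D_def cycle_decD(2)[OF f, symmetric]
      using dist by auto
  have cyc: "cycle (nxt M) (us @ [d])" "cycle (nxt M) (vs @ [d'])" using cycle_decD(3)[OF f] by auto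
  have inD: "set us \<subseteq> D" "set vs \<subseteq> D" unfolding D by auto
  have s: "successively (\<lambda>x y. nxt M x = y) us" "successively (\<lambda>x y. nxt M x = y) vs"
    "us \<noteq> [] \<Longrightarrow> nxt M (last us) = d" "vs \<noteq> [] \<Longrightarrow> nxt M (last vs) = d'"
    "us \<noteq> [] \<Longrightarrow> nxt M d = hd us" "vs \<noteq> [] \<Longrightarrow> nxt M d' = hd vs"
    "us = [] \<Longrightarrow> nxt M d = d" "vs = [] \<Longrightarrow> nxt M d' = d'"
    using cyc by (auto simp: cycle_def successively_append_iff hd_append)
  have s': "successively (\<lambda>x y. nxt (erase_edge d M) x = y) us"
      "successively (\<lambda>x y. nxt (erase_edge d M) x = y) vs"
    by (rule successively_mono[OF s(1)] successively_mono[OF s(2)]; use inD nxt_in in \<open>auto simp: subset_iff\<close>)+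
  have hdD: "us \<noteq> [] \<Longrightarrow> hd us \<in> D" "vs \<noteq> [] \<Longrightarrow> hd vs \<in> D" "us \<noteq> [] \<Longrightarrow> last us \<in> D"
      "vs \<noteq> [] \<Longrightarrow> last vs \<in> D"
    using inD by auto
  have lu: "nxt (erase_edge d M) (last us) = (if vs = [] then hd us else hd vs)" if "us \<noteq> []"
    using that er(3)[OF hdD(3)[OF that]] s(3,5,6,8) skip_d(1,2) hdD by auto
  have lv: "nxt (erase_edge d M) (last vs) = (if us = [] then hd vs else hd us)" if "vs \<noteq> []"
    using that er(3)[OF hdD(4)[OF that]] s(4,5,6,7) skip_d(3,4) hdD by auto
  have "us @ vs \<noteq> []" using not_all s(7,8) by auto
  then have c: "cycle (nxt (erase_edge d M)) (us @ vs)"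
    using s' lu lv
      by (cases "us = []"; cases "vs = []") (simp_all add: cycle_def successively_append_iff)
  have "cycle (nxt (erase_edge d M)) c" if "c \<in> set fs" for c
    by (rule erase_keep) (use that D cycle_decD(3)[OF f] in auto)
  then have "facelist (erase_edge d M) ((us @ vs) # fs)"
    unfolding cycle_dec_def er(1) using D dist c by auto
  moreover have "facelist M ((d # us) # (d' # vs) # fs)"
  proof -
    have "facelist M (([d] @ us) # (vs @ [d']) # fs)" by (rule cycle_dec_append_commute[OF f])
    then have "facelist M ((vs @ [d']) # ([d] @ us) # fs)" by (rule cycle_dec_mset) simp
    then have "facelist M (([d'] @ vs) # ([d] @ us) # fs)" by (rule cycle_dec_append_commute)
    then show ?thesis by (rule cycle_dec_mset) simp
  qed
  ultimately show ?thesis using that by blast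
qed

lemma erase_hanging_facelist:
  assumes "nxt M d = d'"
  obtains us fs where "facelist M ((d # d' # us) # fs)" "facelist (erase_edge d M) (us # fs)"
proof -
  note pm = premapD[OF pm0]
  have o: "orbit (nxt M) d = orbit (nxt M) d'" by (rule orbit_step_eq[OF pm(1,3) assms])
  obtain fs0 where "facelist M fs0" using cycle_dec_exists[OF pm(1,3)] by blast
  then obtain us fs where f: "facelist M ((us @ [d']) # fs)" "set (us @ [d']) = orbit (nxt M) d'"
    by (rule cycle_dec_head[OF _ pd(4)])
  have "d \<in> set (us @ [d'])" unfolding f(2) o[symmetric]
      by (rule permutes_self_in_orbit[OF pm(1,3)])
  then have "d \<in> set us" using pd by simp
  then obtain u1 u2 where u: "us = u1 @ d # u2" by (meson split_list)
  have dist0: "distinct (concat ((us @ [d']) # fs))" using cycle_decD(1)[OF f(1)] .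
  have u2: "u2 = []"
  proof (rule ccontr)
    assume "u2 \<noteq> []"
    then obtain h u3 where h: "u2 = h # u3" by (cases u2) auto
    have "nxt M d = h" by (rule facelist_nxt[of M u1 d h "u3 @ [d']" fs]) (use f(1) u h in simp)
    then show False using assms dist0 u h by auto
  qed
  have "facelist M ((u1 @ [d, d']) # fs)" using f(1) u u2 by simp
  from cycle_dec_append_commute[OF this] have g: "facelist M ((d # d' # u1) # fs)" by simp
  have dist: "distinct (concat ((d # d' # u1) # fs))" using cycle_decD(1)[OF g] .
  have D: "D = set (concat (u1 # fs))" unfolding D_def cycle_decD(2)[OF g, symmetric] using dist
      by auto
  have cyc: "cycle (nxt M) (d # d' # u1)" using cycle_decD(3)[OF g] by auto
  have "u1 \<noteq> []"
  proof
    assume "u1 = []"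
    then have "nxt M d' = d" using cyc by (simp add: cycle_def)
    then show False using not_all assms by simp
  qed
  then have s: "successively (\<lambda>x y. nxt M x = y) u1" "nxt M (last u1) = d" "nxt M d' = hd u1"
    using cyc by (auto simp: cycle_def successively_Cons)
  have inD: "set u1 \<subseteq> D" unfolding D by auto
  have "successively (\<lambda>x y. nxt (erase_edge d M) x = y) u1"
    by (rule successively_mono[OF s(1)]; use inD nxt_in in \<open>auto simp: subset_iff\<close>)
  moreover have "nxt (erase_edge d M) (last u1) = hd u1"
    using er(3)[of "last u1"] s(2,3) skip_d(1) inD \<open>u1 \<noteq> []\<close> by (auto simp: subset_iff)
  ultimately have c: "cycle (nxt (erase_edge d M)) u1" using \<open>u1 \<noteq> []\<close> by (simp add: cycle_def)
  have "cycle (nxt (erase_edge d M)) c" if "c \<in> set fs" for c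
    by (rule erase_keep) (use that D cycle_decD(3)[OF g] in auto)
  then have "facelist (erase_edge d M) (u1 # fs)"
    unfolding cycle_dec_def er(1) using D dist c by auto
  then show ?thesis using that g by blast
qed

text \<open>Together with the edge, a hanging edge takes away its end vertex, and an edge between
  two faces takes away one of these faces.\<close>

lemma erase_euler:
  assumes "premap (erase_edge d M)" "face_of M d \<noteq> face_of M d' \<or> nxt M d = d'"
  shows "euler_char (erase_edge d M) = euler_char M"
proof -
  note pm = premapD[OF pm0]
  have card: "card (darts M) = card D + 2"
    using d pd(3,4) pm(1) card_Diff_subset[of "{d, d'}" "darts M"] card_mono[of "darts M"
      "{d, d'}"] by (simp add: D_def)
  show ?thesis
  proof (cases "nxt M d = d'")
    case True
    obtain us fs where f: "facelist M ((d # d' # us) # fs)" "facelist (erase_edge d M) (us # fs)"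
      by (rule erase_hanging_facelist[OF True])
    have "orbs (rot M) (darts M) = orbs (rot (erase_edge d M)) D + 1"
        using erase_rot_orbs[OF assms(1)] True by simp
    then show ?thesis
        unfolding euler_char_eq[OF pm0] euler_char_eq[OF assms(1)] cycle_dec_orbs[OF f(1)] cycle_dec_orbs[OF f(2)] unfolding er(1) card by simp
  next
    case False
    then have fd: "face_of M d \<noteq> face_of M d'" using assms(2) by simp
    then obtain us vs fs where f: "facelist M ((d # us) # (d' # vs) # fs)"
        "facelist (erase_edge d M) ((us @ vs) # fs)"
      by (rule erase_merge_facelist)
    have "nxt M d' \<noteq> d" using fd orbit_step_eq[OF pm(1,3), of d' d] by (auto simp: face_of_def)
    then have "orbs (rot M) (darts M) = orbs (rot (erase_edge d M)) D"
        using erase_rot_orbs[OF assms(1)] False by simp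
    then show ?thesis
        unfolding euler_char_eq[OF pm0] euler_char_eq[OF assms(1)] cycle_dec_orbs[OF f(1)] cycle_dec_orbs[OF f(2)] unfolding er(1) card by simp
  qed
qed

lemma erase_lab: "x \<in> D \<Longrightarrow> lab (erase_edge d M) x = lab M x"
  by (rule er)

end

section \<open>Cutting along a path\<close>

text \<open>A form of \<open>cut_along\<close> without labels in which the new darts are recovered
  from \<open>opp M'\<close>. This leaves only the path as a parameter for the induction.\<close>

definition cutting :: "nat list \<Rightarrow> 'a diagram \<Rightarrow> 'a diagram \<Rightarrow> bool"
  where "cutting t M M' \<longleftrightarrow> (let a = map (opp M') t; b = map (\<lambda>x. opp M' (opp M x)) t in
    distinct (a @ b) \<and> set (a @ b) \<inter> darts M = {} \<and> darts M' = darts M \<union> set (a @ b) \<and>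
    (\<forall>x\<in>darts M. nxt M' x = nxt M x) \<and>
    (\<forall>x\<in>darts M - (set t \<union> opp M ` set t). opp M' x = opp M x) \<and>
    cycle (nxt M') (b @ rev a))"

lemma cyclic_nth_imp_cycle:
  assumes "c \<noteq> []" "\<forall>k<length c. p (c ! k) = c ! (Suc k mod length c)"
  shows "cycle p c"
proof -
  have "p (c ! k) = c ! Suc k" if "Suc k < length c" for k using assms(2)[rule_format, of k] that
      by simp
  then have "successively (\<lambda>x y. p x = y) c" by (simp add: successively_conv_nth)
  moreover have "p (last c) = hd c"
    using assms(2)[rule_format, of "length c - 1"] assms(1) by (simp add: last_conv_nth hd_conv_nth)
  ultimately show ?thesis using assms(1) by (simp add: cycle_def)
qed

lemma cut_along_cutting:
  assumes "cut_along t a b M M'" "t \<noteq> []"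
  shows "cutting t M M'" "a = map (opp M') t" "b = map (\<lambda>x. opp M' (opp M x)) t"
proof -
  note c = assms(1)[unfolded cut_along_def Let_def]
  have len: "length a = length t" "length b = length t" using c by blast+
  have k: "\<And>k. k < length t \<Longrightarrow> opp M' (t ! k) = a ! k \<and> opp M' (opp M (t ! k)) = b ! k" using c
      by blast
  show a: "a = map (opp M') t" by (rule nth_equalityI) (use len k in auto)
  show b: "b = map (\<lambda>x. opp M' (opp M x)) t" by (rule nth_equalityI) (use len k in auto)
  have "b @ rev a \<noteq> []" using assms(2) len by auto
  moreover have "\<forall>k<length (b @ rev a). nxt M' ((b @ rev a) ! k) = (b @ rev a) ! (Suc k mod length (b @ rev a))" using c by blast
  ultimately have "cycle (nxt M') (b @ rev a)" by (rule cyclic_nth_imp_cycle)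
  then show "cutting t M M'" unfolding cutting_def Let_def a[symmetric] b[symmetric] using c
      by blast
qed

lemma cutting_facelist:
  assumes "cutting t M M'" "facelist M fs"
  shows "facelist M' ((map (\<lambda>x. opp M' (opp M x)) t @ rev (map (opp M') t)) # fs)"
proof -
  let ?a = "map (opp M') t" and ?b = "map (\<lambda>x. opp M' (opp M x)) t"
  have c: "distinct (?a @ ?b)" "set (?a @ ?b) \<inter> darts M = {}" "darts M' = darts M \<union> set (?a @ ?b)"
    "\<And>x. x \<in> darts M \<Longrightarrow> nxt M' x = nxt M x" "cycle (nxt M') (?b @ rev ?a)"
    using assms(1) unfolding cutting_def Let_def by blast+
  have "cycle_dec (nxt M') (darts M) fs" using cycle_dec_cong[of "darts M" "nxt M'"
      "nxt M", OF c(4)] assms(2) by blast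
  then have f: "distinct (concat fs)" "set (concat fs) = darts M" "\<forall>f\<in>set fs. cycle (nxt M') f"
      by (auto simp: cycle_dec_def)
  have "distinct (concat ((?b @ rev ?a) # fs))"
    unfolding concat.simps distinct_append f(2) using c(1,2) f(1) by auto
  moreover have "set (concat ((?b @ rev ?a) # fs)) = darts M'"
    unfolding concat.simps set_append f(2) c(3) by auto
  ultimately show ?thesis using c(5) f(3) unfolding cycle_dec_def by simp
qed

text \<open>The end vertices of the edges are distinct, but nothing is required of the start vertex.
  This also covers a cut along a single edge that is a loop.\<close>

fun cpath :: "'a diagram \<Rightarrow> nat list \<Rightarrow> bool"
  where
    "cpath M (t # t' # s) \<longleftrightarrow> orbit (rot M) (opp M t) = orbit (rot M) t' \<and>
      orbit (rot M) (opp M t) \<notin> (\<lambda>z. orbit (rot M) (opp M z)) ` set (t' # s) \<and> cpath M (t' # s)"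
  | "cpath M _ \<longleftrightarrow> True"

lemma cpath_transfer:
  assumes "cpath M s" "set s \<subseteq> darts M" "premap M"
    and iff: "\<And>z z'. z \<in> darts M \<Longrightarrow> z' \<in> darts M \<Longrightarrow> orbit (rot M') z = orbit (rot M') z' \<longleftrightarrow> orbit (rot M) z = orbit (rot M) z'"
    and opp: "\<And>z. z \<in> set s \<Longrightarrow> opp M' z = opp M z"
  shows "cpath M' s"
  using assms(1,2) opp
proof (induction s)
  case (Cons t r)
  show ?case
  proof (cases r)
    case (Cons t' s)
    have d: "t \<in> darts M" "t' \<in> darts M" "opp M t \<in> darts M"
        using Cons.prems(2) Cons premapD(7)[OF assms(3)] by auto
    have "orbit (rot M') (opp M' t) \<noteq> orbit (rot M') (opp M' z)" if z: "z \<in> set r" for z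
    proof -
      have "opp M z \<in> darts M" using Cons.prems(2) z premapD(7)[OF assms(3)] by auto
      moreover have "orbit (rot M) (opp M t) \<noteq> orbit (rot M) (opp M z)" using Cons.prems(1) Cons z
          by auto
      moreover have "opp M' t = opp M t" "opp M' z = opp M z" using Cons.prems(3) z by auto
      ultimately show ?thesis using iff d by simp
    qed
    then have "orbit (rot M') (opp M' t) \<notin> (\<lambda>z. orbit (rot M') (opp M' z)) ` set r" by blast
    moreover have "orbit (rot M') (opp M' t) = orbit (rot M') t'"
      using iff[OF d(3,2)] Cons.prems(1,3) Cons by simp
    moreover have "cpath M' r" using Cons.IH Cons.prems Cons by simp
    ultimately show ?thesis unfolding Cons by simp
  qed simp
qed simp

text \<open>The second conjunct, that the vertices not in the interior of the path stay as they are, only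
  serves to make the induction work.\<close>

lemma cut_euler:
  assumes "premap M" "premap M'" "t \<noteq> []" "set t \<subseteq> darts M" "cutting t M M'" "cpath M t"
  shows "euler_char M' = euler_char M \<and> (\<forall>x\<in>darts M. \<forall>y\<in>darts M.
    orbit (rot M) x \<notin> (\<lambda>z. orbit (rot M) (opp M z)) ` set (butlast t) \<longrightarrow>
    orbit (rot M) y \<notin> (\<lambda>z. orbit (rot M) (opp M z)) ` set (butlast t) \<longrightarrow>
    (orbit (rot M') x = orbit (rot M') y \<longleftrightarrow> orbit (rot M) x = orbit (rot M) y))"
  using assms
proof (induction t arbitrary: M M')
  case Nil then show ?case by simp
next
  case (Cons t0 ts)
  define a0 where "a0 = opp M' t0"
  define b0 where "b0 = opp M' (opp M t0)"
  let ?a = "map (opp M') (t0 # ts)" and ?b = "map (\<lambda>x. opp M' (opp M x)) (t0 # ts)"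
  have c: "distinct (?a @ ?b)" "set (?a @ ?b) \<inter> darts M = {}" "darts M' = darts M \<union> set (?a @ ?b)"
    "\<And>x. x \<in> darts M \<Longrightarrow> nxt M' x = nxt M x" "cycle (nxt M') (?b @ rev ?a)"
    "\<And>x. x \<in> darts M - (set (t0 # ts) \<union> opp M ` set (t0 # ts)) \<Longrightarrow> opp M' x = opp M x"
    using Cons.prems(5) unfolding cutting_def Let_def by blast+
  note pm = premapD[OF Cons.prems(1)] and pm' = premapD[OF Cons.prems(2)]
  have t0: "t0 \<in> darts M" using Cons.prems(4) by simp
  have ab: "a0 \<notin> darts M" "b0 \<notin> darts M" "a0 \<noteq> b0" using c(1,2) by (auto simp: a0_def b0_def)
  \<comment> \<open>The first edge is doubled on its own. If it is the whole path, the result has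
    the same darts and permutations as \<open>M'\<close>; otherwise the rest of the path is cut in
    \<open>M1\<close>.\<close>
  define M1 where "M1 = cut1 a0 b0 t0 M"
  have pm1: "premap M1" unfolding M1_def by (rule cut1_premap[OF Cons.prems(1) t0 ab])
  have e1: "euler_char M1 = euler_char M" unfolding M1_def
      by (rule cut1_euler[OF Cons.prems(1) t0 ab])
  have iff1: "\<And>z w. z \<in> darts M \<Longrightarrow> w \<in> darts M \<Longrightarrow> orbit (rot M1) z = orbit (rot M1) w \<longleftrightarrow> orbit (rot M) z = orbit (rot M) w"
    unfolding M1_def by (rule cut1_orbit_eq_iff[OF Cons.prems(1) t0 ab])
  note o1 = cut1_opp[OF Cons.prems(1) t0 ab, folded M1_def]
  have D1: "darts M1 = insert a0 (insert b0 (darts M))" by (simp add: M1_def)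
  have n1: "nxt M1 a0 = b0" "nxt M1 b0 = a0" "\<And>z. z \<in> darts M \<Longrightarrow> nxt M1 z = nxt M z" using ab
      by (auto simp: M1_def)
  have o': "opp M' t0 = a0" "opp M' (opp M t0) = b0" "opp M' a0 = t0" "opp M' b0 = opp M t0"
    using pm'(5) by (simp_all add: a0_def b0_def)
  have ot0: "opp M t0 \<in> darts M" using pm(7) t0 by simp
  show ?case
  proof (cases ts)
    case Nil
    have DD: "darts M' = darts M1" using c(3) Nil by (auto simp: D1 a0_def b0_def)
    have "opp M' z = opp M1 z" for z
    proof (cases "z \<in> darts M1")
      case True
      then consider "z = a0" | "z = b0" | "z = t0" | "z = opp M t0" | "z \<in> darts M" "z \<noteq> t0"
          "z \<noteq> opp M t0" unfolding D1 by blast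
      then show ?thesis
      proof cases
        case 5
        then have "opp M' z = opp M z" using c(6) Nil by simp
        then show ?thesis using o1(5) 5 by simp
      qed (simp_all only: o' o1)
    next
      case False
      then show ?thesis using pm'(2) premapD(2)[OF pm1] DD by (simp add: permutes_not_in)
    qed
    then have oo: "opp M' = opp M1" by (rule ext)
    have cy: "nxt M' b0 = a0" "nxt M' a0 = b0" using c(5) Nil
        by (simp_all add: cycle_def flip: a0_def b0_def)
    have "nxt M' z = nxt M1 z" for z
    proof (cases "z \<in> darts M1")
      case True
      then consider "z = a0" | "z = b0" | "z \<in> darts M" unfolding D1 by blast
      then show ?thesis by cases (simp_all only: cy n1 c(4))
    next
      case False
      then show ?thesis using pm'(3) premapD(3)[OF pm1] DD by (simp add: permutes_not_in)
    qed
    then have nn: "nxt M' = nxt M1" by (rule ext)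
    have rr: "rot M' = rot M1" by (rule ext) (simp add: rot_def oo nn)
    have "euler_char M' = euler_char M"
        unfolding euler_char_eq[OF Cons.prems(2)] e1[symmetric] euler_char_eq[OF pm1] rr nn DD ..
    then show ?thesis using iff1 unfolding rr by simp
  next
    case (Cons t1 s)
    define a1 where "a1 = opp M' t1"
    \<comment> \<open>Splitting the new polygon of \<open>M'\<close> separates the digon over
      \<open>t0\<close> from the polygon over \<open>ts\<close>. Hence \<open>M2\<close> arises from
      \<open>M1\<close> by cutting along \<open>ts\<close>, and the induction hypothesis applies to
      it.\<close>
    define M2 where "M2 = swap_nxt b0 a1 M'"
    have in': "a0 \<in> darts M'" "b0 \<in> darts M'" "a1 \<in> darts M'" using c(3) Cons
        by (auto simp: a0_def b0_def a1_def)
    have pm2: "premap M2" unfolding M2_def by (rule swap_nxt_premap[OF Cons.prems(2) in'(2,3)])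
    have ts: "set ts \<subseteq> darts M" "t1 \<in> darts M" using Cons.prems(4) Cons by auto
    have cp: "orbit (rot M) (opp M t0) = orbit (rot M) t1"
      "orbit (rot M) (opp M t0) \<notin> (\<lambda>z. orbit (rot M) (opp M z)) ` set ts" "cpath M ts"
      using Cons.prems(6) Cons by auto
    have t0n: "t0 \<notin> set ts" "opp M t0 \<notin> set ts"
    proof -
      have "opp M' t0 \<notin> set (map (opp M') ts)" using c(1) by auto
      then show "t0 \<notin> set ts" by auto
      have "b0 \<notin> set (map (opp M') ts)" using c(1) by (auto simp: b0_def)
      then show "opp M t0 \<notin> set ts" by (auto simp: b0_def)
    qed
    have ots: "opp M1 z = opp M z" if "z \<in> set ts" for z using o1(5)[of z] that t0n ts by blast
    have maps: "map (\<lambda>x. opp M' (opp M1 x)) ts = map (\<lambda>x. opp M' (opp M x)) ts" using ots by simp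
    let ?a' = "map (opp M') ts" and ?b' = "map (\<lambda>x. opp M' (opp M x)) ts"
    obtain fs where fs: "facelist M fs" using cycle_dec_exists[OF pm(1,3)] by blast
    have rev: "rev ?a = rev (map (opp M') s) @ [a1] @ [a0]" by (simp add: Cons a0_def a1_def)
    have "facelist M' (((b0 # ?b' @ rev (map (opp M') s) @ [a1]) @ [a0]) # fs)"
      using cutting_facelist[OF Cons.prems(5) fs] unfolding rev by (simp add: b0_def)
    from cycle_dec_append_commute[OF this]
    have f': "facelist M' (([a0] @ [b0] @ (?b' @ rev (map (opp M') s)) @ [a1]) # fs)" by simp
    have f2: "facelist M2 (([a0] @ [b0]) # ((?b' @ rev (map (opp M') s)) @ [a1]) # fs)"
      using swap_split_cycle[OF f'] unfolding M2_def swap_nxt_simps .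
    have ra: "rev ?a' = rev (map (opp M') s) @ [a1]" by (simp add: Cons a1_def)
    have M2s: "darts M2 = darts M'" "opp M2 = opp M'" "nxt M2 = nxt M' \<circ> transpose b0 a1"
        by (simp_all add: M2_def)
    have a1n: "a1 \<notin> darts M" "a1 \<noteq> b0" "a1 \<noteq> a0" using c(1,2) Cons
        by (auto simp: a1_def b0_def a0_def)
    have n2: "nxt M2 z = nxt M z" if "z \<in> darts M" for z
    proof -
      have "z \<noteq> b0" "z \<noteq> a1" using that ab a1n by auto
      then show ?thesis using c(4)[OF that] unfolding M2s by simp
    qed
    have cyc2: "cycle (nxt M2) [a0, b0]" "cycle (nxt M2) (?b' @ rev ?a')"
      using cycle_decD(3)[OF f2] unfolding ra by simp_all
    have cut': "cutting ts M1 M2"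
      unfolding cutting_def Let_def M2s(2) maps
    proof (intro conjI ballI)
      show "distinct (?a' @ ?b')" using c(1) by auto
      show "set (?a' @ ?b') \<inter> darts M1 = {}" using c(1,2) unfolding D1 by (auto simp: a0_def b0_def)
      show "darts M2 = darts M1 \<union> set (?a' @ ?b')" unfolding M2s D1 c(3)
        by (auto simp: a0_def b0_def)
      show "cycle (nxt M2) (?b' @ rev ?a')" by (rule cyc2)
      fix x assume "x \<in> darts M1"
      then consider "x = a0" | "x = b0" | "x \<in> darts M" unfolding D1 by blast
      then show "nxt M2 x = nxt M1 x"
      proof cases
        case 3 then show ?thesis using n2 n1(3) by simp
      qed (use cyc2(1) n1 in \<open>simp_all add: cycle_def\<close>)
    next
      fix x assume x: "x \<in> darts M1 - (set ts \<union> opp M1 ` set ts)"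
      then consider "x = a0" | "x = b0" | "x = t0" | "x = opp M t0" | "x \<in> darts M" "x \<noteq> t0"
          "x \<noteq> opp M t0" unfolding D1 by blast
      then show "opp M' x = opp M1 x"
      proof cases
        case 5
        have "opp M1 ` set ts = opp M ` set ts" using ots by simp
        then have "x \<in> darts M - (set (t0 # ts) \<union> opp M ` set (t0 # ts))" using x 5 by auto
        from c(6)[OF this] show ?thesis using o1(5) 5 by simp
      qed (simp_all only: o' o1)
    qed
    have cp1: "cpath M1 ts" by (rule cpath_transfer[OF cp(3) ts(1) Cons.prems(1) iff1 ots])
    have ts1: "ts \<noteq> []" "set ts \<subseteq> darts M1" using Cons ts D1 by auto
    note IH = Cons.IH[OF pm1 pm2 ts1 cut' cp1]
    have orb1: "(\<lambda>z. orbit (rot M1) (opp M1 z)) ` set (butlast ts) = (\<lambda>z. orbit (rot M1) (opp M z)) ` set (butlast ts)"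
      using ots by (intro image_cong) (auto dest: in_set_butlastD)
    have IH2: "orbit (rot M2) x = orbit (rot M2) y \<longleftrightarrow> orbit (rot M) x = orbit (rot M) y"
      if xy: "x \<in> darts M" "y \<in> darts M"
        "orbit (rot M) x \<notin> (\<lambda>z. orbit (rot M) (opp M z)) ` set (butlast ts)"
        "orbit (rot M) y \<notin> (\<lambda>z. orbit (rot M) (opp M z)) ` set (butlast ts)" for x y
    proof -
      have ni: "orbit (rot M1) z \<notin> (\<lambda>z. orbit (rot M1) (opp M1 z)) ` set (butlast ts)"
        if z: "z \<in> darts M" "orbit (rot M) z \<notin> (\<lambda>z. orbit (rot M) (opp M z)) ` set (butlast ts)"
          for z
        unfolding orb1
      proof
        assume "orbit (rot M1) z \<in> (\<lambda>z. orbit (rot M1) (opp M z)) ` set (butlast ts)"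
        then obtain w where w: "w \<in> set (butlast ts)"
            "orbit (rot M1) z = orbit (rot M1) (opp M w)" by blast
        then have "w \<in> darts M" using ts(1) in_set_butlastD by fast
        then have "opp M w \<in> darts M" using pm(7) by simp
        then show False using iff1[OF z(1)] w z(2) by blast
      qed
      have "x \<in> darts M1" "y \<in> darts M1" using xy D1 by auto
      then have "orbit (rot M2) x = orbit (rot M2) y \<longleftrightarrow> orbit (rot M1) x = orbit (rot M1) y"
        using IH ni[OF xy(1,3)] ni[OF xy(2,4)] by blast
      then show ?thesis using iff1[OF xy(1,2)] by blast
    qed
    have v1: "orbit (rot M) (opp M t0) \<notin> (\<lambda>z. orbit (rot M) (opp M z)) ` set (butlast ts)"
    proof -
      have "set (butlast ts) \<subseteq> set ts" by (auto dest: in_set_butlastD)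
      then show ?thesis using cp(2) by blast
    qed
    \<comment> \<open>The vertex between \<open>t0\<close> and \<open>t1\<close> is not in the
      interior of \<open>ts\<close>, so in \<open>M2\<close> it is still a single vertex. Joining
      the digon and the polygon there trades a face for a vertex.\<close>
    have same2: "orbit (rot M2) (opp M t0) = orbit (rot M2) t1"
      using IH2[OF ot0 ts(2) v1] v1 cp(1) by simp
    have oo: "opp M2 b0 = opp M t0" "opp M2 a1 = t1" using o' pm'(5) unfolding M2s
        by (simp_all add: a1_def)
    \<comment> \<open>A swap is an involution, so \<open>M'\<close> is recovered from
      \<open>M2\<close> by the very same one.\<close>
    have bk: "M' = swap_nxt b0 a1 M2"
    proof -
      have "nxt M' \<circ> transpose b0 a1 \<circ> transpose b0 a1 = nxt M'" by (simp add: comp_assoc)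
      then show ?thesis by (simp add: M2_def swap_nxt_def)
    qed
    have "orbit (nxt M2) b0 = {a0, b0}"
      using facelist_orbit[OF f2, of b0] by simp
    moreover have "orbit (nxt M2) a1 = set ((?b' @ rev (map (opp M') s)) @ [a1])"
      by (rule facelist_orbit2[OF f2]) simp
    ultimately have od: "orbit (nxt M2) b0 \<noteq> orbit (nxt M2) a1" using a1n by auto
    have in2: "b0 \<in> darts M2" "a1 \<in> darts M2" using in' M2s by auto
    have so: "orbit (rot M2) (opp M2 b0) = orbit (rot M2) (opp M2 a1)" unfolding oo by (rule same2)
    have "euler_char M' = euler_char M2"
      using swap_nxt_euler[OF pm2 in2 a1n(2)[symmetric]] od so unfolding bk[symmetric] by simp
    then have E: "euler_char M' = euler_char M" using IH e1 by simp
    have bl: "butlast (t0 # ts) = t0 # butlast ts" using ts1(1) by simp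
    note pm2D = premapD[OF pm2]
    have rot': "rot M' = rot M2 \<circ> transpose (opp M2 b0) (opp M2 a1)"
      using swap_nxt_rot[OF pm2, of b0 a1] unfolding bk[symmetric] .
    have no: "opp M2 b0 \<noteq> opp M2 a1" using pm2D(9)[of b0 a1] a1n(2) by simp
    have ind: "opp M2 b0 \<in> darts M2" "opp M2 a1 \<in> darts M2" using pm2D(7) in2 by auto
    have orb': "orbit (rot M') x = orbit (rot M2) x"
      if x: "x \<in> darts M"
        "orbit (rot M) x \<notin> (\<lambda>z. orbit (rot M) (opp M z)) ` set (t0 # butlast ts)" for x
    proof -
      have "orbit (rot M2) x \<noteq> orbit (rot M2) (opp M t0)"
        using IH2[OF x(1) ot0 _ v1] x(2) by auto
      then have "x \<notin> orbit (rot M2) (opp M2 b0)"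
        using orbit_eq_of_mem[OF pm2D(1,4) ind(1)] unfolding oo by blast
      moreover have "x \<in> darts M2" using x c(3) M2s by auto
      ultimately show ?thesis unfolding rot' using orbs_swap_split(2)[OF pm2D(1,4) ind so no]
          by blast
    qed
    show ?thesis unfolding bl
    proof (intro conjI ballI impI)
      show "euler_char M' = euler_char M" by (rule E)
      fix x y assume xy: "x \<in> darts M" "y \<in> darts M"
        "orbit (rot M) x \<notin> (\<lambda>z. orbit (rot M) (opp M z)) ` set (t0 # butlast ts)"
        "orbit (rot M) y \<notin> (\<lambda>z. orbit (rot M) (opp M z)) ` set (t0 # butlast ts)"
      then show "orbit (rot M') x = orbit (rot M') y \<longleftrightarrow> orbit (rot M) x = orbit (rot M) y"
        unfolding orb'[OF xy(1,3)] orb'[OF xy(2,4)] by (intro IH2) auto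
    qed
  qed
qed

lemma is_path_spath:
  assumes "is_path M (origin M u) s (origin M w)" "premap M" "u \<in> darts M"
    "distinct (origin M u # map (terminus M) s)"
  shows "spath M u s w"
  using assms
proof (induction s arbitrary: u)
  case Nil then show ?case by (simp add: origin_def)
next
  case (Cons t s)
  have t: "t \<in> darts M" "origin M t = origin M u" "is_path M (origin M (opp M t)) s (origin M w)"
    using Cons.prems(1) by (auto simp: terminus_def)
  have "opp M t \<in> darts M" using premapD(7)[OF assms(2)] t(1) by simp
  moreover have "distinct (origin M (opp M t) # map (terminus M) s)" using Cons.prems(4)
    by (simp add: terminus_def[symmetric])
  ultimately have "spath M (opp M t) s w" using Cons.IH t(3) assms(2) by blast
  moreover have "orbit (rot M) u \<notin> (\<lambda>z. orbit (rot M) (opp M z)) ` set (t # s)"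
    using Cons.prems(4) by (auto simp: terminus_def origin_def)
  ultimately show ?case using t(1,2) by (simp add: origin_def)
qed

lemma is_path_cpath:
  assumes "is_path M x s y" "distinct (map (terminus M) s)"
  shows "cpath M s"
  using assms
proof (induction M s arbitrary: x rule: cpath.induct)
  case (1 M t t' s)
  have "is_path M (terminus M t) (t' # s) y" using 1(2) by simp
  then have "cpath M (t' # s)" "origin M t' = terminus M t" using 1(1)[of "terminus M t"] 1(3)
      by auto
  then show ?case using 1(3) by (auto simp: terminus_def origin_def)
qed simp_all

lemma is_path_darts: "is_path M x s y \<Longrightarrow> set s \<subseteq> darts M"
  by (induction s arbitrary: x) auto

section \<open>Words and their values\<close>

lemma free_group_simps [simp]:
  "carrier (free_group A) = {w \<in> words A. freely_reduced w}"
  "u \<otimes>\<^bsub>free_group A\<^esub> v = red (u @ v)" "\<one>\<^bsub>free_group A\<^esub> = []"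
  by (simp_all add: free_group_def)

lemma red_in_free_group: "w \<in> words A \<Longrightarrow> red w \<in> carrier (free_group A)"
  by (simp add: red_in_words freely_reduced_red)

lemma red_Nil [simp]: "red [] = []"
  by (simp add: red_def)

lemma red_mult: "red u \<otimes>\<^bsub>free_group A\<^esub> red v = red (u @ v)"
  by (simp add: red_red_left red_red_right)

lemma red_inv:
  assumes "w \<in> words A"
  shows "inv\<^bsub>free_group A\<^esub> (red w) = red (inv_word w)"
proof -
  interpret F: group "free_group A" by (rule group_free_group)
  have 1: "red w \<in> carrier (free_group A)" "red (inv_word w) \<in> carrier (free_group A)"
    using assms by (intro red_in_free_group; simp)+
  have "red (inv_word w) \<otimes>\<^bsub>free_group A\<^esub> red w = \<one>\<^bsub>free_group A\<^esub>"
    unfolding red_mult by (simp add: red_inv_word)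
  then show ?thesis using F.inv_equality 1 by blast
qed

lemma normal_closure_subset:
  assumes "H \<lhd> K" "S \<subseteq> H"
  shows "normal_closure K S \<subseteq> H"
  using assms by (auto simp: normal_closure_def)

lemma normal_closure_superset: "S \<subseteq> normal_closure K S"
  by (auto simp: normal_closure_def)

lemma (in group) normal_normal_closure:
  assumes "S \<subseteq> carrier G"
  shows "normal_closure G S \<lhd> G"
proof -
  have G: "carrier G \<lhd> G" using normal_invI[OF subgroup_self] by simp
  have sub: "\<And>H. H \<lhd> G \<Longrightarrow> subgroup H G" by (simp add: normal_def)
  show ?thesis
  proof (rule normal_invI)
    show "subgroup (normal_closure G S) G"
    proof (rule subgroupI)
      show "normal_closure G S \<subseteq> carrier G" using normal_closure_subset[OF G assms] .
      show "normal_closure G S \<noteq> {}"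
        unfolding normal_closure_def using subgroup.one_closed[OF sub] by blast
      fix a assume "a \<in> normal_closure G S"
      then show "inv a \<in> normal_closure G S"
        unfolding normal_closure_def using subgroup.m_inv_closed[OF sub] by blast
      fix b assume "b \<in> normal_closure G S"
      then show "a \<otimes> b \<in> normal_closure G S" using \<open>a \<in> normal_closure G S\<close>
        unfolding normal_closure_def using subgroup.m_closed[OF sub] by blast
    qed
    fix x h assume xh: "x \<in> carrier G" "h \<in> normal_closure G S"
    show "x \<otimes> h \<otimes> inv x \<in> normal_closure G S"
      unfolding normal_closure_def
    proof (rule InterI)
      fix H assume H: "H \<in> {H. H \<lhd> G \<and> S \<subseteq> H}"
      then have "h \<in> H" using xh(2) by (auto simp: normal_closure_def)
      moreover have "H \<lhd> G" using H by simp
      ultimately show "x \<otimes> h \<otimes> inv x \<in> H" using normal.inv_op_closed2 xh(1) by metis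
    qed
  qed
qed

context group
begin

lemma conjugate_in_refl: "x \<in> carrier G \<Longrightarrow> conjugate_in G x x"
  unfolding conjugate_in_def by (intro bexI[of _ \<one>]) auto

lemma conjugate_in_sym:
  assumes "conjugate_in G x y" "x \<in> carrier G" shows "conjugate_in G y x"
proof -
  obtain g where g: "g \<in> carrier G" "y = g \<otimes> x \<otimes> inv g" using assms(1)
      by (auto simp: conjugate_in_def)
  have "x = inv g \<otimes> y \<otimes> inv (inv g)" using g assms(2)
      by (simp add: m_assoc inv_solve_left')  (simp add: m_assoc[symmetric])
  then show ?thesis using g unfolding conjugate_in_def by blast
qed

lemma conjugate_in_trans:
  assumes "conjugate_in G x y" "conjugate_in G y z" "x \<in> carrier G" shows "conjugate_in G x z"
proof -
  obtain g where g: "g \<in> carrier G" "y = g \<otimes> x \<otimes> inv g" using assms(1)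
      by (auto simp: conjugate_in_def)
  obtain h where h: "h \<in> carrier G" "z = h \<otimes> y \<otimes> inv h" using assms(2)
      by (auto simp: conjugate_in_def)
  have "z = (h \<otimes> g) \<otimes> x \<otimes> inv (h \<otimes> g)" using g h assms(3) by (simp add: m_assoc inv_mult_group)
  then show ?thesis using g h unfolding conjugate_in_def by blast
qed

end

section \<open>Evaluation of words in the group\<close>

locale generated_group = group G for G (structure) +
  fixes \<gamma> :: "'a \<Rightarrow> 'g" and A :: "'a set"
  assumes gam: "\<gamma> ` A \<subseteq> carrier G" and gen: "generate G (\<gamma> ` A) = carrier G"
begin

abbreviation ev :: "'a word \<Rightarrow> 'g"
  where "ev \<equiv> eval_word G \<gamma>"

lemma ev_Nil [simp]: "ev [] = \<one>"
  by (simp add: eval_word_def)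

lemma ev_Cons: "ev (x # w) = (if snd x then \<gamma> (fst x) else inv (\<gamma> (fst x))) \<otimes> ev w"
  by (simp add: eval_word_def case_prod_beta)

lemma letter_closed: "x \<in> A \<times> UNIV \<Longrightarrow> (if snd x then \<gamma> (fst x) else inv (\<gamma> (fst x))) \<in> carrier G"
  using gam by (auto simp: mem_Times_iff)

lemma ev_closed [simp]: "w \<in> words A \<Longrightarrow> ev w \<in> carrier G"
proof (induction w)
  case (Cons x w)
  then show ?case using letter_closed[of x] unfolding ev_Cons words_Cons by blast
qed simp

lemma ev_append: "u \<in> words A \<Longrightarrow> v \<in> words A \<Longrightarrow> ev (u @ v) = ev u \<otimes> ev v"
proof (induction u)
  case (Cons x u)
  then have x: "(if snd x then \<gamma> (fst x) else inv (\<gamma> (fst x))) \<in> carrier G" "u \<in> words A"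
    using letter_closed[of x] unfolding words_Cons by blast+
  then show ?case using Cons.IH Cons.prems(2) unfolding append_Cons ev_Cons by (simp add: m_assoc)
qed simp

lemma ev_inv_letter:
  assumes "x \<in> A \<times> UNIV" shows "ev [inv_letter x] = inv (ev [x])"
proof -
  have "\<gamma> (fst x) \<in> carrier G" using gam assms by (auto simp: mem_Times_iff)
  then show ?thesis by (simp add: ev_Cons inv_letter_def)
qed

lemma ev_inv_word: "w \<in> words A \<Longrightarrow> ev (inv_word w) = inv (ev w)"
proof (induction w)
  case (Cons x w)
  have x: "x \<in> A \<times> UNIV" "w \<in> words A" using Cons.prems by (simp_all only: words_Cons)
  have xs: "[x] \<in> words A" using x by (simp only: words_Cons words_Nil)
  have xi: "[inv_letter x] \<in> words A" using x by (simp only: words_Cons words_Nil inv_letter_in)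
  have "ev (inv_word (x # w)) = inv (ev w) \<otimes> inv (ev [x])"
    unfolding inv_word_Cons using x xi Cons.IH
      by (subst ev_append) (simp_all add: ev_inv_letter[OF x(1)])
  also have "\<dots> = inv (ev [x] \<otimes> ev w)" using x xs by (simp add: inv_mult_group)
  also have "ev [x] \<otimes> ev w = ev (x # w)" using ev_append[OF xs x(2)] by simp
  finally show ?case .
qed simp

lemma ev_red: "w \<in> words A \<Longrightarrow> ev (red w) = ev w"
proof (induction w)
  case (Cons x w)
  have x: "x \<in> A \<times> UNIV" "w \<in> words A" using Cons.prems by (simp_all only: words_Cons)
  have xs: "[x] \<in> words A" using x by (simp only: words_Cons words_Nil)
  have r: "red (x # w) = cons_red x (red w)" by (simp add: red_def)
  have rw: "red w \<in> words A" using red_in_words x(2) .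
  have xw: "ev (x # w) = ev [x] \<otimes> ev w" using ev_append[OF xs x(2)] by simp
  show ?case
  proof (cases "red w \<noteq> [] \<and> hd (red w) = inv_letter x")
    case True
    then obtain v where v: "red w = inv_letter x # v" by (cases "red w") auto
    have vw: "v \<in> words A" "[inv_letter x] \<in> words A" using rw x unfolding v by simp_all
    have "ev w = ev [inv_letter x] \<otimes> ev v" using Cons.IH[OF x(2)] ev_append[OF vw(2,1)] v by simp
    then have "ev (x # w) = ev [x] \<otimes> (inv (ev [x]) \<otimes> ev v)" unfolding xw ev_inv_letter[OF x(1)]
        by simp
    also have "\<dots> = ev v" using xs vw(1) by (simp add: m_assoc[symmetric])
    finally show ?thesis unfolding r cons_red_def using v True by simp
  next
    case False
    then show ?thesis unfolding r cons_red_def using Cons.IH[OF x(2)] ev_append[OF xs rw] xw by auto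
  qed
qed simp

lemma ev_hom: "ev \<in> hom (free_group A) G"
  by (rule homI) (auto simp: ev_red ev_append)

lemma ev_group_hom: "group_hom (free_group A) G ev"
  by (simp add: group_hom_def group_hom_axioms_def ev_hom group_free_group is_group)

lemma ev_surj: "ev ` carrier (free_group A) = carrier G"
proof
  show "ev ` carrier (free_group A) \<subseteq> carrier G" by auto
  have "\<gamma> ` A \<subseteq> ev ` carrier (free_group A)"
  proof
    fix g assume "g \<in> \<gamma> ` A"
    then obtain a where a: "a \<in> A" "g = \<gamma> a" by blast
    have "[(a, True)] \<in> carrier (free_group A)" using a by (simp add: freely_reduced_def)
    moreover have "ev [(a, True)] = g" using a gam by (auto simp: ev_Cons)
    ultimately show "g \<in> ev ` carrier (free_group A)" by (metis imageI)
  qed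
  then have "generate G (\<gamma> ` A) \<subseteq> ev ` carrier (free_group A)"
    using generate_subgroup_incl group_hom.img_is_subgroup[OF ev_group_hom] by blast
  then show "carrier G \<subseteq> ev ` carrier (free_group A)" using gen by simp
qed

definition relset :: "'a word set"
  where "relset = relators G \<gamma> A"

lemma relset_iff: "w \<in> relset \<longleftrightarrow> w \<in> words A \<and> ev w = \<one>"
  by (simp add: relset_def relators_def)

lemma ev_eq_one_commute:
  assumes "u \<in> words A" "v \<in> words A" "ev (u @ v) = \<one>" shows "ev (v @ u) = \<one>"
  using assms by (simp add: ev_append) (metis ev_closed inv_comm)

lemma relset_rotation_closed: "rotation_closed relset"
  unfolding rotation_closed_def
proof (intro allI impI)
  fix w n assume w: "w \<in> relset"
  show "rotate n w \<in> relset"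
  proof (induction n)
    case 0 then show ?case using w by simp
  next
    case (Suc n)
    show ?case
    proof (cases "rotate n w")
      case Nil then show ?thesis using Suc by simp
    next
      case (Cons x v)
      have xv: "[x] \<in> words A" "v \<in> words A" using Suc unfolding Cons relset_iff by simp_all
      have "rotate (Suc n) w = v @ [x]" using Cons by simp
      moreover have "ev ([x] @ v) = \<one>" using Suc unfolding Cons relset_iff by simp
      ultimately show ?thesis using ev_eq_one_commute[OF xv] xv unfolding relset_iff by simp
    qed
  qed
qed

text \<open>Keeps the label trivial when an edge with label \<open>l\<close> between two 0-faces is
  erased: the face that arises is read as \<open>u\<close> followed by \<open>v\<close>. The next
  lemma does the same for a hanging edge.\<close>

lemma relset_cancel:
  assumes "l # u \<in> relset" "inv_letter l # v \<in> relset"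
  shows "u @ v \<in> relset"
proof -
  have w: "[l] \<in> words A" "u \<in> words A" "[inv_letter l] \<in> words A" "v \<in> words A" "l \<in> A \<times> UNIV"
      using assms unfolding relset_iff by simp_all
  have "ev [l] \<otimes> ev u = \<one>" using assms(1) ev_append[OF w(1,2)] unfolding relset_iff by simp
  then have u: "ev u = inv (ev [l])" using w by (metis ev_closed inv_equality inv_comm)
  have "inv (ev [l]) \<otimes> ev v = \<one>" using assms(2) ev_append[OF w(3,4)] ev_inv_letter[OF w(5)]
      unfolding relset_iff by simp
  then show ?thesis using w unfolding relset_iff by (simp add: ev_append u)
qed

lemma relset_cancel_pair:
  assumes "l # inv_letter l # u \<in> relset"
  shows "u \<in> relset"
proof -
  have w: "[l] \<in> words A" "u \<in> words A" "[inv_letter l] \<in> words A" "l \<in> A \<times> UNIV" using assms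
      unfolding relset_iff by simp_all
  have "ev [l] \<otimes> (inv (ev [l]) \<otimes> ev u) = \<one>"
      using assms ev_append[OF w(1), of "[inv_letter l] @ u"] ev_append[OF w(3,2)] w
      ev_inv_letter[OF w(4)] unfolding relset_iff by simp
  then have "ev u = \<one>" using w by (simp add: m_assoc[symmetric])
  then show ?thesis using w unfolding relset_iff by simp
qed

lemma relset_inv_word: "w \<in> words A \<Longrightarrow> w @ inv_word w \<in> relset"
  unfolding relset_iff by (simp add: ev_append ev_inv_word)

end

section \<open>The level groups and conjugacy in them\<close>

locale graded_presentation = generated_group G \<gamma> A
  for G (structure) and \<gamma> :: "'a \<Rightarrow> 'g" and A :: "'a set" +
  fixes R Rp :: "nat \<Rightarrow> 'a word set"
  assumes graded: "graded_relators A relset R"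
    and reduced: "\<And>i. i \<ge> 1 \<Longrightarrow> reduced_relators A relset R i (Rp i)"
begin

abbreviation F :: "'a word monoid" where "F \<equiv> free_group A"
abbreviation LK :: "nat \<Rightarrow> 'a word set" where "LK \<equiv> level_kernel A relset R"
abbreviation LG :: "nat \<Rightarrow> 'a word set monoid" where "LG \<equiv> level_group A relset R"
abbreviation q :: "nat \<Rightarrow> 'a word \<Rightarrow> 'a word set" where "q \<equiv> level_elem A relset R"

lemma R_words: "i \<ge> 1 \<Longrightarrow> w \<in> R i \<Longrightarrow> w \<in> words A"
  using graded unfolding graded_relators_def by blast

lemma R_inv: "i \<ge> 1 \<Longrightarrow> w \<in> R i \<Longrightarrow> inv_word w \<in> R i"
  using graded unfolding graded_relators_def symmetrized_def by blast

lemma R_rotate: "i \<ge> 1 \<Longrightarrow> w \<in> R i \<Longrightarrow> rotate n w \<in> R i"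
  using graded unfolding graded_relators_def symmetrized_def by blast

lemma R_relset: "i \<ge> 1 \<Longrightarrow> w \<in> R i \<Longrightarrow> w \<notin> relset"
  using graded unfolding graded_relators_def by blast

lemma R_disjoint: "i \<ge> 1 \<Longrightarrow> j \<ge> 1 \<Longrightarrow> w \<in> R i \<Longrightarrow> w \<in> R j \<Longrightarrow> i = j"
  using graded unfolding graded_relators_def by blast

lemma Nil_relset: "[] \<in> relset"
  by (simp add: relset_iff)

lemma R_not_Nil: "i \<ge> 1 \<Longrightarrow> w \<in> R i \<Longrightarrow> w \<noteq> []"
  using R_relset Nil_relset by blast

lemma LK_normal: "LK k \<lhd> F"
  unfolding level_kernel_def
proof (rule group.normal_normal_closure[OF group_free_group])
  have "relset \<union> (\<Union>i\<in>{1..k}. R i) \<subseteq> words A" using R_words by (auto simp: relset_iff)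
  then show "red ` (relset \<union> (\<Union>i\<in>{1..k}. R i)) \<subseteq> carrier F" using red_in_free_group by blast
qed

lemma LG_group: "group (LG k)"
  unfolding level_group_def by (rule normal.factorgroup_is_group[OF LK_normal])

lemma q_hom: "group_hom F (LG k) (\<lambda>a. LK k #>\<^bsub>F\<^esub> a)"
  unfolding group_hom_def group_hom_axioms_def level_group_def
  using group_free_group normal.factorgroup_is_group[OF LK_normal] normal.r_coset_hom_Mod[OF LK_normal] by blast

lemma q_closed: "w \<in> words A \<Longrightarrow> q k w \<in> carrier (LG k)"
  unfolding level_elem_def by (rule group_hom.hom_closed[OF q_hom]) (rule red_in_free_group)

lemma q_append:
  assumes "u \<in> words A" "v \<in> words A"
  shows "q k (u @ v) = q k u \<otimes>\<^bsub>LG k\<^esub> q k v"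
proof -
  have "red (u @ v) = red u \<otimes>\<^bsub>F\<^esub> red v" by (rule red_mult[symmetric])
  then show ?thesis unfolding level_elem_def
    using group_hom.hom_mult[OF q_hom red_in_free_group[OF assms(1)] red_in_free_group[OF assms(2)]] by simp
qed

lemma q_inv:
  assumes "w \<in> words A" shows "q k (inv_word w) = inv\<^bsub>LG k\<^esub> (q k w)"
  unfolding level_elem_def red_inv[OF assms, symmetric]
    by (rule group_hom.hom_inv[OF q_hom red_in_free_group[OF assms]])

lemma q_one:
  assumes "w \<in> words A" shows "q k w = \<one>\<^bsub>LG k\<^esub> \<longleftrightarrow> red w \<in> LK k"
proof -
  interpret N: normal "LK k" F by (rule LK_normal)
  have o: "\<one>\<^bsub>LG k\<^esub> = LK k" by (simp add: level_group_def FactGroup_def)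
  have r: "red w \<in> carrier F" by (rule red_in_free_group[OF assms])
  show ?thesis unfolding o level_elem_def
  proof
    assume e: "LK k #>\<^bsub>F\<^esub> red w = LK k"
    have "red w \<in> LK k #>\<^bsub>F\<^esub> red w"
        by (rule group.rcos_self[OF group_free_group r N.subgroup_axioms])
    then show "red w \<in> LK k" unfolding e .
  next
    assume "red w \<in> LK k"
    then show "LK k #>\<^bsub>F\<^esub> red w = LK k"
        by (rule group.coset_join2[OF group_free_group r N.subgroup_axioms])
  qed
qed

abbreviation cj :: "nat \<Rightarrow> 'a word \<Rightarrow> 'a word \<Rightarrow> bool"
  where "cj k \<equiv> conjugate_words A relset R k"

lemma cj_refl: "u \<in> words A \<Longrightarrow> cj k u u"
  unfolding conjugate_words_def by (rule group.conjugate_in_refl[OF LG_group q_closed])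

lemma cj_sym: "cj k u v \<Longrightarrow> u \<in> words A \<Longrightarrow> cj k v u"
  unfolding conjugate_words_def by (rule group.conjugate_in_sym[OF LG_group _ q_closed])

lemma cj_trans: "cj k u v \<Longrightarrow> cj k v w \<Longrightarrow> u \<in> words A \<Longrightarrow> cj k u w"
  unfolding conjugate_words_def by (rule group.conjugate_in_trans[OF LG_group _ _ q_closed])

lemma cjI:
  assumes "g \<in> words A" "u \<in> words A" "v \<in> words A" "q k v = q k (g @ u @ inv_word g)"
  shows "cj k u v"
  unfolding conjugate_words_def conjugate_in_def
  using q_closed[OF assms(1)] assms
    by (intro bexI[of _ "q k g"]) (simp_all add: q_append q_inv group.is_monoid[OF LG_group] monoid.m_assoc q_closed group.inv_closed[OF LG_group])

lemma LG_surj: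
  assumes "x \<in> carrier (LG k)"
  shows "\<exists>g\<in>words A. x = q k g"
proof -
  obtain a where "a \<in> carrier F" "x = LK k #>\<^bsub>F\<^esub> a"
    using assms by (auto simp: level_group_def FactGroup_def RCOSETS_def)
  then have "a \<in> words A" "x = q k a" by (simp_all add: level_elem_def red_freely_reduced)
  then show ?thesis by blast
qed

lemma cjD:
  assumes "cj k u v" "u \<in> words A" "v \<in> words A"
  shows "\<exists>g\<in>words A. red (v @ inv_word (g @ u @ inv_word g)) \<in> LK k"
proof -
  interpret Q: group "LG k" by (rule LG_group)
  obtain x where x: "x \<in> carrier (LG k)" "q k v = x \<otimes>\<^bsub>LG k\<^esub> q k u \<otimes>\<^bsub>LG k\<^esub> inv\<^bsub>LG k\<^esub> x"
    using assms(1) unfolding conjugate_words_def conjugate_in_def by blast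
  obtain g where g: "g \<in> words A" "x = q k g" using LG_surj[OF x(1)] by blast
  have "q k v = q k (g @ u @ inv_word g)" using x(2) g assms
      by (simp add: q_append q_inv Q.m_assoc q_closed)
  moreover have w: "g @ u @ inv_word g \<in> words A" using g assms by simp
  ultimately have "q k (v @ inv_word (g @ u @ inv_word g)) = \<one>\<^bsub>LG k\<^esub>"
    using assms(3) q_closed[OF w, of k]
      by (simp only: q_append q_inv[OF w] inv_word_in_words) (rule Q.r_inv)
  then show ?thesis using g q_one w assms(3) by (metis inv_word_in_words words_append)
qed

lemma cj_inv: "cj k u v \<Longrightarrow> u \<in> words A \<Longrightarrow> v \<in> words A \<Longrightarrow> cj k (inv_word u) (inv_word v)"
proof -
  assume a: "cj k u v" "u \<in> words A" "v \<in> words A"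
  interpret Q: group "LG k" by (rule LG_group)
  obtain x where x: "x \<in> carrier (LG k)" "q k v = x \<otimes>\<^bsub>LG k\<^esub> q k u \<otimes>\<^bsub>LG k\<^esub> inv\<^bsub>LG k\<^esub> x"
    using a(1) unfolding conjugate_words_def conjugate_in_def by blast
  have "q k (inv_word v) = x \<otimes>\<^bsub>LG k\<^esub> q k (inv_word u) \<otimes>\<^bsub>LG k\<^esub> inv\<^bsub>LG k\<^esub> x"
    using x a q_closed[OF a(2), of k] by (simp add: q_inv Q.inv_mult_group Q.m_assoc)
  then show ?thesis using x(1) unfolding conjugate_words_def conjugate_in_def by blast
qed

text \<open>Moving the first letter to the end is conjugation by its inverse, at every
  level.\<close>

lemma cj_rotate:
  assumes "w \<in> words A" shows "cj k w (rotate n w)"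
proof (induction n)
  case 0 then show ?case using cj_refl assms by simp
next
  case (Suc n)
  show ?case
  proof (cases "rotate n w")
    case Nil then show ?thesis using Suc by simp
  next
    case (Cons x v)
    have "set (rotate n w) = set w" by simp
    then have "rotate n w \<in> words A" using assms unfolding words_def in_lists_conv_set by blast
    then have xv: "[x] \<in> words A" "v \<in> words A" unfolding Cons by simp_all
    interpret Q: group "LG k" by (rule LG_group)
    have "cj k ([x] @ v) (v @ [x])"
    proof (rule cjI[of "inv_word [x]"])
      have "q k (inv_word [x] @ ([x] @ v) @ inv_word (inv_word [x])) =
         inv\<^bsub>LG k\<^esub> q k [x] \<otimes>\<^bsub>LG k\<^esub> (q k [x] \<otimes>\<^bsub>LG k\<^esub> q k v \<otimes>\<^bsub>LG k\<^esub> q k [x])"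
        using xv q_inv[OF xv(1)]
          by (simp only: q_append words_append inv_word_in_words inv_word_inv_word simp_thms)
      also have "\<dots> = q k (v @ [x])"
        using q_closed[OF xv(1), of k] q_closed[OF xv(2), of k] xv
          by (simp add: q_append Q.m_assoc[symmetric])
      finally show "q k (v @ [x]) = q k (inv_word [x] @ ([x] @ v) @ inv_word (inv_word [x]))" ..
    qed (use xv in simp_all)
    then have "cj k (rotate n w) (rotate (Suc n) w)" using Cons by simp
    then show ?thesis using cj_trans Suc assms by blast
  qed
qed

section \<open>Conjugacy classes of relators\<close>

definition classrel :: "nat \<Rightarrow> ('a word \<times> 'a word) set"
  where "classrel i = {(u, v) \<in> R i \<times> R i. cj (i - 1) u v}"

lemma equiv_classrel:
  assumes "i \<ge> 1" shows "equiv (R i) (classrel i)"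
proof (rule equivI)
  show "classrel i \<subseteq> R i \<times> R i" unfolding classrel_def by blast
  show "refl_on (R i) (classrel i)"
    unfolding refl_on_def classrel_def using cj_refl[OF R_words[OF assms]] by simp
  show "sym (classrel i)"
  proof (rule symI)
    fix u v assume "(u, v) \<in> classrel i"
    then show "(v, u) \<in> classrel i" unfolding classrel_def
        using cj_sym[of "i - 1" u v] R_words[OF assms, of u] by simp
  qed
  show "trans (classrel i)"
  proof (rule transI)
    fix u v w assume "(u, v) \<in> classrel i" "(v, w) \<in> classrel i"
    then show "(u, w) \<in> classrel i" unfolding classrel_def
        using cj_trans[of "i - 1" u v w] R_words[OF assms, of u] by simp
  qed
qed

lemma reduced_obtain:
  assumes "i \<ge> 1"
  obtains P rep where "R i // classrel i = P \<union> (\<lambda>C. inv_word ` C) ` P"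
    "P \<inter> (\<lambda>C. inv_word ` C) ` P = {}" "\<forall>C\<in>P. rep C \<in> C" "Rp i = rep ` P"
proof -
  from reduced[OF assms, unfolded reduced_relators_def conjugacy_classes_def, folded classrel_def]
  show thesis
  proof (elim exE conjE)
    fix P rep assume *: "R i // classrel i = P \<union> (\<lambda>C. inv_word ` C) ` P"
      "P \<inter> (\<lambda>C. inv_word ` C) ` P = {}" "\<forall>C\<in>P. rep C \<in> C" "Rp i = rep ` P"
    show thesis by (rule that[OF *])
  qed
qed

lemma Rp_class:
  assumes "i \<ge> 1" "r \<in> Rp i" shows "r \<in> R i"
proof -
  obtain P rep where P: "R i // classrel i = P \<union> (\<lambda>C. inv_word ` C) ` P"
      "P \<inter> (\<lambda>C. inv_word ` C) ` P = {}"
      "\<forall>C\<in>P. rep C \<in> C" "Rp i = rep ` P"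
    by (rule reduced_obtain[OF assms(1)])
  obtain C where C: "C \<in> P" "r = rep C" using assms(2) P(4) by blast
  then have "C \<in> R i // classrel i" "r \<in> C" using P(1,3) by blast+
  then show ?thesis using in_quotient_imp_subset[OF equiv_classrel[OF assms(1)]] by blast
qed

lemma Rp_words: "i \<ge> 1 \<Longrightarrow> r \<in> Rp i \<Longrightarrow> r \<in> words A"
  using Rp_class R_words by blast

text \<open>Conjugate words lie in the same class, each positive class has one representative, and
  no class is both positive and negative. The case \<open>r1 = r2\<close> of the second claim says
  that no representative is conjugate to its inverse.\<close>

lemma Rp_conj_unique:
  assumes "i \<ge> 1" "r1 \<in> Rp i" "r2 \<in> Rp i"
  shows "cj (i - 1) r1 r2 \<Longrightarrow> r1 = r2" and "\<not> cj (i - 1) r1 (inv_word r2)"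
proof -
  obtain P rep where P: "R i // classrel i = P \<union> (\<lambda>C. inv_word ` C) ` P"
    "P \<inter> (\<lambda>C. inv_word ` C) ` P = {}" "\<forall>C\<in>P. rep C \<in> C" "Rp i = rep ` P"
    by (rule reduced_obtain[OF assms(1)])
  obtain C1 where C1: "C1 \<in> P" "r1 = rep C1" using assms(2) P(4) by blast
  obtain C2 where C2: "C2 \<in> P" "r2 = rep C2" using assms(3) P(4) by blast
  note eq = equiv_classrel[OF assms(1)]
  have q: "C1 \<in> R i // classrel i" "C2 \<in> R i // classrel i" "inv_word ` C2 \<in> R i // classrel i"
    "r1 \<in> C1" "r2 \<in> C2" "inv_word r2 \<in> inv_word ` C2" using P(1,3) C1 C2 by blast+
  have same: "C = D" if "C \<in> R i // classrel i" "D \<in> R i // classrel i" "x \<in> C" "y \<in> D"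
      "cj (i - 1) x y" for C D x y
  proof -
    have "x \<in> R i" "y \<in> R i" using in_quotient_imp_subset[OF eq] that by blast+
    then have "(x, y) \<in> classrel i" using that(5) unfolding classrel_def by blast
    then show ?thesis using quotient_eqI[OF eq that(1-4)] by blast
  qed
  show "r1 = r2" if "cj (i - 1) r1 r2" using same[OF q(1,2,4,5) that] C1 C2 by simp
  show "\<not> cj (i - 1) r1 (inv_word r2)"
  proof
    assume "cj (i - 1) r1 (inv_word r2)"
    from same[OF q(1,3,4,6) this] have "C1 = inv_word ` C2" .
    then have "C1 \<in> P \<inter> (\<lambda>C. inv_word ` C) ` P" using C1(1) C2(1) by blast
    then show False using P(2) by blast
  qed
qed

lemma R_conj_Rp:
  assumes "i \<ge> 1" "w \<in> R i"
  shows "\<exists>r\<in>Rp i. cj (i - 1) r w \<or> cj (i - 1) (inv_word r) w"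
proof -
  obtain P rep where P: "R i // classrel i = P \<union> (\<lambda>C. inv_word ` C) ` P"
    "P \<inter> (\<lambda>C. inv_word ` C) ` P = {}" "\<forall>C\<in>P. rep C \<in> C" "Rp i = rep ` P"
    by (rule reduced_obtain[OF assms(1)])
  note eq = equiv_classrel[OF assms(1)]
  let ?C = "classrel i `` {w}"
  have C: "?C \<in> R i // classrel i" using assms(2) by (rule quotientI)
  then consider "?C \<in> P" | D where "D \<in> P" "?C = inv_word ` D" using P(1) by blast
  then show ?thesis
  proof cases
    case 1
    then have "(w, rep ?C) \<in> classrel i" using P(3) by blast
    then have "cj (i - 1) (rep ?C) w" using cj_sym R_words[OF assms] unfolding classrel_def by blast
    then show ?thesis using 1 P(4) by blast
  next
    case 2
    then have "inv_word (rep D) \<in> ?C" using P(3) by blast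
    then have "cj (i - 1) (inv_word (rep D)) w" using cj_sym R_words[OF assms]
        unfolding classrel_def by blast
    then show ?thesis using 2 P(4) by blast
  qed
qed

section \<open>Products of conjugates\<close>

text \<open>The set \<open>I\<close> bounds the ranks: it is \<open>{1..k}\<close> for the kernel of
  the k-th level and \<open>{1..}\<close> for the full normal closure. The products are taken in G,
  which absorbs all relators of rank 0.\<close>

definition conj_lists :: "nat set \<Rightarrow> ('a word \<times> 'a word) list set"
  where "conj_lists I = {L. \<forall>(S, Q)\<in>set L. S \<in> words A \<and> (\<exists>i\<in>I. Q \<in> Rp i \<union> inv_word ` Rp i)}"

definition conj_prods :: "nat set \<Rightarrow> 'g set"
  where "conj_prods I = (\<lambda>L. ev (lollipops L)) ` conj_lists I"

lemma conj_listsD: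
  "L \<in> conj_lists I \<Longrightarrow> (S, Q) \<in> set L \<Longrightarrow> S \<in> words A \<and> (\<exists>i\<in>I. Q \<in> Rp i \<union> inv_word ` Rp i)"
  unfolding conj_lists_def by blast

lemma conj_listsI:
  assumes "\<And>S Q. (S, Q) \<in> set L \<Longrightarrow> S \<in> words A \<and> (\<exists>i\<in>I. Q \<in> Rp i \<union> inv_word ` Rp i)"
  shows "L \<in> conj_lists I"
  using assms unfolding conj_lists_def by blast

lemma conj_lists_words:
  assumes "L \<in> conj_lists I" "I \<subseteq> {1..}" "(S, Q) \<in> set L"
  shows "S \<in> words A \<and> Q \<in> words A \<and> Q \<noteq> []"
proof -
  obtain i where i: "S \<in> words A" "i \<in> I" "Q \<in> Rp i \<union> inv_word ` Rp i" using assms(1,3)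
      unfolding conj_lists_def by blast
  then have "i \<ge> 1" using assms(2) by auto
  then have "Q \<in> R i" using i(3) Rp_class R_inv by blast
  then show ?thesis using i(1) R_words R_not_Nil \<open>i \<ge> 1\<close> by blast
qed

lemma lollipops_Cons: "lollipops ((S, Q) # L) = (S @ inv_word Q @ inv_word S) @ lollipops L"
  by (simp add: lollipops_def)

lemma lollipops_append: "lollipops (L1 @ L2) = lollipops L1 @ lollipops L2"
  by (simp add: lollipops_def)

lemma lollipops_words:
  assumes "\<And>S Q. (S, Q) \<in> set L \<Longrightarrow> S \<in> words A \<and> Q \<in> words A"
  shows "lollipops L \<in> words A"
  using assms
proof (induction L)
  case Nil then show ?case by (simp add: lollipops_def)
next
  case (Cons SQ L)
  obtain S Q where SQ: "SQ = (S, Q)" by (cases SQ)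
  show ?case using Cons.prems[of S Q] Cons.IH Cons.prems unfolding SQ lollipops_Cons by auto
qed

lemma conj_lists_lollipops_words: "L \<in> conj_lists I \<Longrightarrow> I \<subseteq> {1..} \<Longrightarrow> lollipops L \<in> words A"
  using lollipops_words conj_lists_words by blast

lemma conj_prods_one: "\<one> \<in> conj_prods I"
proof -
  have "[] \<in> conj_lists I" by (simp add: conj_lists_def)
  moreover have "\<one> = ev (lollipops [])" by (simp add: lollipops_def)
  ultimately show ?thesis unfolding conj_prods_def by blast
qed

lemma conj_prods_mult:
  assumes "x \<in> conj_prods I" "y \<in> conj_prods I" "I \<subseteq> {1..}" shows "x \<otimes> y \<in> conj_prods I"
proof -
  obtain L1 L2 where L: "L1 \<in> conj_lists I" "L2 \<in> conj_lists I" "x = ev (lollipops L1)"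
      "y = ev (lollipops L2)"
    using assms unfolding conj_prods_def by blast
  have "L1 @ L2 \<in> conj_lists I"
      by (rule conj_listsI) (use L(1,2) conj_listsD in \<open>unfold set_append, blast\<close>)
  moreover have "x \<otimes> y = ev (lollipops (L1 @ L2))"
    unfolding L lollipops_append
      by (rule ev_append[symmetric]; rule conj_lists_lollipops_words[OF _ assms(3)]) (rule L)+
  ultimately show ?thesis unfolding conj_prods_def by blast
qed

definition inv_list :: "('a word \<times> 'a word) list \<Rightarrow> ('a word \<times> 'a word) list"
  where "inv_list L = rev (map (\<lambda>(S, Q). (S, inv_word Q)) L)"

lemma lollipops_inv_list: "lollipops (inv_list L) = inv_word (lollipops L)"
proof (induction L)
  case Nil then show ?case by (simp add: lollipops_def inv_list_def)
next
  case (Cons SQ L)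
  obtain S Q where SQ: "SQ = (S, Q)" by (cases SQ)
  have "inv_list (SQ # L) = inv_list L @ [(S, inv_word Q)]" by (simp add: inv_list_def SQ)
  then show ?case using Cons
      by (simp add: SQ lollipops_append lollipops_Cons inv_word_append) (simp add: lollipops_def)
qed

lemma inv_list_conj_lists:
  assumes "L \<in> conj_lists I" shows "inv_list L \<in> conj_lists I"
proof (rule conj_listsI)
  fix S Q assume "(S, Q) \<in> set (inv_list L)"
  then obtain Q' where Q': "(S, Q') \<in> set L" "Q = inv_word Q'" by (auto simp: inv_list_def)
  obtain i where i: "S \<in> words A" "i \<in> I" "Q' \<in> Rp i \<union> inv_word ` Rp i"
      using conj_listsD[OF assms Q'(1)] by blast
  then have "Q \<in> Rp i \<union> inv_word ` Rp i" unfolding Q'(2) by auto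
  then show "S \<in> words A \<and> (\<exists>i\<in>I. Q \<in> Rp i \<union> inv_word ` Rp i)" using i by blast
qed

lemma conj_prods_inv:
  assumes "x \<in> conj_prods I" "I \<subseteq> {1..}" shows "inv x \<in> conj_prods I"
proof -
  obtain L where L: "L \<in> conj_lists I" "x = ev (lollipops L)" using assms unfolding conj_prods_def
      by blast
  have "inv x = ev (lollipops (inv_list L))"
    unfolding lollipops_inv_list L(2)
      using ev_inv_word[OF conj_lists_lollipops_words[OF L(1) assms(2)]] by simp
  then show ?thesis using inv_list_conj_lists[OF L(1)] unfolding conj_prods_def by blast
qed

definition conj_list :: "'a word \<Rightarrow> ('a word \<times> 'a word) list \<Rightarrow> ('a word \<times> 'a word) list"
  where "conj_list g L = map (\<lambda>(S, Q). (g @ S, Q)) L"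

lemma conj_list_conj_lists:
  assumes "L \<in> conj_lists I" "g \<in> words A" shows "conj_list g L \<in> conj_lists I"
proof (rule conj_listsI)
  fix S Q assume "(S, Q) \<in> set (conj_list g L)"
  then obtain S' where S': "(S', Q) \<in> set L" "S = g @ S'" by (auto simp: conj_list_def)
  then show "S \<in> words A \<and> (\<exists>i\<in>I. Q \<in> Rp i \<union> inv_word ` Rp i)"
      using conj_listsD[OF assms(1) S'(1)] assms(2) by simp
qed

lemma ev_conj_list:
  assumes "g \<in> words A" "\<And>S Q. (S, Q) \<in> set L \<Longrightarrow> S \<in> words A \<and> Q \<in> words A"
  shows "ev (lollipops (conj_list g L)) = ev g \<otimes> ev (lollipops L) \<otimes> inv (ev g)"
  using assms(2)
proof (induction L)
  case Nil then show ?case using assms(1) by (simp add: lollipops_def conj_list_def)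
next
  case (Cons SQ L)
  obtain S Q where SQ: "SQ = (S, Q)" by (cases SQ)
  have L: "S' \<in> words A \<and> Q' \<in> words A" if "(S', Q') \<in> set L" for S' Q'
    by (rule Cons.prems) (use that in simp)
  have "S' \<in> words A \<and> Q' \<in> words A" if sq: "(S', Q') \<in> set (conj_list g L)" for S' Q'
  proof -
    obtain S'' where "(S'', Q') \<in> set L" "S' = g @ S''" using sq by (auto simp: conj_list_def)
    then show ?thesis using L[of S'' Q'] assms(1) by simp
  qed
  then have w: "S \<in> words A" "Q \<in> words A" "lollipops L \<in> words A"
      "lollipops (conj_list g L) \<in> words A"
    using Cons.prems[of S Q] SQ lollipops_words[OF L] lollipops_words[of "conj_list g L"] by auto
  have "conj_list g (SQ # L) = (g @ S, Q) # conj_list g L" by (simp add: conj_list_def SQ)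
  then have "ev (lollipops (conj_list g (SQ # L))) = (ev g \<otimes> ev S \<otimes> inv (ev Q) \<otimes> inv (ev S) \<otimes> inv (ev g)) \<otimes> (ev g \<otimes> ev (lollipops L) \<otimes> inv (ev g))"
    using w assms(1) Cons.IH[OF L]
      by (simp add: lollipops_Cons ev_append ev_inv_word inv_mult_group m_assoc)
  also have "\<dots> = ev g \<otimes> (ev S \<otimes> inv (ev Q) \<otimes> inv (ev S) \<otimes> ev (lollipops L)) \<otimes> inv (ev g)"
    using w assms(1) by (simp add: m_assoc) (simp add: m_assoc[symmetric])
  finally show ?case using w by (simp add: SQ lollipops_Cons ev_append ev_inv_word m_assoc)
qed

lemma conj_prods_conj:
  assumes "x \<in> conj_prods I" "g \<in> words A" "I \<subseteq> {1..}" shows "ev g \<otimes> x \<otimes> inv (ev g) \<in> conj_prods I"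
proof -
  obtain L where L: "L \<in> conj_lists I" "x = ev (lollipops L)" using assms unfolding conj_prods_def
      by blast
  have "ev g \<otimes> x \<otimes> inv (ev g) = ev (lollipops (conj_list g L))"
    unfolding L(2) using ev_conj_list[OF assms(2)] conj_lists_words[OF L(1) assms(3)] by metis
  then show ?thesis using conj_list_conj_lists[OF L(1) assms(2)] unfolding conj_prods_def by blast
qed

lemma conj_prods_mono: "I \<subseteq> J \<Longrightarrow> conj_prods I \<subseteq> conj_prods J"
  unfolding conj_prods_def conj_lists_def by fast

lemma Rp_conj_prods:
  assumes "i \<in> I" "I \<subseteq> {1..}" "Q \<in> Rp i \<union> inv_word ` Rp i"
  shows "ev Q \<in> conj_prods I"
proof -
  have L: "[([], Q)] \<in> conj_lists I" using assms by (auto simp: conj_lists_def)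
  then have "ev (lollipops [([], Q)]) \<in> conj_prods I" by (auto simp: conj_prods_def)
  moreover have "Q \<in> words A" using conj_lists_words[OF L assms(2)] by simp
  ultimately have "inv (ev Q) \<in> conj_prods I" by (simp add: lollipops_def ev_inv_word)
  then have "inv (inv (ev Q)) \<in> conj_prods I" by (rule conj_prods_inv[OF _ assms(2)])
  then show ?thesis using \<open>Q \<in> words A\<close> by simp
qed

text \<open>Lets the normal closures of relators be treated by their generators alone.\<close>

lemma conj_prods_normal:
  assumes "I \<subseteq> {1..}"
  shows "{w \<in> carrier F. ev w \<in> conj_prods I} \<lhd> F"
proof -
  interpret F: group F by (rule group_free_group)
  interpret h: group_hom F G ev by (rule ev_group_hom)
  show ?thesis
  proof (rule F.normal_invI)
    show "subgroup {w \<in> carrier F. ev w \<in> conj_prods I} F"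
    proof (rule F.subgroupI)
      have "\<one>\<^bsub>F\<^esub> \<in> {w \<in> carrier F. ev w \<in> conj_prods I}"
          using conj_prods_one h.hom_one F.one_closed by (simp del: free_group_simps)
      then show "{w \<in> carrier F. ev w \<in> conj_prods I} \<noteq> {}" by blast
    next
      fix a assume a: "a \<in> {w \<in> carrier F. ev w \<in> conj_prods I}"
      then have "ev (inv\<^bsub>F\<^esub> a) = inv (ev a)" using h.hom_inv by blast
      then show "inv\<^bsub>F\<^esub> a \<in> {w \<in> carrier F. ev w \<in> conj_prods I}"
        using a conj_prods_inv[OF _ assms] F.inv_closed by (simp del: free_group_simps)
      fix b assume b: "b \<in> {w \<in> carrier F. ev w \<in> conj_prods I}"
      have "ev (a \<otimes>\<^bsub>F\<^esub> b) = ev a \<otimes> ev b" using a b h.hom_mult by blast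
      then show "a \<otimes>\<^bsub>F\<^esub> b \<in> {w \<in> carrier F. ev w \<in> conj_prods I}"
        using a b conj_prods_mult[OF _ _ assms] F.m_closed by (simp del: free_group_simps)
    qed blast
  next
    fix x h assume x: "x \<in> carrier F" and h: "h \<in> {w \<in> carrier F. ev w \<in> conj_prods I}"
    have hc: "h \<in> carrier F" using h by blast
    have "ev (x \<otimes>\<^bsub>F\<^esub> h \<otimes>\<^bsub>F\<^esub> inv\<^bsub>F\<^esub> x) = ev x \<otimes> ev h \<otimes> inv (ev x)"
      using h.hom_mult[OF F.m_closed[OF x hc] F.inv_closed[OF x]] h.hom_mult[OF x hc] h.hom_inv[OF x] by simp
    moreover have "x \<in> words A" using x by simp
    ultimately have "ev (x \<otimes>\<^bsub>F\<^esub> h \<otimes>\<^bsub>F\<^esub> inv\<^bsub>F\<^esub> x) \<in> conj_prods I"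
        using conj_prods_conj[OF _ _ assms] h by simp
    then show "x \<otimes>\<^bsub>F\<^esub> h \<otimes>\<^bsub>F\<^esub> inv\<^bsub>F\<^esub> x \<in> {w \<in> carrier F. ev w \<in> conj_prods I}"
      using F.m_closed F.inv_closed x hc by blast
  qed
qed

text \<open>In the group of level \<open>i - 1\<close> the relator is conjugate to a representative
  or its inverse. So \<open>w\<close> is a conjugate of such a word up to a factor from the kernel
  of that level, and this factor is a product of the required form by assumption.\<close>

lemma R_conj_prods:
  assumes "i \<in> I" "I \<subseteq> {1..}" "w \<in> R i" and LK: "\<And>v. v \<in> LK (i - 1) \<Longrightarrow> ev v \<in> conj_prods I"
  shows "ev w \<in> conj_prods I"
proof -
  have i: "i \<ge> 1" using assms by auto
  have w: "w \<in> words A" using R_words i assms by blast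
  obtain Q where Q: "Q \<in> Rp i \<union> inv_word ` Rp i" "cj (i - 1) Q w" using R_conj_Rp[OF i assms(3)]
      by blast
  have Qw: "Q \<in> words A" using Q(1) Rp_words[OF i] by auto
  obtain g where g: "g \<in> words A" "red (w @ inv_word (g @ Q @ inv_word g)) \<in> LK (i - 1)"
      using cjD[OF Q(2) Qw w] by blast
  define u where "u = g @ Q @ inv_word g"
  have u: "u \<in> words A" using g Qw by (simp add: u_def)
  have "ev (red (w @ inv_word u)) \<in> conj_prods I" using LK g(2) unfolding u_def .
  then have 1: "ev w \<otimes> inv (ev u) \<in> conj_prods I" using u w
      by (simp add: ev_red ev_append ev_inv_word)
  have "ev u = ev g \<otimes> ev Q \<otimes> inv (ev g)" using g Qw
      by (simp add: u_def ev_append ev_inv_word m_assoc)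
  also have "\<dots> \<in> conj_prods I"
    by (rule conj_prods_conj[OF Rp_conj_prods[OF assms(1,2) Q(1)] g(1) assms(2)])
  finally have "ev w \<otimes> inv (ev u) \<otimes> ev u \<in> conj_prods I" using conj_prods_mult[OF 1 _ assms(2)]
    by blast
  moreover have "ev w \<otimes> inv (ev u) \<otimes> ev u = ev w" using ev_closed[OF w] ev_closed[OF u]
      by (simp add: m_assoc)
  ultimately show ?thesis by simp
qed

text \<open>Passing to representatives does not change the level groups. The induction is strong
  because a relator of rank \<open>i\<close> refers to the kernel of level \<open>i - 1\<close>, for
  every \<open>i\<close> up to \<open>k\<close>.\<close>

lemma LK_conj_prods: "v \<in> LK k \<Longrightarrow> ev v \<in> conj_prods {1..k}"
proof (induction k arbitrary: v rule: less_induct)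
  case (less k)
  have I: "{1..k} \<subseteq> {1..}" by auto
  have "LK k \<subseteq> {w \<in> carrier F. ev w \<in> conj_prods {1..k}}"
    unfolding level_kernel_def
  proof (rule normal_closure_subset[OF conj_prods_normal[OF I]], rule image_subsetI)
    fix w assume "w \<in> relset \<union> (\<Union>i\<in>{1..k}. R i)"
    then consider "w \<in> relset" | i where "i \<in> {1..k}" "w \<in> R i" by blast
    then have "w \<in> words A \<and> ev w \<in> conj_prods {1..k}"
    proof cases
      case 1 then show ?thesis using conj_prods_one unfolding relset_iff by simp
    next
      case 2
      have ik: "i - 1 < k" "{1..i - 1} \<subseteq> {1..k}" using 2(1) by auto
      have "ev v \<in> conj_prods {1..k}" if v: "v \<in> LK (i - 1)" for v
        using less.IH[OF ik(1) v] conj_prods_mono[OF ik(2)] by blast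
      then have "ev w \<in> conj_prods {1..k}" using R_conj_prods[OF 2(1) I 2(2)] by blast
      then show ?thesis using R_words[of i w] 2 by simp
    qed
    then show "red w \<in> {w \<in> carrier F. ev w \<in> conj_prods {1..k}}"
      using red_in_free_group[of w A] ev_red[of w] by (simp del: free_group_simps)
  qed
  then show ?case using less.prems by blast
qed

text \<open>Each relator needs only its own finite level, so the result for the levels suffices for
  all ranks at once.\<close>

lemma NR_conj_prods: "v \<in> normal_closure F (red ` (\<Union>i\<in>{1..}. R i)) \<Longrightarrow> ev v \<in> conj_prods {1..}"
proof -
  have "normal_closure F (red ` (\<Union>i\<in>{1..}. R i)) \<subseteq> {w \<in> carrier F. ev w \<in> conj_prods {1..}}"
  proof (rule normal_closure_subset[OF conj_prods_normal], simp, rule image_subsetI)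
    fix w assume "w \<in> (\<Union>i\<in>{1..}. R i)"
    then obtain i where i: "i \<in> {1..}" "w \<in> R i" by blast
    have "ev v \<in> conj_prods {1..}" if "v \<in> LK (i - 1)" for v
      using LK_conj_prods[OF that] conj_prods_mono[of "{1..i - 1}" "{1..}"] by auto
    then have "ev w \<in> conj_prods {1..}" using R_conj_prods[OF i(1) _ i(2)] by blast
    moreover have "w \<in> words A" using R_words[of i w] i by simp
    ultimately show "red w \<in> {w \<in> carrier F. ev w \<in> conj_prods {1..}}"
      using red_in_free_group[of w A] ev_red[of w] by (simp del: free_group_simps)
  qed
  then show "v \<in> normal_closure F (red ` (\<Union>i\<in>{1..}. R i)) \<Longrightarrow> ev v \<in> conj_prods {1..}" by blast
qed

end

context graded_presentation
begin

section \<open>Ranks and signs of face labels\<close>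

text \<open>A multiset with at most one element, so that \<open>face_sum\<close> collects the ranks
  of all faces of positive rank. The rank is unique because the sets \<open>R i\<close> are
  disjoint.\<close>

definition rank_mset :: "'a word \<Rightarrow> nat multiset"
  where "rank_mset w = (if \<exists>i\<ge>1. w \<in> cyclic_closure (Rp i)
    then {#THE i. i \<ge> 1 \<and> w \<in> cyclic_closure (Rp i)#} else {#})"

definition sign_of :: "'a word \<Rightarrow> 'a word \<Rightarrow> int"
  where "sign_of r w = (if \<exists>n. w = rotate n r then 1 else if \<exists>n. w = rotate n (inv_word r) then -1 else 0)"

lemma cyclic_closure_cases:
  assumes "w \<in> cyclic_closure (Rp i)"
  obtains r n where "r \<in> Rp i" "w = rotate n r" | r n where "r \<in> Rp i" "w = rotate n (inv_word r)"
  using assms unfolding cyclic_closure_def by blast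

lemma cyclic_closure_R:
  assumes "i \<ge> 1" "w \<in> cyclic_closure (Rp i)" shows "w \<in> R i"
  using assms(2) by (rule cyclic_closure_cases) (use Rp_class R_inv R_rotate assms(1) in simp_all)

lemma cyclic_closureI: "Q \<in> Rp i \<union> inv_word ` Rp i \<Longrightarrow> Q \<in> cyclic_closure (Rp i)"
  unfolding cyclic_closure_def by (intro CollectI exI[of _ 0] exI[of _ Q]) simp

lemma rank_mset_eq:
  assumes "i \<ge> 1" "w \<in> cyclic_closure (Rp i)" shows "rank_mset w = {#i#}"
proof -
  have "(THE i. i \<ge> 1 \<and> w \<in> cyclic_closure (Rp i)) = i"
  proof (rule the_equality)
    fix j assume "j \<ge> 1 \<and> w \<in> cyclic_closure (Rp j)"
    then show "j = i" using R_disjoint[of j i w] cyclic_closure_R assms by blast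
  qed (use assms in simp)
  then show ?thesis unfolding rank_mset_def using assms by auto
qed

lemma rank_mset_relset: "w \<in> relset \<Longrightarrow> rank_mset w = {#}"
  unfolding rank_mset_def using cyclic_closure_R R_relset by auto

lemma rank_mset_rotate: "rank_mset (rotate n w) = rank_mset w"
  unfolding rank_mset_def rotation_closed_iff[OF rotation_closed_cyclic_closure] ..

lemma ex_rotate_iff: "(\<exists>m. rotate n w = rotate m r) \<longleftrightarrow> (\<exists>m. w = rotate m r)"
proof -
  have "rotation_closed {rotate m r | m. True}" unfolding rotation_closed_def
      by (auto simp: rotate_rotate)
  from rotation_closed_iff[OF this, of n w] show ?thesis by simp
qed

lemma sign_of_rotate: "sign_of r (rotate n w) = sign_of r w"
  unfolding sign_of_def ex_rotate_iff ..

lemma sign_of_relset: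
  assumes "i \<ge> 1" "r \<in> Rp i" "w \<in> relset" shows "sign_of r w = 0"
proof -
  have "r \<in> R i" "inv_word r \<in> R i" using Rp_class R_inv assms by blast+
  then have "w \<noteq> rotate n r" "w \<noteq> rotate n (inv_word r)" for n using R_rotate R_relset assms(1,3)
      by blast+
  then show ?thesis by (simp add: sign_of_def)
qed

text \<open>A rotation is conjugate to the word itself, and equal words have equal ranks. So if
  \<open>s\<close> or its inverse were a rotation of \<open>r\<close> or its inverse, the uniqueness
  of representatives would give \<open>r = s\<close> and equal signs.\<close>

lemma sign_of_Rp:
  assumes "i \<ge> 1" "r \<in> Rp i" "j \<ge> 1" "s \<in> Rp j"
  shows "sign_of r s = (if r = s then 1 else 0)"
      "sign_of r (inv_word s) = (if r = s then -1 else 0)"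
proof -
  have R: "r \<in> R i" "inv_word r \<in> R i" "s \<in> R j" "inv_word s \<in> R j" using Rp_class R_inv assms
      by blast+
  have w: "r \<in> words A" "s \<in> words A" using R R_words assms by blast+
  have same: "i = j" if "x \<in> R j" "x = rotate n y" "y \<in> R i" for x y n
    using R_disjoint[OF assms(1,3)] R_rotate[OF assms(1) that(3)] that by blast
  note u = Rp_conj_unique[OF assms(1,2)]
  have 1: "r = s" if e: "s = rotate n r" for n
  proof -
    have "s \<in> Rp i" using same[OF R(3) e R(1)] assms by simp
    moreover have "cj (i - 1) r s" unfolding e by (rule cj_rotate[OF w(1)])
    ultimately show ?thesis using u(1) by blast
  qed
  have 2: "s \<noteq> rotate n (inv_word r)" for n
  proof
    assume e: "s = rotate n (inv_word r)"
    have s: "s \<in> Rp i" using same[OF R(3) e R(2)] assms by simp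
    have "cj (i - 1) (inv_word r) s" unfolding e by (rule cj_rotate) (use w in simp)
    then have "cj (i - 1) (inv_word (inv_word r)) (inv_word s)" by (rule cj_inv) (use w in simp_all)
    then show False using u(2)[OF s] by simp
  qed
  have 3: "inv_word s \<noteq> rotate n r" for n
  proof
    assume e: "inv_word s = rotate n r"
    have s: "s \<in> Rp i" using same[OF R(4) e R(1)] assms by simp
    have "cj (i - 1) r (inv_word s)" unfolding e by (rule cj_rotate[OF w(1)])
    then show False using u(2)[OF s] by simp
  qed
  have 4: "r = s" if e: "inv_word s = rotate n (inv_word r)" for n
  proof -
    have s: "s \<in> Rp i" using same[OF R(4) e R(2)] assms by simp
    have "cj (i - 1) (inv_word r) (inv_word s)" unfolding e by (rule cj_rotate) (use w in simp)
    then have "cj (i - 1) (inv_word (inv_word r)) (inv_word (inv_word s))"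
        by (rule cj_inv) (use w in simp_all)
    then show ?thesis using u(1)[OF s] by simp
  qed
  show "sign_of r s = (if r = s then 1 else 0)"
  proof (cases "r = s")
    case True
    then have "s = rotate 0 r" by simp
    then show ?thesis using True unfolding sign_of_def by metis
  next
    case False then show ?thesis using 1 2 unfolding sign_of_def by metis
  qed
  show "sign_of r (inv_word s) = (if r = s then -1 else 0)"
  proof (cases "r = s")
    case True
    then have "inv_word s = rotate 0 (inv_word r)" by simp
    then show ?thesis using True 3 unfolding sign_of_def by metis
  next
    case False then show ?thesis using 3 4 unfolding sign_of_def by metis
  qed
qed

section \<open>Invariance under elementary transformations\<close>

abbreviation diagram :: "'a diagram \<Rightarrow> bool"
  where "diagram \<equiv> diagram_over A relset Rp"

lemma diagram_facelist:
  "facelist M fs \<Longrightarrow> diagram M \<longleftrightarrow> labelled_map A M \<and>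
    (\<forall>c\<in>set fs. map (lab M) c \<in> relset \<or> (\<exists>i\<ge>1. map (lab M) c \<in> cyclic_closure (Rp i)))"
  by (rule diagram_over_iff[OF _ relset_rotation_closed])

lemma diagram_premap: "diagram M \<Longrightarrow> premap M"
  by (simp add: diagram_over_def labelled_map_iff)

text \<open>What the torus argument needs to know about an elementary transformation: the surface,
  the faces of positive rank as sets of darts, and both kinds of sums are kept.\<close>

definition similar :: "'a diagram \<Rightarrow> 'a diagram \<Rightarrow> bool"
  where "similar M M' \<longleftrightarrow> euler_char M = euler_char M' \<and>
    (\<forall>i\<ge>1. \<forall>f. rel_face Rp M i f \<longleftrightarrow> rel_face Rp M' i f) \<and>
    face_sum rank_mset M = face_sum rank_mset M' \<and>
    (\<forall>i\<ge>1. \<forall>r\<in>Rp i. face_sum (sign_of r) M = face_sum (sign_of r) M')"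

lemma similar_refl: "similar M M"
  by (simp add: similar_def)

lemma similar_sym: "similar M M' \<Longrightarrow> similar M' M"
  unfolding similar_def by (metis (no_types))

lemma similar_trans: "similar M M' \<Longrightarrow> similar M' M'' \<Longrightarrow> similar M M''"
  unfolding similar_def by (metis (no_types))

lemma rel_face_facelist:
  assumes "facelist M fs"
  shows "rel_face Rp M i f \<longleftrightarrow> (\<exists>c\<in>set fs. f = set c \<and> map (lab M) c \<in> cyclic_closure (Rp i))"
proof
  assume r: "rel_face Rp M i f"
  then obtain c where c: "c \<in> set fs" "f = set c" unfolding rel_face_def faces_eq[OF assms] by blast
  then show "\<exists>c\<in>set fs. f = set c \<and> map (lab M) c \<in> cyclic_closure (Rp i)"
      using rel_face_iff[OF assms c(1)] r by blast
next
  assume "\<exists>c\<in>set fs. f = set c \<and> map (lab M) c \<in> cyclic_closure (Rp i)"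
  then show "rel_face Rp M i f" using rel_face_iff[OF assms] by blast
qed

lemma face_sum_zero_faces:
  fixes g :: "'a word \<Rightarrow> 'c::comm_monoid_add"
  assumes f: "facelist M (zs @ fs)" "facelist M' (zs' @ fs)"
    and z: "\<And>c. c \<in> set zs \<Longrightarrow> map (lab M) c \<in> relset" "\<And>c. c \<in> set zs' \<Longrightarrow> map (lab M') c \<in> relset"
    and l: "\<And>c. c \<in> set fs \<Longrightarrow> map (lab M') c = map (lab M) c"
    and g: "\<And>w n. g (rotate n w) = g w" "\<And>w. w \<in> relset \<Longrightarrow> g w = 0"
  shows "face_sum g M = face_sum g M'"
proof -
  have "(\<Sum>c\<leftarrow>zs. g (map (lab M) c)) = 0" using z(1) g(2) by (induction zs) auto
  moreover have "(\<Sum>c\<leftarrow>zs'. g (map (lab M') c)) = 0" using z(2) g(2) by (induction zs') auto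
  moreover have "map (\<lambda>c. g (map (lab M') c)) fs = map (\<lambda>c. g (map (lab M) c)) fs"
      by (rule map_cong[OF refl]) (simp add: l del: map_eq_conv)
  ultimately show ?thesis unfolding face_sum_eq[OF f(1) g(1)] face_sum_eq[OF f(2) g(1)]
      by (simp del: map_eq_conv)
qed

text \<open>Isolates the combinatorics of a transformation: apart from the common faces
  \<open>fs\<close>, only 0-faces occur on either side, and these contribute nothing.\<close>

lemma similarI:
  assumes f: "facelist M (zs @ fs)" "facelist M' (zs' @ fs)"
    and z: "\<And>c. c \<in> set zs \<Longrightarrow> map (lab M) c \<in> relset" "\<And>c. c \<in> set zs' \<Longrightarrow> map (lab M') c \<in> relset"
    and l: "\<And>c. c \<in> set fs \<Longrightarrow> map (lab M') c = map (lab M) c"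
    and e: "euler_char M = euler_char M'"
  shows "similar M M'"
proof -
  have nr: "w \<notin> cyclic_closure (Rp i)" if "i \<ge> 1" "w \<in> relset" for i w
    using cyclic_closure_R[OF that(1)] R_relset[OF that(1)] that(2) by blast
  note gs = face_sum_zero_faces[OF f z l]
  have "rel_face Rp M i h \<longleftrightarrow> rel_face Rp M' i h" if i: "i \<ge> 1" for i h
  proof -
    have "(\<exists>c\<in>set (zs @ fs). h = set c \<and> map (lab M) c \<in> cyclic_closure (Rp i)) \<longleftrightarrow>
      (\<exists>c\<in>set fs. h = set c \<and> map (lab M) c \<in> cyclic_closure (Rp i))"
      using nr[OF i z(1)] unfolding set_append by blast
    also have "\<dots> \<longleftrightarrow> (\<exists>c\<in>set fs. h = set c \<and> map (lab M') c \<in> cyclic_closure (Rp i))" using l by metis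
    also have "\<dots> \<longleftrightarrow> (\<exists>c\<in>set (zs' @ fs). h = set c \<and> map (lab M') c \<in> cyclic_closure (Rp i))"
      using nr[OF i z(2)] unfolding set_append by blast
    finally show ?thesis unfolding rel_face_facelist[OF f(1)] rel_face_facelist[OF f(2)] .
  qed
  moreover have "face_sum rank_mset M = face_sum rank_mset M'"
    by (rule gs) (simp_all add: rank_mset_rotate rank_mset_relset)
  moreover have "face_sum (sign_of r) M = face_sum (sign_of r) M'" if "i \<ge> 1" "r \<in> Rp i" for i r
    by (rule gs) (use that sign_of_rotate sign_of_relset in auto)
  ultimately show ?thesis using e unfolding similar_def by blast
qed

lemma erase_similar:
  assumes "diagram M" "erasable relset d M" "diagram (erase_edge d M)"
  shows "similar M (erase_edge d M)"
proof -
  let ?M = "erase_edge d M"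
  have pm0: "premap M" "premap ?M" using diagram_premap assms by blast+
  have lm: "labelled_map A M" "labelled_map A ?M" using assms by (simp_all add: diagram_over_def)
  have con: "conn M" "darts ?M \<noteq> {}" using lm by (simp_all add: labelled_map_iff)
  have ne: "darts M - {d, opp M d} \<noteq> {}" using con(2) by (simp add: erase_edge_def Let_def)
  have d: "d \<in> darts M" and z: "zero_face relset M (face_of M d)"
      "zero_face relset M (face_of M (opp M d))"
    and alt: "face_of M d \<noteq> face_of M (opp M d) \<or> nxt M d = opp M d" using assms(2)
      by (auto simp: erasable_def)
  have od: "opp M d \<in> darts M" using premapD(7)[OF pm0(1)] d by simp
  have ld: "lab M (opp M d) = inv_letter (lab M d)" using lm(1) d by (simp add: labelled_map_iff)
  have e: "euler_char ?M = euler_char M" by (rule erase_euler[OF pm0(1) con(1) d ne pm0(2) alt])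
  note el = erase_lab[OF pm0(1) con(1) d ne]
  have fo: "face_of M x = set c" if "facelist M fs" "c \<in> set fs" "x \<in> set c" for x c fs
    unfolding face_of_def by (rule cycle_dec_orbit[OF that])
  show ?thesis
  proof (cases "nxt M d = opp M d")
    case True
    obtain us fs where f: "facelist M ((d # opp M d # us) # fs)" "facelist ?M (us # fs)"
      by (rule erase_hanging_facelist[OF pm0(1) con(1) d ne True])
    have D: "darts ?M = darts M - {d, opp M d}" by (simp add: erase_edge_def Let_def)
    have lo: "map (lab ?M) c = map (lab M) c" if "c \<in> set (us # fs)" for c
      using facelist_in_darts[OF f(2) that] el unfolding D by auto
    have "map (lab M) (d # opp M d # us) \<in> relset"
      using z(1) fo[OF f(1), of "d # opp M d # us" d] zero_face_iff[OF f(1) _ relset_rotation_closed, of "d # opp M d # us"] by simp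
    then have "lab M d # inv_letter (lab M d) # map (lab M) us \<in> relset" by (simp add: ld)
    then have "map (lab M) us \<in> relset" by (rule relset_cancel_pair)
    moreover have "map (lab ?M) us = map (lab M) us" by (rule lo) simp
    ultimately have us: "map (lab ?M) us \<in> relset" by (simp only:)
    show ?thesis
    proof (rule similarI[of _ "[d # opp M d # us]" fs _ "[us]"])
      show "facelist M ([d # opp M d # us] @ fs)" "facelist ?M ([us] @ fs)" using f by simp_all
      show "map (lab M) c \<in> relset" if "c \<in> set [d # opp M d # us]" for c
        using that \<open>map (lab M) (d # opp M d # us) \<in> relset\<close> by simp
      show "map (lab ?M) c \<in> relset" if "c \<in> set [us]" for c using that us by simp
      show "map (lab ?M) c = map (lab M) c" if "c \<in> set fs" for c by (rule lo) (use that in simp)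
    qed (use e in simp)
  next
    case False
    then have fd: "face_of M d \<noteq> face_of M (opp M d)" using alt by simp
    obtain us vs fs where f: "facelist M ((d # us) # (opp M d # vs) # fs)"
        "facelist ?M ((us @ vs) # fs)"
      by (rule erase_merge_facelist[OF pm0(1) con(1) d ne fd])
    have D: "darts ?M = darts M - {d, opp M d}" by (simp add: erase_edge_def Let_def)
    have lo: "map (lab ?M) c = map (lab M) c" if "c \<in> set ((us @ vs) # fs)" for c
      using facelist_in_darts[OF f(2) that] el unfolding D by auto
    have 1: "map (lab M) (d # us) \<in> relset"
      using z(1) fo[OF f(1), of "d # us" d] zero_face_iff[OF f(1) _ relset_rotation_closed, of "d # us"] by simp
    have 2: "map (lab M) (opp M d # vs) \<in> relset"
      using z(2) fo[OF f(1), of "opp M d # vs"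
        "opp M d"] zero_face_iff[OF f(1) _ relset_rotation_closed, of "opp M d # vs"] by simp
    have "lab M d # map (lab M) us \<in> relset" "inv_letter (lab M d) # map (lab M) vs \<in> relset"
        using 1 2 by (simp_all add: ld)
    then have "map (lab M) us @ map (lab M) vs \<in> relset" by (rule relset_cancel)
    then have "map (lab M) (us @ vs) \<in> relset" by simp
    moreover have "map (lab ?M) (us @ vs) = map (lab M) (us @ vs)" by (rule lo) simp
    ultimately have 3: "map (lab ?M) (us @ vs) \<in> relset" by (simp only:)
    show ?thesis
    proof (rule similarI[of _ "[d # us, opp M d # vs]" fs _ "[us @ vs]"])
      show "facelist M ([d # us, opp M d # vs] @ fs)" "facelist ?M ([us @ vs] @ fs)" using f
        by simp_all
      show "map (lab M) c \<in> relset" if "c \<in> set [d # us, opp M d # vs]" for c using that 1 2 by auto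
      show "map (lab ?M) c \<in> relset" if "c \<in> set [us @ vs]" for c using that 3 by auto
      show "map (lab ?M) c = map (lab M) c" if "c \<in> set fs" for c by (rule lo) (use that in simp)
    qed (use e in simp)
  qed
qed

text \<open>The pasted face is read as the label of the path followed by its inverse, hence is a
  0-face; all other faces keep their darts.\<close>

lemma cut_similar:
  assumes "diagram M" "diagram M'" "t \<noteq> []" "(\<exists>u v. simple_path M u t v) \<or> (\<exists>d\<in>darts M. t = [d])"
      "cut_along t a b M M'"
  shows "similar M M'"
proof -
  have pm0: "premap M" "premap M'" using diagram_premap assms by blast+
  have lm: "labelled_map A M" "labelled_map A M'" using assms by (simp_all add: diagram_over_def)
  note c = cut_along_cutting[OF assms(5,3)]
  have t: "set t \<subseteq> darts M" "cpath M t"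
  proof -
    have "set t \<subseteq> darts M \<and> cpath M t" using assms(4)
    proof
      assume "\<exists>u v. simple_path M u t v"
      then obtain u v where "is_path M u t v" "distinct (map (terminus M) t)"
          by (auto simp: simple_path_def)
      then show ?thesis using is_path_darts is_path_cpath by blast
    qed auto
    then show "set t \<subseteq> darts M" "cpath M t" by blast+
  qed
  have e: "euler_char M' = euler_char M" using cut_euler[OF pm0 assms(3) t(1) c(1) t(2)] by blast
  obtain fs where fs: "facelist M fs" using cycle_dec_exists[OF premapD(1,3)[OF pm0(1)]] by blast
  have f': "facelist M' ((b @ rev a) # fs)" using cutting_facelist[OF c(1) fs] unfolding c(2,3) .
  have L: "\<And>d. d \<in> darts M' \<Longrightarrow> lab M' (opp M' d) = inv_letter (lab M' d)" using lm(2)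
      by (simp add: labelled_map_iff)
  have L0: "\<And>d. d \<in> darts M \<Longrightarrow> lab M (opp M d) = inv_letter (lab M d)" using lm(1)
      by (simp add: labelled_map_iff)
  have lo: "\<And>x. x \<in> darts M \<Longrightarrow> lab M' x = lab M x" and D: "darts M \<subseteq> darts M'" using assms(5)
      unfolding cut_along_def by auto
  have la: "lab M' (opp M' x) = inv_letter (lab M x)" if "x \<in> set t" for x
  proof -
    have x: "x \<in> darts M" "x \<in> darts M'" using t(1) D that by blast+
    show ?thesis using L[OF x(2)] lo[OF x(1)] by simp
  qed
  have lb: "lab M' (opp M' (opp M x)) = lab M x" if "x \<in> set t" for x
  proof -
    have x: "x \<in> darts M" using t(1) that by blast
    then have ox: "opp M x \<in> darts M" using premapD(7)[OF pm0(1)] by blast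
    then have "opp M x \<in> darts M'" using D by blast
    then have "lab M' (opp M' (opp M x)) = inv_letter (lab M (opp M x))"
        using L[of "opp M x"] lo[OF ox] by simp
    then show ?thesis using L0[OF x] by simp
  qed
  have "map (lab M') b = map (lab M) t" using lb by (simp add: c(3))
  moreover have "map (lab M') (rev a) = inv_word (map (lab M) t)" using la
      by (simp add: c(2) inv_word_def rev_map)
  moreover have "map (lab M) t \<in> words A"
  proof -
    have "lab M x \<in> A \<times> UNIV" if "x \<in> set t" for x using lm(1) t(1) that
        by (auto simp: labelled_map_iff)
    then show ?thesis unfolding words_def in_lists_conv_set by auto
  qed
  ultimately have new: "map (lab M') (b @ rev a) \<in> relset" using relset_inv_word by simp
  show ?thesis
  proof (rule similarI[of M "[]" fs M' "[b @ rev a]"])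
    show "facelist M ([] @ fs)" "facelist M' ([b @ rev a] @ fs)" using fs f' by simp_all
    show "map (lab M') c = map (lab M) c" if "c \<in> set fs" for c
      using facelist_in_darts[OF fs that] lo by auto
    show "map (lab M') c \<in> relset" if "c \<in> set [b @ rev a]" for c using that new by auto
  qed (use e in auto)
qed

lemma elementary_similar:
  assumes "elementary A relset Rp M M'" shows "similar M M'" "diagram M'"
  using assms
proof (induction rule: elementary.induct)
  case (erase M d) case 1 show ?case using erase_similar erase by blast
next
  case (erase M d) case 2 show ?case using erase by blast
next
  case (subdivide M d) case 1 show ?case using erase_similar similar_sym subdivide by blast
next
  case (subdivide M d) case 2 show ?case using subdivide by blast
next
  case (cut M M' t a b) case 1 show ?case using cut_similar cut by blast
next
  case (cut M M' t a b) case 2 show ?case using cut by blast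
qed

lemma elementary_rtranclp_similar:
  assumes "(elementary A relset Rp)\<^sup>*\<^sup>* M M'" "diagram M"
  shows "similar M M' \<and> diagram M'"
  using assms
proof (induction rule: rtranclp_induct)
  case base then show ?case using similar_refl by blast
next
  case (step y z) then show ?case using elementary_similar similar_trans by blast
qed

end

section \<open>Tori with prescribed faces\<close>

lemma labels_in_words: "labelled_map A M \<Longrightarrow> set c \<subseteq> darts M \<Longrightarrow> map (lab M) c \<in> words A"
  unfolding labelled_map_iff words_def in_lists_conv_set using PiE_mem by fastforce

lemma face_label_hd:
  assumes "facelist M ((d # us) # fs)"
  shows "face_label M d = map (lab M) (d # us)"
proof -
  define c where "c = d # us"
  note f = assms[folded c_def]
  have cyc: "cycle (nxt M) c" using cycle_decD(3)[OF f] by simp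
  have dist: "distinct c" using cycle_decD(1)[OF f] by simp
  have hd: "hd c = d" by (simp add: c_def)
  have "face_of M d = set c" unfolding face_of_def by (rule facelist_orbit[OF f]) (simp add: c_def)
  then have len: "card (face_of M d) = length c" using distinct_card[OF dist] by simp
  have "face_label M d = map (lab M) c"
    unfolding face_label_def len by (rule nth_equalityI) (use cycle_funpow[OF cyc] hd in auto)
  then show ?thesis by (simp add: c_def)
qed

context graded_presentation
begin

text \<open>The substitute for pasting in a disk diagram. The face \<open>f\<close> may have any
  label; the lollipops multiply it by a word that makes its value trivial, so that it becomes a
  0-face, and each pair of \<open>L\<close> leaves one relator face behind.\<close>

lemma lollipop_torus:
  assumes "chi_map A 0 M" "facelist M (f # fs)" "L \<in> conj_lists I" "I \<subseteq> {1..}"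
    and fs: "\<And>c. c \<in> set fs \<Longrightarrow> map (lab M) c \<in> relset \<or> (\<exists>i\<ge>1. map (lab M) c \<in> cyclic_closure (Rp i))"
    and e: "ev (map (lab M) f @ lollipops L) = \<one>"
  shows "\<exists>M'. diagram M' \<and> on_torus M' \<and>
    face_sum rank_mset M' = (\<Sum>SQ\<leftarrow>L. rank_mset (snd SQ)) + (\<Sum>c\<leftarrow>fs. rank_mset (map (lab M) c)) \<and>
    (\<forall>i\<ge>1. \<forall>r\<in>Rp i. face_sum (sign_of r) M' = (\<Sum>SQ\<leftarrow>L. sign_of r (snd SQ)) + (\<Sum>c\<leftarrow>fs. sign_of r (map (lab M) c)))"
proof -
  have fw: "map (lab M) f \<in> words A"
    using labels_in_words facelist_head[OF assms(2)] assms(1) unfolding chi_map_def by blast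
  have "(S, Q) \<in> set L \<Longrightarrow> S \<in> words A \<and> Q \<in> words A \<and> Q \<noteq> []" for S Q
    by (rule conj_lists_words[OF assms(3,4)])
  from attach_lollipops[OF assms(1,2) this] obtain M' f' ds where M': "chi_map A 0 M'"
      "facelist M' (f' # ds @ fs)"
    "map (lab M') f' = map (lab M) f @ lollipops L"
      "mset (map (map (lab M')) ds) = mset (map snd L)"
    "\<forall>d\<in>set fs. map (lab M') d = map (lab M) d" by blast
  have f': "map (lab M') f' \<in> relset"
    unfolding M'(3) relset_iff using e fw conj_lists_lollipops_words[OF assms(3,4)] by simp
  have ds: "\<exists>i\<ge>1. map (lab M') c \<in> cyclic_closure (Rp i)" if c: "c \<in> set ds" for c
  proof -
    have "map (lab M') c \<in> set (map snd L)" using c mset_eq_setD[OF M'(4)]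
        by (metis image_eqI list.set_map)
    then obtain S Q where SQ: "(S, Q) \<in> set L" "map (lab M') c = Q" by auto
    obtain i where "i \<in> I" "Q \<in> Rp i \<union> inv_word ` Rp i" using conj_listsD[OF assms(3) SQ(1)]
        by blast
    then show ?thesis using cyclic_closureI assms(4) SQ(2) by (metis atLeast_iff subsetD)
  qed
  have "map (lab M') c \<in> relset \<or> (\<exists>i\<ge>1. map (lab M') c \<in> cyclic_closure (Rp i))"
      if c: "c \<in> set (f' # ds @ fs)" for c
  proof -
    consider "c = f'" | "c \<in> set ds" | "c \<in> set fs" using c by auto
    then show ?thesis
    proof cases
      case 3 then show ?thesis using fs[OF 3] M'(5) by (simp del: map_eq_conv)
    qed (use f' ds in blast)+
  qed
  then have "diagram M'" unfolding diagram_facelist[OF M'(2)] using M'(1) unfolding chi_map_def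
      by blast
  have fsum: "(\<Sum>c\<leftarrow>fs. g (map (lab M') c)) = (\<Sum>c\<leftarrow>fs. g (map (lab M) c))"
      for g :: "'a word \<Rightarrow> nat multiset"
    by (rule arg_cong[of _ _ sum_list], rule map_cong[OF refl]) (use M'(5) in \<open>simp del: map_eq_conv\<close>)
  have fsum': "(\<Sum>c\<leftarrow>fs. g (map (lab M') c)) = (\<Sum>c\<leftarrow>fs. g (map (lab M) c))" for g :: "'a word \<Rightarrow> int"
    by (rule arg_cong[of _ _ sum_list], rule map_cong[OF refl]) (use M'(5) in \<open>simp del: map_eq_conv\<close>)
  have dsum: "(\<Sum>c\<leftarrow>ds. g (map (lab M') c)) = (\<Sum>SQ\<leftarrow>L. g (snd SQ))" for g :: "'a word \<Rightarrow> nat multiset"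
  proof -
    have "mset (map g (map (map (lab M')) ds)) = mset (map g (map snd L))" using M'(4)
        by (metis mset_map)
    then show ?thesis unfolding map_map comp_def by (metis sum_mset_sum_list)
  qed
  have dsum': "(\<Sum>c\<leftarrow>ds. g (map (lab M') c)) = (\<Sum>SQ\<leftarrow>L. g (snd SQ))" for g :: "'a word \<Rightarrow> int"
  proof -
    have "mset (map g (map (map (lab M')) ds)) = mset (map g (map snd L))" using M'(4)
        by (metis mset_map)
    then show ?thesis unfolding map_map comp_def by (metis sum_mset_sum_list)
  qed
  have "face_sum rank_mset M' = (\<Sum>SQ\<leftarrow>L. rank_mset (snd SQ)) + (\<Sum>c\<leftarrow>fs. rank_mset (map (lab M) c))"
    unfolding face_sum_eq[OF M'(2) rank_mset_rotate] using f'
      by (simp add: rank_mset_relset dsum fsum)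
  moreover have "face_sum (sign_of r) M' = (\<Sum>SQ\<leftarrow>L. sign_of r (snd SQ)) + (\<Sum>c\<leftarrow>fs. sign_of r (map (lab M) c))"
    if "i \<ge> 1" "r \<in> Rp i" for i r
    unfolding face_sum_eq[OF M'(2) sign_of_rotate] using f'
      by (simp add: sign_of_relset[OF that] dsum' fsum')
  moreover have "on_torus M'" using M'(1) by (simp add: chi_map_def on_torus_def)
  ultimately show ?thesis using \<open>diagram M'\<close> by blast
qed

lemma commutator_lollipop_torus:
  assumes "X \<in> words A" "X \<noteq> []" "Y \<in> words A" "Y \<noteq> []" "L \<in> conj_lists I" "I \<subseteq> {1..}"
    and "ev ((X @ Y @ inv_word X @ inv_word Y) @ lollipops L) = \<one>"
  shows "\<exists>M'. diagram M' \<and> on_torus M' \<and> face_sum rank_mset M' = (\<Sum>SQ\<leftarrow>L. rank_mset (snd SQ)) \<and>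
    (\<forall>i\<ge>1. \<forall>r\<in>Rp i. face_sum (sign_of r) M' = (\<Sum>SQ\<leftarrow>L. sign_of r (snd SQ)))"
proof -
  obtain M f where M: "chi_map A 0 M" "facelist M [f]"
      "map (lab M) f = X @ Y @ inv_word X @ inv_word Y"
    using commutator_torus[OF assms(1-4)] by blast
  show ?thesis using lollipop_torus[OF M(1,2) assms(5,6)] M(3) assms(7) by simp
qed

lemma rank_conj_list:
  assumes "L \<in> conj_lists {1..k}" "x \<in># (\<Sum>SQ\<leftarrow>L. rank_mset (snd SQ))" shows "x \<le> k"
  using assms
proof (induction L)
  case (Cons SQ L)
  obtain S Q where SQ: "SQ = (S, Q)" by (cases SQ)
  obtain i where i: "i \<in> {1..k}" "Q \<in> Rp i \<union> inv_word ` Rp i"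
      using conj_listsD[OF Cons.prems(1), of S Q] SQ by auto
  then have "rank_mset Q = {#i#}" using rank_mset_eq[OF _ cyclic_closureI] by simp
  moreover have "L \<in> conj_lists {1..k}" using Cons.prems(1) by (simp add: conj_lists_def)
  ultimately show ?case using Cons.IH Cons.prems(2) i(1) by (auto simp: SQ)
qed simp

end

section \<open>Signed sums over a torus vanish\<close>

locale atorical_presentation = graded_presentation G \<gamma> A R Rp
  for G (structure) and \<gamma> :: "'a \<Rightarrow> 'g" and A :: "'a set" and R Rp :: "nat \<Rightarrow> 'a word set" +
  assumes ator: "atorical A relset R Rp"
begin

text \<open>The equation makes \<open>W1\<close> conjugate to the inverse of \<open>W2\<close> at
  level \<open>i - 1\<close>. Both are rotations of representatives or their inverses, so uniqueness
  leaves only the same representative with opposite signs; equal signs would make a representative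
  conjugate to the inverse of a representative.\<close>

lemma opposite_labels:
  assumes i: "i \<ge> 1" and W: "W1 \<in> cyclic_closure (Rp i)" "W2 \<in> cyclic_closure (Rp i)"
      and w: "w \<in> words A"
    and one: "q (i - 1) (inv_word w @ W1 @ w @ W2) = \<one>\<^bsub>LG (i - 1)\<^esub>"
  obtains Y n m where "Y \<in> Rp i \<union> inv_word ` Rp i" "W1 = rotate n Y" "W2 = rotate m (inv_word Y)"
proof -
  interpret Q: group "LG (i - 1)" by (rule LG_group)
  have Ww: "W1 \<in> words A" "W2 \<in> words A" using W cyclic_closure_R R_words i by blast+
  have "q (i - 1) ((inv_word w @ W1 @ inv_word (inv_word w)) @ W2) = \<one>\<^bsub>LG (i - 1)\<^esub>" using one
      by simp
  then have "q (i - 1) (inv_word w @ W1 @ inv_word (inv_word w)) \<otimes>\<^bsub>LG (i - 1)\<^esub> q (i - 1) W2 = \<one>\<^bsub>LG (i - 1)\<^esub>"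
    using w Ww by (subst (asm) q_append) simp_all
  then have "inv\<^bsub>LG (i - 1)\<^esub> (q (i - 1) W2) = q (i - 1) (inv_word w @ W1 @ inv_word (inv_word w))"
    by (rule Q.inv_equality) (use w Ww in \<open>intro q_closed; simp\<close>)+
  then have "q (i - 1) (inv_word W2) = q (i - 1) (inv_word w @ W1 @ inv_word (inv_word w))"
      using q_inv[OF Ww(2)] by simp
  then have c: "cj (i - 1) W1 (inv_word W2)" using w Ww by (intro cjI[of "inv_word w"]) simp_all
  note u = Rp_conj_unique[OF i]
  have tr: "cj (i - 1) y1 y2" if "cj (i - 1) y1 W1" "cj (i - 1) (inv_word W2) y2" "y1 \<in> words A"
      for y1 y2
    using cj_trans[OF cj_trans[OF that(1) c that(3)] that(2,3)] .
  have inv2: "cj (i - 1) (inv_word W2) (inv_word y)" if "W2 = rotate m y" "y \<in> words A" for y m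
    using cj_inv[OF cj_sym[OF cj_rotate[OF that(2)] that(2)]] that Ww(2) by simp
  show thesis
    using W(1)
  proof (cases rule: cyclic_closure_cases)
    case (1 r1 n)
    have r1: "r1 \<in> words A" using Rp_words i 1 by blast
    have c1: "cj (i - 1) r1 W1" unfolding 1(2) by (rule cj_rotate[OF r1])
    show ?thesis using W(2)
    proof (cases rule: cyclic_closure_cases)
      case (1 r2 m)
      have "r2 \<in> words A" using Rp_words i 1 by blast
      then have "cj (i - 1) r1 (inv_word r2)" using tr[OF c1 inv2[OF 1(2)] r1] by blast
      then show ?thesis using u(2)[OF \<open>r1 \<in> Rp i\<close> 1(1)] by blast
    next
      case (2 r2 m)
      have "inv_word r2 \<in> words A" using Rp_words i 2 by simp
      then have "cj (i - 1) r1 r2" using tr[OF c1 inv2[OF 2(2)] r1] by simp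
      then have "r1 = r2" using u(1)[OF \<open>r1 \<in> Rp i\<close> 2(1)] by blast
      then show ?thesis using that[of r1 n m] 1 2 by blast
    qed
  next
    case (2 r1 n)
    have r1: "r1 \<in> words A" "inv_word r1 \<in> words A" using Rp_words i 2 by simp_all
    have c1: "cj (i - 1) (inv_word r1) W1" unfolding 2(2) by (rule cj_rotate[OF r1(2)])
    show ?thesis using W(2)
    proof (cases rule: cyclic_closure_cases)
      case (1 r2 m)
      have r2: "r2 \<in> words A" using Rp_words i 1 by blast
      then have "cj (i - 1) (inv_word r1) (inv_word r2)" using tr[OF c1 inv2[OF 1(2)] r1(2)]
          by blast
      then have "cj (i - 1) (inv_word (inv_word r1)) (inv_word (inv_word r2))"
          by (rule cj_inv) (use r1 r2 in simp_all)
      then have "r1 = r2" using u(1)[OF \<open>r1 \<in> Rp i\<close> 1(1)] by simp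
      then show ?thesis using that[of "inv_word r1" n m] 1 2 by simp
    next
      case (2 r2 m)
      have r2: "r2 \<in> words A" "inv_word r2 \<in> words A" using Rp_words i 2 by simp_all
      then have "cj (i - 1) (inv_word r1) r2" using tr[OF c1 inv2[OF 2(2)] r1(2)] by simp
      then have "cj (i - 1) r2 (inv_word r1)" using cj_sym r1 by blast
      then show ?thesis using u(2)[OF 2(1) \<open>r1 \<in> Rp i\<close>] by blast
    qed
  qed
qed

text \<open>Two tori with a smaller multiset of ranks come up: the first arises by joining the opposite faces
  and filling the resulting face with relators of lower rank; the second, with the boundary label of
  that face as a commutator, shows that these fillings do not contribute to the sum.\<close>

lemma torus_sum_step:
  assumes IH: "\<And>M'. diagram M' \<Longrightarrow> on_torus M' \<Longrightarrow> (face_sum rank_mset M', face_sum rank_mset M) \<in> mult {(x, y). x < y} \<Longrightarrow>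
      face_sum (sign_of r) M' = 0"
    and j: "j \<ge> 1" "r \<in> Rp j"
    and M: "diagram M" "on_torus M" and opp: "i > 0" "opposite_faces A relset R Rp i M f1 f2"
  shows "face_sum (sign_of r) M = 0"
proof -
  have i: "i \<ge> 1" using opp(1) by simp
  obtain M' d1 d2 s where f: "f1 \<noteq> f2" "rel_face Rp M i f1" "rel_face Rp M i f2"
    and el: "(elementary A relset Rp)\<^sup>*\<^sup>* M M'" and d: "d1 \<in> f1" "d2 \<in> f2"
    and sp: "simple_path M' (origin M' d1) s (origin M' d2)"
    and lev: "q (i - 1) (inv_word (map (lab M') s) @ face_label M' d1 @ map (lab M') s @ face_label M' d2) = \<one>\<^bsub>LG (i - 1)\<^esub>"
    using opp(2) unfolding opposite_faces_def by blast
  have sim: "similar M M'" and dM': "diagram M'" using elementary_rtranclp_similar[OF el M(1)]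
      by blast+
  have lM': "labelled_map A M'" using dM' by (simp add: diagram_over_def)
  have pm0: "premap M'" using diagram_premap[OF dM'] .
  note pm = premapD[OF pm0]
  \<comment> \<open>The path between the faces exists only after elementary transformations, so the
    surgery is done on \<open>M'\<close>, which is still a torus with the same sums.\<close>
  have g0: "chi_map A 0 M'" using lM' sim M(2) by (simp add: chi_map_def similar_def on_torus_def)
  have f': "rel_face Rp M' i f1" "rel_face Rp M' i f2" using sim f i unfolding similar_def by blast+
  obtain fs0 where fs0: "facelist M' fs0" using cycle_dec_exists[OF pm(1,3)] by blast
  obtain c1 c2 where c: "c1 \<in> set fs0" "f1 = set c1" "c2 \<in> set fs0" "f2 = set c2"
    using f' unfolding rel_face_facelist[OF fs0] by blast
  have orb: "orbit (nxt M') d1 = f1" "orbit (nxt M') d2 = f2"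
    using cycle_dec_orbit[OF fs0] c d by simp_all
  have dd: "d1 \<in> darts M'" "d2 \<in> darts M'" using facelist_in_darts[OF fs0] c d by blast+
  obtain us vs fs where 1: "facelist M' ((us @ [d1]) # (vs @ [d2]) # fs)"
    by (rule cycle_dec_head2[OF fs0 dd]) (use orb f(1) in simp)
  have "facelist M' (([d1] @ us) # (vs @ [d2]) # fs)" by (rule cycle_dec_append_commute[OF 1])
  then have "facelist M' ((vs @ [d2]) # ([d1] @ us) # fs)" by (rule cycle_dec_mset) simp
  then have 2: "facelist M' ((d2 # vs) # (d1 # us) # fs)"
      using cycle_dec_append_commute[of _ _ vs "[d2]"] by simp
  then have 3: "facelist M' ((d1 # us) # (d2 # vs) # fs)" by (rule cycle_dec_mset) simp
  define W1 where "W1 = map (lab M') (d1 # us)"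
  define W2 where "W2 = map (lab M') (d2 # vs)"
  define w where "w = map (lab M') s"
  have l1: "face_label M' d1 = W1" unfolding W1_def by (rule face_label_hd[OF 3])
  have l2: "face_label M' d2 = W2" unfolding W2_def by (rule face_label_hd[OF 2])
  have s1: "set (d1 # us) = f1" using facelist_orbit[OF 3, of d1] orb by simp
  have s2: "set (d2 # vs) = f2" using facelist_orbit[OF 2, of d2] orb by simp
  have W: "W1 \<in> cyclic_closure (Rp i)" "W2 \<in> cyclic_closure (Rp i)"
    using f'(1)[folded s1] rel_face_iff[OF 3, of "d1 # us" Rp i] f'(2)[folded s2] rel_face_iff[OF 2, of "d2 # vs" Rp i]
    unfolding W1_def W2_def by simp_all
  have Ww: "W1 \<in> words A" "W2 \<in> words A" using W cyclic_closure_R R_words i by blast+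
  have path: "is_path M' (origin M' d1) s (origin M' d2)"
      "distinct (origin M' d1 # map (terminus M') s)"
    using sp by (simp_all add: simple_path_def)
  have spath: "spath M' d1 s d2" by (rule is_path_spath[OF path(1) pm0 dd(1) path(2)])
  have ww: "w \<in> words A" unfolding w_def by (rule labels_in_words[OF lM' is_path_darts[OF path(1)]])
  have one: "q (i - 1) (inv_word w @ W1 @ w @ W2) = \<one>\<^bsub>LG (i - 1)\<^esub>" using lev unfolding l1 l2 w_def .
  obtain Y n m where Y: "Y \<in> Rp i \<union> inv_word ` Rp i" "W1 = rotate n Y" "W2 = rotate m (inv_word Y)"
    by (rule opposite_labels[OF i W ww one])
  have "Y \<in> R i" by (rule cyclic_closure_R[OF i cyclic_closureI[OF Y(1)]])
  then have Yw: "Y \<in> words A" "Y \<noteq> []" using R_words[OF i] R_not_Nil[OF i] by blast+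
  have I: "{1..i - 1} \<subseteq> {1..}" by auto
  \<comment> \<open>The label of the joined face. It is the conjugate by \<open>w\<close> of the
    word in \<open>one\<close>, hence also trivial at level \<open>i - 1\<close>.\<close>
  define U where "U = W1 @ w @ W2 @ inv_word w"
  have Uw: "U \<in> words A" using Ww ww by (simp add: U_def)
  have "red (inv_word w @ W1 @ w @ W2) \<in> LK (i - 1)" using one q_one ww Ww by simp
  then have "ev (red (inv_word w @ W1 @ w @ W2)) \<in> conj_prods {1..i - 1}" by (rule LK_conj_prods)
  then have "ev w \<otimes> ev (inv_word w @ W1 @ w @ W2) \<otimes> inv (ev w) \<in> conj_prods {1..i - 1}"
    using conj_prods_conj[OF _ ww I] ev_red ww Ww by simp
  moreover have "ev w \<otimes> ev (inv_word w @ W1 @ w @ W2) \<otimes> inv (ev w) = ev U"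
    using ww Ww by (simp add: U_def ev_append ev_inv_word m_assoc) (simp add: m_assoc[symmetric])
  \<comment> \<open>The inverse is taken because the lollipops have to cancel the label
    \<open>U\<close>.\<close>
  ultimately have "inv (ev U) \<in> conj_prods {1..i - 1}" using conj_prods_inv[OF _ I] by simp
  then obtain L where L: "L \<in> conj_lists {1..i - 1}" "inv (ev U) = ev (lollipops L)"
      unfolding conj_prods_def by blast
  have Lw: "lollipops L \<in> words A" by (rule conj_lists_lollipops_words[OF L(1) I])
  have evUL: "ev U \<otimes> ev (lollipops L) = \<one>" using Uw by (simp flip: L(2))
  obtain M1 f where M1: "chi_map A 0 M1" "facelist M1 (f # fs)"
    "map (lab M1) f = U" "\<forall>d\<in>set fs. map (lab M1) d = map (lab M') d"
    using join_faces[OF g0 3 spath] unfolding U_def W1_def W2_def w_def by blast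
  have fs_ok: "map (lab M1) c \<in> relset \<or> (\<exists>i\<ge>1. map (lab M1) c \<in> cyclic_closure (Rp i))"
      if c: "c \<in> set fs" for c
  proof -
    have "map (lab M1) c = map (lab M') c" using M1(4) c by blast
    then show ?thesis using dM' c unfolding diagram_facelist[OF 3] by (simp del: map_eq_conv)
  qed
  have "ev (map (lab M1) f @ lollipops L) = \<one>" unfolding M1(3) using evUL Uw Lw
      by (simp add: ev_append)
  from lollipop_torus[OF M1(1,2) L(1) I fs_ok this] obtain M2 where M2: "diagram M2" "on_torus M2"
    "face_sum rank_mset M2 = (\<Sum>SQ\<leftarrow>L. rank_mset (snd SQ)) + (\<Sum>c\<leftarrow>fs. rank_mset (map (lab M1) c))"
    "face_sum (sign_of r) M2 = (\<Sum>SQ\<leftarrow>L. sign_of r (snd SQ)) + (\<Sum>c\<leftarrow>fs. sign_of r (map (lab M1) c))"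
    using j by blast
  have fsum: "(\<Sum>c\<leftarrow>fs. rank_mset (map (lab M1) c)) = (\<Sum>c\<leftarrow>fs. rank_mset (map (lab M') c))"
    "(\<Sum>c\<leftarrow>fs. sign_of r (map (lab M1) c)) = (\<Sum>c\<leftarrow>fs. sign_of r (map (lab M') c))"
    by (rule arg_cong[of _ _ sum_list], rule map_cong[OF refl], use M1(4) in \<open>simp del: map_eq_conv\<close>)+
  have rM: "face_sum rank_mset M = (\<Sum>c\<leftarrow>fs. rank_mset (map (lab M1) c)) + {#i, i#}"
  proof -
    have "face_sum rank_mset M = face_sum rank_mset M'" using sim by (simp add: similar_def)
    also have "\<dots> = rank_mset W1 + (rank_mset W2 + (\<Sum>c\<leftarrow>fs. rank_mset (map (lab M') c)))"
      unfolding face_sum_eq[OF 3 rank_mset_rotate] by (simp add: W1_def W2_def)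
    finally show ?thesis using rank_mset_eq[OF i W(1)] rank_mset_eq[OF i W(2)] fsum(1) by simp
  qed
  \<comment> \<open>Two faces of rank \<open>i\<close> are replaced by faces of rank at most
    \<open>i - 1\<close>; this is one step down in the multiset order.\<close>
  have small: "\<forall>x\<in>set_mset (\<Sum>SQ\<leftarrow>L. rank_mset (snd SQ)). \<exists>y\<in>set_mset {#i, i#}. (x, y) \<in> {(x, y). x < y}"
    using rank_conj_list[OF L(1)] i by fastforce
  have "(face_sum rank_mset M2, face_sum rank_mset M) \<in> mult {(x, y). x < y}"
    unfolding M2(3) rM add.commute[of "\<Sum>SQ\<leftarrow>L. rank_mset (snd SQ)"]
    by (rule one_step_implies_mult[OF _ small]) simp
  then have sum1: "(\<Sum>SQ\<leftarrow>L. sign_of r (snd SQ)) + (\<Sum>c\<leftarrow>fs. sign_of r (map (lab M1) c)) = 0"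
    using IH[OF M2(1,2)] M2(4) by simp
  \<comment> \<open>The shifts are made explicit: \<open>W1\<close> is the conjugate of
    \<open>Y\<close> by the inverse of \<open>p\<close>, and \<open>W2\<close> that of the inverse
    of \<open>Y\<close> by the inverse of \<open>t\<close>, where conjugating a word by g means g
    word g^-1.\<close>
  obtain p p1 where p: "Y = p @ p1" "W1 = p1 @ p"
    using Y(2) that append_take_drop_id unfolding rotate_drop_take by metis
  obtain t t1 where t: "inv_word Y = t @ t1" "W2 = t1 @ t"
    using Y(3) append_take_drop_id unfolding rotate_drop_take by metis
  have pw: "p \<in> words A" "p1 \<in> words A" using Yw p by simp_all
  have "inv_word Y \<in> words A" using Yw by simp
  then have tw: "t \<in> words A" "t1 \<in> words A" unfolding t by simp_all
  \<comment> \<open>With this word, the conjugate p U p^-1 has in G the value of the commutator Y X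
    Y^-1 X^-1.\<close>
  define X where "X = p @ w @ inv_word t"
  \<comment> \<open>Both words of a commutator torus must be nonempty. If \<open>X\<close> is empty,
    \<open>Y\<close> takes its place: either commutator has trivial value.\<close>
  define X' where "X' = (if X = [] then Y else X)"
  have X': "X' \<in> words A" "X' \<noteq> []" using Yw pw ww tw by (auto simp: X'_def X_def)
  have Xw: "X \<in> words A" using pw ww tw by (simp add: X_def)
  \<comment> \<open>The filling is conjugated by \<open>p\<close> along with \<open>U\<close>. This
    changes only the stems of the lollipops, so ranks and signs stay the same.\<close>
  define L' where "L' = conj_list p L"
  have L': "L' \<in> conj_lists {1..i - 1}" unfolding L'_def
      by (rule conj_list_conj_lists[OF L(1) pw(1)])
  have L'w: "lollipops L' \<in> words A" by (rule conj_lists_lollipops_words[OF L' I])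
  have evC: "ev (Y @ X' @ inv_word Y @ inv_word X') = ev (Y @ X @ inv_word Y @ inv_word X)"
    using Yw by (auto simp: X'_def ev_append ev_inv_word m_assoc[symmetric])
  also have "\<dots> = ev ((p @ p1) @ (p @ w @ inv_word t) @ (t @ t1) @ (t @ inv_word w @ inv_word p))"
    unfolding t(1) X_def p(1)[symmetric] by (simp add: inv_word_append)
  also have "\<dots> = ev p \<otimes> ev U \<otimes> inv (ev p)"
    using pw tw ww unfolding U_def p(2) t(2)
      by (simp add: ev_append ev_inv_word m_assoc) (simp add: m_assoc[symmetric])
  finally have evC: "ev (Y @ X' @ inv_word Y @ inv_word X') = ev p \<otimes> ev U \<otimes> inv (ev p)" .
  have "ev (lollipops L') = ev p \<otimes> ev (lollipops L) \<otimes> inv (ev p)"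
    unfolding L'_def using ev_conj_list[OF pw(1)] conj_lists_words[OF L(1) I] by blast
  then have "ev ((Y @ X' @ inv_word Y @ inv_word X') @ lollipops L') = (ev p \<otimes> ev U \<otimes> inv (ev p)) \<otimes> (ev p \<otimes> ev (lollipops L) \<otimes> inv (ev p))"
    using evC L'w Yw X' by (subst ev_append) simp_all
  also have "\<dots> = ev p \<otimes> (ev U \<otimes> ev (lollipops L)) \<otimes> inv (ev p)"
    using pw Uw Lw by (simp add: m_assoc) (simp add: m_assoc[symmetric])
  also have "\<dots> = \<one>" unfolding evUL using pw by simp
  finally have ev1: "ev ((Y @ X' @ inv_word Y @ inv_word X') @ lollipops L') = \<one>" .
  obtain M3 where M3: "diagram M3" "on_torus M3"
      "face_sum rank_mset M3 = (\<Sum>SQ\<leftarrow>L'. rank_mset (snd SQ))"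
    "face_sum (sign_of r) M3 = (\<Sum>SQ\<leftarrow>L'. sign_of r (snd SQ))"
    using commutator_lollipop_torus[OF Yw X' L' I ev1] j by blast
  have snds': "(\<Sum>SQ\<leftarrow>L'. sign_of r (snd SQ)) = (\<Sum>SQ\<leftarrow>L. sign_of r (snd SQ))"
    "(\<Sum>SQ\<leftarrow>L'. rank_mset (snd SQ)) = (\<Sum>SQ\<leftarrow>L. rank_mset (snd SQ))"
    unfolding L'_def conj_list_def by (simp_all add: case_prod_beta comp_def)
  \<comment> \<open>The second torus consists of the filling alone, so it is smaller for two
    reasons: the faces in \<open>fs\<close> are dropped, and rank \<open>i\<close> is replaced by
    lower ranks.\<close>
  have "(face_sum rank_mset M3, face_sum rank_mset M) \<in> mult {(x, y). x < y}"
    using one_step_implies_mult[of "{#i, i#} + (\<Sum>c\<leftarrow>fs. rank_mset (map (lab M1) c))"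
      "\<Sum>SQ\<leftarrow>L. rank_mset (snd SQ)" "{(x, y). x < y}" "{#}"] small
    unfolding M3(3) rM snds' by (auto simp: add.commute)
  then have sum2: "(\<Sum>SQ\<leftarrow>L. sign_of r (snd SQ)) = 0" using IH[OF M3(1,2)] M3(4) snds' by simp
  have "sign_of r W1 + sign_of r W2 = 0"
  proof -
    have "sign_of r Y + sign_of r (inv_word Y) = 0"
      using Y(1) sign_of_Rp[OF j i] by (auto split: if_splits)
    then show ?thesis unfolding Y(2,3) sign_of_rotate .
  qed
  moreover have "face_sum (sign_of r) M = sign_of r W1 + (sign_of r W2 + (\<Sum>c\<leftarrow>fs. sign_of r (map (lab M') c)))"
  proof -
    have "face_sum (sign_of r) M = face_sum (sign_of r) M'" using sim j unfolding similar_def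
        by blast
    then show ?thesis unfolding face_sum_eq[OF 3 sign_of_rotate] by (simp add: W1_def W2_def)
  qed
  moreover have "(\<Sum>c\<leftarrow>fs. sign_of r (map (lab M') c)) = 0" using sum1 sum2 fsum(2) by simp
  ultimately show ?thesis by simp
qed

end

text \<open>Turns the products with N in the theorem into preimages, so that everything can be
  computed in G.\<close>

lemma (in group_hom) set_mult_kernel:
  assumes "X \<subseteq> carrier G"
  shows "X <#> kernel G H h = {x \<in> carrier G. h x \<in> h ` X}"
proof (intro equalityI subsetI)
  fix x assume "x \<in> X <#> kernel G H h"
  then obtain a n where an: "a \<in> X" "n \<in> kernel G H h" "x = a \<otimes> n" unfolding set_mult_def by blast
  then have "a \<in> carrier G" "n \<in> carrier G" "h n = \<one>\<^bsub>H\<^esub>" using assms by (auto simp: kernel_def)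
  then have "x \<in> carrier G" "h x = h a" using an(3) by simp_all
  then show "x \<in> {x \<in> carrier G. h x \<in> h ` X}" using an(1) by simp
next
  fix x assume "x \<in> {x \<in> carrier G. h x \<in> h ` X}"
  then obtain a where a: "x \<in> carrier G" "a \<in> X" "h x = h a" by blast
  then have ac: "a \<in> carrier G" using assms by blast
  have "inv a \<otimes> x \<in> kernel G H h" using a ac by (simp add: kernel_def)
  moreover have "x = a \<otimes> (inv a \<otimes> x)" using a ac by (simp add: G.m_assoc[symmetric])
  ultimately show "x \<in> X <#> kernel G H h" using a(2) unfolding set_mult_def by blast
qed

context atorical_presentation
begin

text \<open>The point is finiteness of the set of ranks, on which \<open>Max\<close> depends: there
  are finitely many faces, each of at most one positive rank.\<close>

lemma diagram_rank_pos:
  assumes "labelled_map A M" "i \<ge> 1" "rel_face Rp M i f"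
  shows "diagram_rank Rp M > 0"
proof -
  have pm0: "premap M" using assms(1) by (simp add: labelled_map_iff)
  obtain fs where fs: "facelist M fs" using cycle_dec_exists[OF premapD(1,3)[OF pm0]] by blast
  let ?I = "{i. i \<ge> 1 \<and> (\<exists>f\<in>faces M. rel_face Rp M i f)}"
  have "?I \<subseteq> (\<Union>c\<in>set fs. set_mset (rank_mset (map (lab M) c)))"
  proof
    fix k assume "k \<in> ?I"
    then obtain c where "k \<ge> 1" "c \<in> set fs" "map (lab M) c \<in> cyclic_closure (Rp k)"
        unfolding rel_face_facelist[OF fs] by blast
    then show "k \<in> (\<Union>c\<in>set fs. set_mset (rank_mset (map (lab M) c)))" using rank_mset_eq by force
  qed
  then have "finite ?I" by (rule finite_subset) simp
  moreover have "i \<in> ?I" using assms by (auto simp: rel_face_def)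
  ultimately have "i \<le> diagram_rank Rp M" unfolding diagram_rank_def by (intro Max_ge) simp_all
  then show ?thesis using assms(2) by simp
qed

text \<open>Faces of rank 0 have sign 0, so a torus without relator faces is handled directly;
  atoricity speaks only about positive rank.\<close>

lemma torus_sum:
  assumes "diagram M" "on_torus M" "j \<ge> 1" "r \<in> Rp j"
  shows "face_sum (sign_of r) M = 0"
  using assms(1,2)
proof (induction "face_sum rank_mset M" arbitrary: M rule: wf_induct_rule[OF wf_mult[OF wf_less]])
  case (1 M)
  have lm: "labelled_map A M" using 1(2) by (simp add: diagram_over_def)
  show ?case
  proof (cases "\<exists>i\<ge>1. \<exists>f. rel_face Rp M i f")
    case True
    then have "diagram_rank Rp M > 0" using diagram_rank_pos[OF lm] by blast
    then obtain i f1 f2 where "i > 0" "opposite_faces A relset R Rp i M f1 f2"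
      using ator 1(2,3) unfolding atorical_def by blast
    then show ?thesis using torus_sum_step[OF _ assms(3,4) 1(2,3)] 1(1) by blast
  next
    case False
    have pm0: "premap M" using lm by (simp add: labelled_map_iff)
    obtain fs where fs: "facelist M fs" using cycle_dec_exists[OF premapD(1,3)[OF pm0]] by blast
    have "map (lab M) c \<in> relset" if "c \<in> set fs" for c
      using False 1(2) that rel_face_iff[OF fs that] unfolding diagram_facelist[OF fs] by blast
    then have "sign_of r (map (lab M) c) = 0" if "c \<in> set fs" for c
        using sign_of_relset[OF assms(3,4)] that by blast
    then have "map (\<lambda>c. sign_of r (map (lab M) c)) fs = map (\<lambda>c. 0) fs" by simp
    from arg_cong[OF this, of sum_list] show ?thesis unfolding face_sum_eq[OF fs sign_of_rotate]
        by simp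
  qed
qed

section \<open>Exponent sums of products of conjugates\<close>

text \<open>The signs are those of the loops as seen from inside. As a lollipop contributes the
  inverse of its relator to the product, this is minus the exponent sum of the product.\<close>

definition esum :: "('a word \<times> 'a word) list \<Rightarrow> 'a word \<Rightarrow> int"
  where "esum L r = (\<Sum>SQ\<leftarrow>L. sign_of r (snd SQ))"

abbreviation CL :: "('a word \<times> 'a word) list set" where "CL \<equiv> conj_lists {1..}"

definition Rplus :: "'a word set" where "Rplus = (\<Union>i\<in>{1..}. Rp i)"

lemma CL_words: "L \<in> CL \<Longrightarrow> lollipops L \<in> words A"
  by (rule conj_lists_lollipops_words[OF _ order_refl])

lemma CL_mem:
  assumes "L \<in> CL" "(S, Q) \<in> set L"
  shows "S \<in> words A \<and> Q \<in> words A \<and> (Q \<in> Rplus \<or> inv_word Q \<in> Rplus)"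
proof -
  obtain i where i: "i \<in> {1..}" "Q \<in> Rp i \<union> inv_word ` Rp i" using conj_listsD[OF assms] by blast
  then have "Q \<in> Rp i \<or> inv_word Q \<in> Rp i" by auto
  then have "Q \<in> Rplus \<or> inv_word Q \<in> Rplus" unfolding Rplus_def using i(1) by blast
  then show ?thesis using conj_lists_words[OF assms(1) order_refl assms(2)] by blast
qed

lemma RplusE: "r \<in> Rplus \<Longrightarrow> (\<And>i. i \<ge> 1 \<Longrightarrow> r \<in> Rp i \<Longrightarrow> P) \<Longrightarrow> P"
  unfolding Rplus_def by auto

lemma sign_of_Rplus:
  assumes "r \<in> Rplus" "s \<in> Rplus"
  shows "sign_of r s = (if r = s then 1 else 0)"
      "sign_of r (inv_word s) = (if r = s then -1 else 0)"
  using assms sign_of_Rp by (meson RplusE)+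

lemma CL_singleton: "S \<in> words A \<Longrightarrow> s \<in> Rplus \<Longrightarrow> Q = s \<or> Q = inv_word s \<Longrightarrow> [(S, Q)] \<in> CL"
  by (rule conj_listsI) (auto simp: Rplus_def)

lemma esum_zero:
  assumes "L \<in> CL" "ev (lollipops L) = \<one>" "r \<in> Rplus"
  shows "esum L r = 0"
proof (cases L)
  case Nil then show ?thesis by (simp add: esum_def)
next
  case (Cons SQ L0)
  \<comment> \<open>The torus needs some nonempty word \<open>Y\<close>; any relator occurring in
    the list provides one.\<close>
  obtain S Y where "(S, Y) \<in> set L" using Cons by (cases SQ) auto
  then have Y: "Y \<in> words A" "Y \<noteq> []" using conj_lists_words[OF assms(1) order_refl] by blast+
  have w: "Y @ Y @ inv_word Y @ inv_word Y \<in> words A" "lollipops L \<in> words A"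
      using Y CL_words assms(1) by simp_all
  have "ev (Y @ Y @ inv_word Y @ inv_word Y) = \<one>" using Y
      by (simp add: ev_append ev_inv_word m_assoc) (simp add: m_assoc[symmetric])
  then have e: "ev ((Y @ Y @ inv_word Y @ inv_word Y) @ lollipops L) = \<one>"
    using ev_append[OF w] assms(2) by simp
  obtain i where i: "i \<ge> 1" "r \<in> Rp i" using assms(3) RplusE by blast
  obtain M where M: "diagram M" "on_torus M" "face_sum (sign_of r) M = (\<Sum>SQ\<leftarrow>L. sign_of r (snd SQ))"
    using commutator_lollipop_torus[OF Y Y assms(1) order_refl e] i by blast
  then show ?thesis using torus_sum[OF M(1,2) i] by (simp add: esum_def)
qed

lemma esum_append: "esum (L1 @ L2) r = esum L1 r + esum L2 r"
  by (simp add: esum_def)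

lemma esum_inv_list:
  assumes "L \<in> CL" "r \<in> Rplus" shows "esum (inv_list L) r = - esum L r"
proof -
  have "sign_of r (inv_word Q) = - sign_of r Q" if "(S, Q) \<in> set L" for S Q
  proof -
    have "Q \<in> Rplus \<or> inv_word Q \<in> Rplus" using CL_mem[OF assms(1) that] by blast
    then show ?thesis
        using sign_of_Rplus[OF assms(2), of Q] sign_of_Rplus[OF assms(2), of "inv_word Q"] by auto
  qed
  then have "map (\<lambda>SQ. sign_of r (inv_word (snd SQ))) L = map (\<lambda>SQ. - sign_of r (snd SQ)) L" by auto
  then have "(\<Sum>SQ\<leftarrow>L. sign_of r (inv_word (snd SQ))) = - (\<Sum>SQ\<leftarrow>L. sign_of r (snd SQ))"
    by (simp add: uminus_sum_list_map comp_def del: map_eq_conv)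
  moreover have "esum (inv_list L) r = (\<Sum>SQ\<leftarrow>L. sign_of r (inv_word (snd SQ)))"
    unfolding esum_def inv_list_def
      by (simp add: rev_map[symmetric] case_prod_beta comp_def sum_list_rev)
  ultimately show ?thesis by (simp add: esum_def)
qed

lemma esum_conj_list: "esum (conj_list g L) r = esum L r"
  by (simp add: esum_def conj_list_def case_prod_beta comp_def)

lemma CL_append: "L1 \<in> CL \<Longrightarrow> L2 \<in> CL \<Longrightarrow> L1 @ L2 \<in> CL"
  by (auto simp: conj_lists_def)

lemma ev_CL_append: "L1 \<in> CL \<Longrightarrow> L2 \<in> CL \<Longrightarrow> ev (lollipops (L1 @ L2)) = ev (lollipops L1) \<otimes> ev (lollipops L2)"
  by (simp add: lollipops_append ev_append CL_words)

lemma ev_CL_inv_list: "L \<in> CL \<Longrightarrow> ev (lollipops (inv_list L)) = inv (ev (lollipops L))"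
  by (simp add: lollipops_inv_list ev_inv_word CL_words)

text \<open>The product of one list with the inverse of the other is trivial in G, so the sums
  differ by 0. Exponent sums are thus invariants of the value in G.\<close>

lemma esum_cong:
  assumes "L1 \<in> CL" "L2 \<in> CL" "ev (lollipops L1) = ev (lollipops L2)" "r \<in> Rplus"
  shows "esum L1 r = esum L2 r"
proof -
  have "ev (lollipops (L1 @ inv_list L2)) = \<one>"
    using assms by (simp add: ev_CL_append inv_list_conj_lists ev_CL_inv_list CL_words)
  then have "esum (L1 @ inv_list L2) r = 0"
      by (rule esum_zero[OF CL_append[OF assms(1) inv_list_conj_lists[OF assms(2)]] _ assms(4)])
  then show ?thesis using esum_inv_list[OF assms(2,4)] by (simp add: esum_append)
qed

section \<open>The commutator subgroup in G\<close>

abbreviation Pn :: "'g set" where "Pn \<equiv> conj_prods {1..}"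
text \<open>In G, \<open>Pn\<close> is the image of the normal closure of the relators, as shown by
  \<open>ev_NR\<close>, and \<open>Cm\<close> is its commutator subgroup with G.\<close>

definition Cm :: "'g set" where "Cm = commutator_subgroup G Pn (carrier G)"

lemma Pn_subgroup: "subgroup Pn G"
proof (rule subgroupI)
  show "Pn \<subseteq> carrier G" unfolding conj_prods_def using CL_words by auto
  show "Pn \<noteq> {}" using conj_prods_one by blast
qed (rule conj_prods_inv[OF _ order_refl] conj_prods_mult[OF _ _ order_refl]; assumption)+

lemma ev_words_surj: "g \<in> carrier G \<Longrightarrow> \<exists>w\<in>carrier F. g = ev w"
  using ev_surj by blast

lemma Pn_conj: "p \<in> Pn \<Longrightarrow> g \<in> carrier G \<Longrightarrow> g \<otimes> p \<otimes> inv g \<in> Pn"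
proof -
  assume p: "p \<in> Pn" "g \<in> carrier G"
  obtain w where "w \<in> carrier F" "g = ev w" using ev_words_surj p(2) by blast
  then show ?thesis using conj_prods_conj[OF p(1) _ order_refl, of w] by simp
qed

lemma comm_gens: "(\<Union>a\<in>Pn. \<Union>b\<in>carrier G. {a \<otimes> b \<otimes> inv a \<otimes> inv b}) \<subseteq> Pn"
proof -
  have "a \<otimes> b \<otimes> inv a \<otimes> inv b \<in> Pn" if ab: "a \<in> Pn" "b \<in> carrier G" for a b
  proof -
    have ac: "a \<in> carrier G" using subgroup.mem_carrier[OF Pn_subgroup] ab by blast
    have "a \<otimes> (b \<otimes> inv a \<otimes> inv b) \<in> Pn"
      using Pn_conj[OF subgroup.m_inv_closed[OF Pn_subgroup ab(1)] ab(2)] subgroup.m_closed[OF Pn_subgroup ab(1)] by blast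
    then show ?thesis using ac ab(2) by (simp add: m_assoc)
  qed
  then show ?thesis by blast
qed

lemma Cm_subset: "Cm \<subseteq> Pn"
  unfolding Cm_def commutator_subgroup_def
    by (rule generate_subgroup_incl[OF comm_gens Pn_subgroup])

text \<open>A conjugate of a generating commutator is the commutator of the conjugates, and
  \<open>Pn\<close> is normal; so the generating set itself is closed under conjugation.\<close>

lemma Cm_normal: "Cm \<lhd> G"
  unfolding Cm_def commutator_subgroup_def
proof (rule normal_generateI)
  show "(\<Union>a\<in>Pn. \<Union>b\<in>carrier G. {a \<otimes> b \<otimes> inv a \<otimes> inv b}) \<subseteq> carrier G"
    using comm_gens subgroup.subset[OF Pn_subgroup] by blast
  fix h g assume h: "h \<in> (\<Union>a\<in>Pn. \<Union>b\<in>carrier G. {a \<otimes> b \<otimes> inv a \<otimes> inv b})" and g: "g \<in> carrier G"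
  then obtain a b where ab: "a \<in> Pn" "b \<in> carrier G" "h = a \<otimes> b \<otimes> inv a \<otimes> inv b" by blast
  have ac: "a \<in> carrier G" using subgroup.mem_carrier[OF Pn_subgroup] ab by blast
  let ?a = "g \<otimes> a \<otimes> inv g" and ?b = "g \<otimes> b \<otimes> inv g"
  have "g \<otimes> h \<otimes> inv g = ?a \<otimes> ?b \<otimes> inv ?a \<otimes> inv ?b"
    unfolding ab(3) using ac ab(2) g
      by (simp add: m_assoc inv_mult_group) (simp add: m_assoc[symmetric])
  moreover have "?a \<in> Pn" "?b \<in> carrier G" using Pn_conj ab g by simp_all
  ultimately show "g \<otimes> h \<otimes> inv g \<in> (\<Union>a\<in>Pn. \<Union>b\<in>carrier G. {a \<otimes> b \<otimes> inv a \<otimes> inv b})" by blast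
qed

lemma Cm_subgroup: "subgroup Cm G"
  using Cm_normal by (simp add: normal_def)

lemma Cm_comm:
  assumes "p \<in> Pn" "g \<in> carrier G"
  shows "p \<otimes> g \<otimes> inv p \<otimes> inv g \<in> Cm" "g \<otimes> p \<otimes> inv g \<otimes> inv p \<in> Cm"
proof -
  have pc: "p \<in> carrier G" using subgroup.mem_carrier[OF Pn_subgroup] assms by blast
  show 1: "p \<otimes> g \<otimes> inv p \<otimes> inv g \<in> Cm"
    unfolding Cm_def commutator_subgroup_def by (rule generate.incl) (use assms in blast)
  have "inv (p \<otimes> g \<otimes> inv p \<otimes> inv g) = g \<otimes> p \<otimes> inv g \<otimes> inv p" using pc assms
      by (simp add: inv_mult_group m_assoc)
  then show "g \<otimes> p \<otimes> inv g \<otimes> inv p \<in> Cm" using subgroup.m_inv_closed[OF Cm_subgroup 1] by simp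
qed

text \<open>A commutator a b a^-1 b^-1 is the product of a list for a and of the b-conjugate of the
  inverse list, whose sums cancel. Inverses of generators form a case of their own in
  \<open>generate\<close> and are written in the opposite order.\<close>

lemma Cm_esum:
  assumes "x \<in> Cm"
  shows "\<exists>L\<in>CL. x = ev (lollipops L) \<and> (\<forall>r\<in>Rplus. esum L r = 0)"
  using assms unfolding Cm_def commutator_subgroup_def
proof (induction rule: generate.induct)
  case one
  have "[] \<in> CL" by (simp add: conj_lists_def)
  then show ?case by (intro bexI[of _ "[]"]) (simp_all add: lollipops_def esum_def)
next
  case (incl h)
  then obtain a b where ab: "a \<in> Pn" "b \<in> carrier G" "h = a \<otimes> b \<otimes> inv a \<otimes> inv b" by blast
  obtain L where L: "L \<in> CL" "a = ev (lollipops L)" using ab(1) unfolding conj_prods_def by blast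
  obtain w where w: "w \<in> words A" "b = ev w" using ev_words_surj[OF ab(2)] by auto
  let ?L = "L @ conj_list w (inv_list L)"
  have iL: "inv_list L \<in> CL" by (rule inv_list_conj_lists[OF L(1)])
  have cL: "conj_list w (inv_list L) \<in> CL" by (rule conj_list_conj_lists[OF iL w(1)])
  have "ev (lollipops (conj_list w (inv_list L))) = ev w \<otimes> ev (lollipops (inv_list L)) \<otimes> inv (ev w)"
    by (rule ev_conj_list[OF w(1)]) (use CL_mem[OF iL] in blast)
  then have "ev (lollipops ?L) = h"
    unfolding ab(3) L(2) w(2) ev_CL_append[OF L(1) cL] using CL_words[OF L(1)] w(1)
    by (simp add: ev_CL_inv_list[OF L(1)] m_assoc)
  moreover have "esum ?L r = 0" if "r \<in> Rplus" for r
    using esum_inv_list[OF L(1) that] by (simp add: esum_append esum_conj_list)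
  ultimately show ?case using CL_append[OF L(1) cL] by (intro bexI[of _ ?L]) auto
next
  case (inv h)
  then obtain a b where ab: "a \<in> Pn" "b \<in> carrier G" "h = a \<otimes> b \<otimes> inv a \<otimes> inv b" by blast
  obtain L where L: "L \<in> CL" "a = ev (lollipops L)" using ab(1) unfolding conj_prods_def by blast
  obtain w where w: "w \<in> words A" "b = ev w" using ev_words_surj[OF ab(2)] by auto
  let ?L = "conj_list w L @ inv_list L"
  have iL: "inv_list L \<in> CL" by (rule inv_list_conj_lists[OF L(1)])
  have cL: "conj_list w L \<in> CL" by (rule conj_list_conj_lists[OF L(1) w(1)])
  have "ev (lollipops (conj_list w L)) = ev w \<otimes> ev (lollipops L) \<otimes> inv (ev w)"
    by (rule ev_conj_list[OF w(1)]) (use CL_mem[OF L(1)] in blast)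
  then have "ev (lollipops ?L) = inv h"
    unfolding ab(3) L(2) w(2) ev_CL_append[OF cL iL] using CL_words[OF L(1)] w(1)
    by (simp add: ev_CL_inv_list[OF L(1)] m_assoc inv_mult_group)
  moreover have "esum ?L r = 0" if "r \<in> Rplus" for r
    using esum_inv_list[OF L(1) that] by (simp add: esum_append esum_conj_list)
  ultimately show ?case using CL_append[OF cL iL] by (intro bexI[of _ ?L]) auto
next
  case (eng h1 h2)
  then obtain L1 L2 where L: "L1 \<in> CL" "h1 = ev (lollipops L1)" "\<forall>r\<in>Rplus. esum L1 r = 0"
    "L2 \<in> CL" "h2 = ev (lollipops L2)" "\<forall>r\<in>Rplus. esum L2 r = 0" by blast
  show ?case using CL_append[OF L(1,4)] L ev_CL_append[OF L(1,4)]
    by (intro bexI[of _ "L1 @ L2"]) (simp_all add: esum_append)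
qed

lemma esum_Cm:
  assumes "L \<in> CL" "ev (lollipops L) \<in> Cm" "r \<in> Rplus" shows "esum L r = 0"
proof -
  obtain L' where "L' \<in> CL" "ev (lollipops L) = ev (lollipops L')" "esum L' r = 0"
      using Cm_esum[OF assms(2)] assms(3) by blast
  then show ?thesis using esum_cong[OF assms(1) _ _ assms(3)] by metis
qed

section \<open>The quotient\<close>

definition NR :: "'a word set" where "NR = normal_closure F (red ` (\<Union>i\<in>{1..}. R i))"
text \<open>\<open>Hs\<close> and \<open>Ks\<close> are the numerator and the denominator of the
  quotient in F, written as preimages of \<open>Pn\<close> and \<open>Cm\<close>;
  \<open>Hs_eq\<close> and \<open>Ks_eq\<close> identify them with the products in the
  theorem.\<close>

definition Hs :: "'a word set" where "Hs = {x \<in> carrier F. ev x \<in> Pn}"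
definition Ks :: "'a word set" where "Ks = {x \<in> carrier F. ev x \<in> Cm}"

lemma NR_normal: "NR \<lhd> F"
  unfolding NR_def
proof (rule group.normal_normal_closure[OF group_free_group])
  show "red ` (\<Union>i\<in>{1..}. R i) \<subseteq> carrier F" using R_words red_in_free_group by blast
qed

lemma NR_carrier: "NR \<subseteq> carrier F"
  using NR_normal by (simp add: normal_def subgroup.subset del: free_group_simps)

lemma R_NR: "i \<ge> 1 \<Longrightarrow> w \<in> R i \<Longrightarrow> red w \<in> NR"
  unfolding NR_def using normal_closure_superset by fastforce

text \<open>Together with \<open>NR_conj_prods\<close> this shows that representatives and all
  relators give the same subgroup of G.\<close>

lemma lollipops_NR: "L \<in> CL \<Longrightarrow> red (lollipops L) \<in> NR"
proof (induction L)
  case Nil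
  have "\<one>\<^bsub>F\<^esub> \<in> NR" using NR_normal subgroup.one_closed by (metis normal_def)
  then show ?case by (simp add: lollipops_def)
next
  case (Cons SQ L)
  obtain S Q where SQ: "SQ = (S, Q)" by (cases SQ)
  obtain i where i: "S \<in> words A" "i \<in> {1..}" "Q \<in> Rp i \<union> inv_word ` Rp i"
      using conj_listsD[OF Cons.prems, of S Q] SQ by auto
  have "Q \<in> R i" using cyclic_closure_R[OF _ cyclic_closureI[OF i(3)]] i(2) by simp
  then have Q: "red (inv_word Q) \<in> NR" "Q \<in> words A" using R_NR R_inv R_words i(2) by simp_all
  have "red S \<otimes>\<^bsub>F\<^esub> red (inv_word Q) \<otimes>\<^bsub>F\<^esub> inv\<^bsub>F\<^esub> (red S) \<in> NR"
    by (rule normal.inv_op_closed2[OF NR_normal red_in_free_group[OF i(1)] Q(1)])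
  then have 1: "red (S @ inv_word Q @ inv_word S) \<in> NR" unfolding red_inv[OF i(1)] red_mult by simp
  have "L \<in> CL" using Cons.prems by (simp add: conj_lists_def)
  then have "red (S @ inv_word Q @ inv_word S) \<otimes>\<^bsub>F\<^esub> red (lollipops L) \<in> NR"
    using subgroup.m_closed[OF _ 1] NR_normal Cons.IH by (metis normal_def)
  then show ?case unfolding red_mult SQ lollipops_Cons .
qed

lemma ev_NR: "ev ` NR = Pn"
proof
  show "ev ` NR \<subseteq> Pn" using NR_conj_prods unfolding NR_def by blast
  show "Pn \<subseteq> ev ` NR"
  proof
    fix x assume "x \<in> Pn"
    then obtain L where L: "L \<in> CL" "x = ev (lollipops L)" unfolding conj_prods_def by blast
    then have "x = ev (red (lollipops L))" using ev_red CL_words by simp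
    then show "x \<in> ev ` NR" using lollipops_NR[OF L(1)] by blast
  qed
qed

lemma Hs_eq: "NR <#>\<^bsub>F\<^esub> kernel F G ev = Hs"
  unfolding Hs_def group_hom.set_mult_kernel[OF ev_group_hom NR_carrier] ev_NR ..

text \<open>As \<open>ev\<close> maps F onto G and \<open>NR\<close> onto \<open>Pn\<close>, it maps
  the generating commutators in F onto those in G, hence the one commutator subgroup onto the
  other.\<close>

lemma Ks_eq: "commutator_subgroup F NR (carrier F) <#>\<^bsub>F\<^esub> kernel F G ev = Ks"
proof -
  interpret h: group_hom F G ev by (rule ev_group_hom)
  let ?S = "\<Union>a\<in>NR. \<Union>b\<in>carrier F. {a \<otimes>\<^bsub>F\<^esub> b \<otimes>\<^bsub>F\<^esub> inv\<^bsub>F\<^esub> a \<otimes>\<^bsub>F\<^esub> inv\<^bsub>F\<^esub> b}"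
  have S: "?S \<subseteq> carrier F" using NR_carrier by (auto simp del: free_group_simps)
  have c: "ev (a \<otimes>\<^bsub>F\<^esub> b \<otimes>\<^bsub>F\<^esub> inv\<^bsub>F\<^esub> a \<otimes>\<^bsub>F\<^esub> inv\<^bsub>F\<^esub> b) = ev a \<otimes> ev b \<otimes> inv (ev a) \<otimes> inv (ev b)"
      if "a \<in> NR" "b \<in> carrier F" for a b
    using NR_carrier that by (simp add: subset_iff del: free_group_simps)
  have "ev ` ?S = (\<Union>a\<in>NR. \<Union>b\<in>carrier F. {ev a \<otimes> ev b \<otimes> inv (ev a) \<otimes> inv (ev b)})"
    unfolding image_UN using c by (simp del: free_group_simps)
  also have "\<dots> = (\<Union>a\<in>ev ` NR. \<Union>b\<in>ev ` carrier F. {a \<otimes> b \<otimes> inv a \<otimes> inv b})" by blast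
  also have "\<dots> = (\<Union>a\<in>Pn. \<Union>b\<in>carrier G. {a \<otimes> b \<otimes> inv a \<otimes> inv b})" unfolding ev_NR ev_surj ..
  finally have "ev ` commutator_subgroup F NR (carrier F) = Cm"
    unfolding commutator_subgroup_def Cm_def h.generate_img[OF S, symmetric] by (rule arg_cong)
  moreover have "commutator_subgroup F NR (carrier F) \<subseteq> carrier F"
    unfolding commutator_subgroup_def using h.G.generate_incl[OF S] .
  ultimately show ?thesis using h.set_mult_kernel unfolding Ks_def by blast
qed

lemma preimage_subgroup:
  assumes "subgroup X G" shows "subgroup {x \<in> carrier F. ev x \<in> X} F"
proof -
  interpret h: group_hom F G ev by (rule ev_group_hom)
  show ?thesis
    by (rule h.G.subgroupI) (use assms in \<open>auto simp: subgroup.one_closed subgroup.m_closed subgroup.m_inv_closed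
          simp del: free_group_simps intro: exI[of _ "\<one>\<^bsub>F\<^esub>"]\<close>)
qed

lemma Hs_subgroup: "subgroup Hs F" and Ks_subgroup: "subgroup Ks F"
  unfolding Hs_def Ks_def using preimage_subgroup Pn_subgroup Cm_subgroup by blast+

abbreviation Hg :: "'a word monoid" where "Hg \<equiv> F\<lparr>carrier := Hs\<rparr>"

lemma Hg_group: "group Hg"
  by (rule subgroup.subgroup_is_group[OF Hs_subgroup group_free_group])

lemma Ks_Hs: "Ks \<subseteq> Hs"
  using Cm_subset unfolding Ks_def Hs_def by blast

lemma Ks_normal: "Ks \<lhd> Hg"
proof (rule group.normal_restrict_supergroup[OF group_free_group Hs_subgroup _ Ks_Hs])
  interpret h: group_hom F G ev by (rule ev_group_hom)
  show "Ks \<lhd> F"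
  proof (rule h.G.normal_invI[OF Ks_subgroup])
    fix x k assume x: "x \<in> carrier F" and k: "k \<in> Ks"
    have kc: "k \<in> carrier F" "ev k \<in> Cm" using k unfolding Ks_def by blast+
    have "ev (x \<otimes>\<^bsub>F\<^esub> k \<otimes>\<^bsub>F\<^esub> inv\<^bsub>F\<^esub> x) = ev x \<otimes> ev k \<otimes> inv (ev x)" using x kc
        by (simp del: free_group_simps)
    moreover have "\<dots> \<in> Cm" by (rule normal.inv_op_closed2[OF Cm_normal h.hom_closed[OF x] kc(2)])
    ultimately show "x \<otimes>\<^bsub>F\<^esub> k \<otimes>\<^bsub>F\<^esub> inv\<^bsub>F\<^esub> x \<in> Ks" unfolding Ks_def using x kc
        by (simp del: free_group_simps)
  qed
qed

abbreviation Qg :: "'a word set monoid" where "Qg \<equiv> Hg Mod Ks"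
definition proj :: "'a word \<Rightarrow> 'a word set" where "proj x = Ks #>\<^bsub>F\<^esub> x"

lemma proj_hom: "group_hom Hg Qg proj"
proof -
  have "proj = (\<lambda>x. Ks #>\<^bsub>Hg\<^esub> x)" by (rule ext) (simp add: proj_def r_coset_def)
  then show ?thesis unfolding group_hom_def group_hom_axioms_def
    using Hg_group normal.factorgroup_is_group[OF Ks_normal] normal.r_coset_hom_Mod[OF Ks_normal]
      by simp
qed

text \<open>Equality of cosets is moved to G, so that words never have to be compared in the free
  group.\<close>

lemma proj_eq_iff:
  assumes "x \<in> Hs" "y \<in> Hs"
  shows "proj x = proj y \<longleftrightarrow> ev x \<otimes> inv (ev y) \<in> Cm"
proof -
  interpret h: group_hom F G ev by (rule ev_group_hom)
  have xy: "x \<in> carrier F" "y \<in> carrier F" using assms unfolding Hs_def by blast+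
  have e: "ev x \<otimes> inv (ev y) \<in> Cm \<longleftrightarrow> x \<otimes>\<^bsub>F\<^esub> inv\<^bsub>F\<^esub> y \<in> Ks" unfolding Ks_def using xy
      by (simp del: free_group_simps)
  show ?thesis unfolding e proj_def
  proof
    assume "Ks #>\<^bsub>F\<^esub> x = Ks #>\<^bsub>F\<^esub> y"
    then have "x \<in> Ks #>\<^bsub>F\<^esub> y" using h.G.rcos_self[OF xy(1) Ks_subgroup] by simp
    then obtain k where k: "k \<in> Ks" "x = k \<otimes>\<^bsub>F\<^esub> y" unfolding r_coset_def by blast
    then have "k \<in> carrier F" unfolding Ks_def by blast
    then have "x \<otimes>\<^bsub>F\<^esub> inv\<^bsub>F\<^esub> y = k" unfolding k(2) using xy
        by (simp add: h.G.m_assoc del: free_group_simps)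
    then show "x \<otimes>\<^bsub>F\<^esub> inv\<^bsub>F\<^esub> y \<in> Ks" using k by simp
  next
    assume k: "x \<otimes>\<^bsub>F\<^esub> inv\<^bsub>F\<^esub> y \<in> Ks"
    have "x = (x \<otimes>\<^bsub>F\<^esub> inv\<^bsub>F\<^esub> y) \<otimes>\<^bsub>F\<^esub> y" using xy by (simp add: h.G.m_assoc del: free_group_simps)
    then have "x \<in> Ks #>\<^bsub>F\<^esub> y" using k unfolding r_coset_def by blast
    then show "Ks #>\<^bsub>F\<^esub> x = Ks #>\<^bsub>F\<^esub> y" using h.G.repr_independence[OF _ xy(2) Ks_subgroup] by simp
  qed
qed

lemma Qg_elem: "X \<in> carrier Qg \<Longrightarrow> \<exists>x\<in>Hs. X = proj x"
  unfolding FactGroup_def RCOSETS_def proj_def by (auto simp: r_coset_def)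

text \<open>The products in the two orders differ by a commutator of an element of \<open>Pn\<close>
  with an element of G, which lies in \<open>Cm\<close>.\<close>

lemma Qg_comm: "comm_group Qg"
proof (rule group.group_comm_groupI[OF normal.factorgroup_is_group[OF Ks_normal]])
  interpret p: group_hom Hg Qg proj by (rule proj_hom)
  interpret h: group_hom F G ev by (rule ev_group_hom)
  fix X Y assume "X \<in> carrier Qg" "Y \<in> carrier Qg"
  then obtain x y where xy: "x \<in> Hs" "X = proj x" "y \<in> Hs" "Y = proj y" using Qg_elem by blast
  have c: "x \<in> carrier F" "y \<in> carrier F" "ev x \<in> Pn" using xy unfolding Hs_def by blast+
  have m: "x \<otimes>\<^bsub>F\<^esub> y \<in> Hs" "y \<otimes>\<^bsub>F\<^esub> x \<in> Hs" using subgroup.m_closed[OF Hs_subgroup] xy by blast+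
  have "ev (x \<otimes>\<^bsub>F\<^esub> y) \<otimes> inv (ev (y \<otimes>\<^bsub>F\<^esub> x)) = ev x \<otimes> ev y \<otimes> inv (ev x) \<otimes> inv (ev y)"
    using c by (simp add: inv_mult_group m_assoc del: free_group_simps)
  then have "proj (x \<otimes>\<^bsub>F\<^esub> y) = proj (y \<otimes>\<^bsub>F\<^esub> x)"
      using proj_eq_iff[OF m] Cm_comm(1)[OF c(3), of "ev y"] c by (simp del: free_group_simps)
  then show "X \<otimes>\<^bsub>Qg\<^esub> Y = Y \<otimes>\<^bsub>Qg\<^esub> X" using p.hom_mult[of x y] p.hom_mult[of y x] xy
      by (simp del: free_group_simps)
qed

lemma CL_Hs: "L \<in> CL \<Longrightarrow> red (lollipops L) \<in> Hs"
  unfolding Hs_def using CL_words red_in_free_group ev_red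
    by (auto simp: conj_prods_def simp del: free_group_simps)

lemma Rplus_Hs:
  assumes "s \<in> Rplus" shows "red s \<in> Hs" "red (inv_word s) \<in> Hs" "s \<in> words A" "ev s \<in> Pn"
proof -
  have "[([], s)] \<in> CL" "[([], inv_word s)] \<in> CL" using CL_singleton[of "[]" s] assms by simp_all
  from this[THEN CL_Hs] show "red s \<in> Hs" "red (inv_word s) \<in> Hs" by (simp_all add: lollipops_def)
  show "s \<in> words A" using assms Rp_words by (auto elim: RplusE)
  then show "ev s \<in> Pn" using \<open>red s \<in> Hs\<close> unfolding Hs_def by (simp add: ev_red)
qed

section \<open>Comparison with the free abelian group\<close>

text \<open>The class of one lollipop. The minus sign stands at the representative itself because a
  lollipop contributes the inverse of its relator.\<close>

definition gen_frag :: "'a word \<Rightarrow> 'a word \<Rightarrow>\<^sub>0 int"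
  where "gen_frag Q = (if Q \<in> Rplus then - frag_of Q else frag_of (inv_word Q))"

definition list_frag :: "('a word \<times> 'a word) list \<Rightarrow> 'a word \<Rightarrow>\<^sub>0 int"
  where "list_frag L = (\<Sum>SQ\<leftarrow>L. gen_frag (snd SQ))"

lemma list_frag_Cons: "list_frag ((S, Q) # L) = gen_frag Q + list_frag L"
  by (simp add: list_frag_def)

lemma gen_frag_props:
  assumes "Q \<in> Rplus \<or> inv_word Q \<in> Rplus"
  shows "Poly_Mapping.keys (gen_frag Q) \<subseteq> Rplus"
      "r \<in> Rplus \<Longrightarrow> Poly_Mapping.lookup (gen_frag Q) r = - sign_of r Q"
proof -
  show "Poly_Mapping.keys (gen_frag Q) \<subseteq> Rplus" using assms by (auto simp: gen_frag_def)
  show "Poly_Mapping.lookup (gen_frag Q) r = - sign_of r Q" if r: "r \<in> Rplus"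
  proof (cases "Q \<in> Rplus")
    case True then show ?thesis using sign_of_Rplus(1)[OF r True] by (simp add: gen_frag_def)
  next
    case False
    then have "inv_word Q \<in> Rplus" using assms by blast
    then show ?thesis using sign_of_Rplus(2)[OF r, of "inv_word Q"] False
        by (simp add: gen_frag_def)
  qed
qed

lemma list_frag_props:
  assumes "L \<in> CL"
  shows "Poly_Mapping.keys (list_frag L) \<subseteq> Rplus"
      "r \<in> Rplus \<Longrightarrow> Poly_Mapping.lookup (list_frag L) r = - esum L r"
proof -
  have "Poly_Mapping.keys (list_frag L) \<subseteq> Rplus \<and> (r \<in> Rplus \<longrightarrow> Poly_Mapping.lookup (list_frag L) r = - esum L r)"
    using assms
  proof (induction L)
    case Nil then show ?case by (simp add: list_frag_def esum_def)
  next
    case (Cons SQ L)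
    obtain S Q where SQ: "SQ = (S, Q)" by (cases SQ)
    have Q: "Q \<in> Rplus \<or> inv_word Q \<in> Rplus" using CL_mem[OF Cons.prems, of S Q] SQ by simp
    have "L \<in> CL" using Cons.prems by (simp add: conj_lists_def)
    then have IH: "Poly_Mapping.keys (list_frag L) \<subseteq> Rplus"
        "r \<in> Rplus \<Longrightarrow> Poly_Mapping.lookup (list_frag L) r = - esum L r"
      using Cons.IH by blast+
    have "Poly_Mapping.keys (list_frag (SQ # L)) \<subseteq> Rplus"
      unfolding SQ list_frag_Cons using keys_add[of "gen_frag Q"
        "list_frag L"] gen_frag_props(1)[OF Q] IH(1) by blast
    moreover have "Poly_Mapping.lookup (list_frag (SQ # L)) r = - esum (SQ # L) r" if "r \<in> Rplus"
      unfolding SQ list_frag_Cons using gen_frag_props(2)[OF Q that] IH(2)[OF that]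
        by (simp add: lookup_add esum_def)
    ultimately show ?case by blast
  qed
  then show "Poly_Mapping.keys (list_frag L) \<subseteq> Rplus"
      "r \<in> Rplus \<Longrightarrow> Poly_Mapping.lookup (list_frag L) r = - esum L r" by blast+
qed

lemma list_frag_eqI:
  assumes "L \<in> CL" "Poly_Mapping.keys c \<subseteq> Rplus"
      "\<And>r. r \<in> Rplus \<Longrightarrow> Poly_Mapping.lookup c r = - esum L r"
  shows "list_frag L = c"
proof (rule poly_mapping_eqI)
  fix r
  show "Poly_Mapping.lookup (list_frag L) r = Poly_Mapping.lookup c r"
  proof (cases "r \<in> Rplus")
    case True then show ?thesis using list_frag_props(2)[OF assms(1)] assms(3) by simp
  next
    case False
    then have "r \<notin> Poly_Mapping.keys (list_frag L)" "r \<notin> Poly_Mapping.keys c"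
        using list_frag_props(1)[OF assms(1)] assms(2) by blast+
    then show ?thesis by (simp add: in_keys_iff)
  qed
qed

text \<open>Differences come from concatenation with an inverse list, and a basis element from a
  lollipop with empty stem and inverted relator.\<close>

lemma list_frag_surj:
  assumes "Poly_Mapping.keys c \<subseteq> Rplus" shows "\<exists>L\<in>CL. list_frag L = c"
  using assms
proof (rule free_Abelian_group_induct)
  have "[] \<in> CL" by (simp add: conj_lists_def)
  then show "\<exists>L\<in>CL. list_frag L = 0" by (intro bexI[of _ "[]"]) (simp add: list_frag_def)
next
  fix x y assume xy: "Poly_Mapping.keys x \<subseteq> Rplus" "Poly_Mapping.keys y \<subseteq> Rplus"
    "\<exists>L\<in>CL. list_frag L = x" "\<exists>L\<in>CL. list_frag L = y"
  then obtain L1 L2 where L: "L1 \<in> CL" "list_frag L1 = x" "L2 \<in> CL" "list_frag L2 = y" by blast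
  have LL: "L1 @ inv_list L2 \<in> CL" by (rule CL_append[OF L(1) inv_list_conj_lists[OF L(3)]])
  have "list_frag (L1 @ inv_list L2) = x - y"
  proof (rule list_frag_eqI[OF LL])
    show "Poly_Mapping.keys (x - y) \<subseteq> Rplus" using keys_diff[of x y] xy(1,2) by blast
    fix r assume r: "r \<in> Rplus"
    show "Poly_Mapping.lookup (x - y) r = - esum (L1 @ inv_list L2) r"
      using list_frag_props(2)[OF L(1) r] list_frag_props(2)[OF L(3) r] L esum_inv_list[OF L(3) r]
        by (simp add: lookup_minus esum_append)
  qed
  then show "\<exists>L\<in>CL. list_frag L = x - y" using LL by blast
next
  fix a assume a: "a \<in> Rplus"
  have L: "[([], inv_word a)] \<in> CL" by (rule CL_singleton[OF _ a]) simp_all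
  have "list_frag [([], inv_word a)] = frag_of a"
    by (rule list_frag_eqI[OF L]) (use a sign_of_Rplus(2) in \<open>auto simp: esum_def\<close>)
  then show "\<exists>L\<in>CL. list_frag L = frag_of a" using L by blast
qed

text \<open>The homomorphism comes from the universal property, as the quotient is abelian. That it
  is compatible with lists of lollipops, stems included, is checked factor by factor.\<close>

lemma ex_basis_hom:
  "\<exists>h \<in> hom (free_Abelian_group Rplus) Qg. (\<forall>r\<in>Rplus. h (frag_of r) = proj (red r)) \<and>
    (\<forall>L\<in>CL. h (list_frag L) = proj (red (lollipops L)))"
proof -
  interpret p: group_hom Hg Qg proj by (rule proj_hom)
  interpret Q: comm_group Qg by (rule Qg_comm)
  have "(\<lambda>r. proj (red r)) ` Rplus \<subseteq> carrier Qg" using Rplus_Hs(1) p.hom_closed by auto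
  then obtain h where h: "h \<in> hom (free_Abelian_group Rplus) Qg"
      "\<forall>r\<in>Rplus. h (frag_of r) = proj (red r)"
    by (rule Q.free_Abelian_group_universal) blast
  interpret h: group_hom "free_Abelian_group Rplus" Qg h
    by (simp add: group_hom_def group_hom_axioms_def h(1) p.H.is_group)
  have gf: "h (gen_frag Q) = proj (red (S @ inv_word Q @ inv_word S))" if S: "S \<in> words A"
      and Q: "Q \<in> Rplus \<or> inv_word Q \<in> Rplus" for S Q
  proof -
    have iQ: "red (inv_word Q) \<in> Hs" "Q \<in> words A"
        using Q Rplus_Hs[of Q] Rplus_Hs[of "inv_word Q"] by auto
    have iQ': "ev (inv_word Q) \<in> Pn" using iQ unfolding Hs_def by (simp add: ev_red)
    have "[(S, Q)] \<in> CL" using CL_singleton[OF S, of Q Q] CL_singleton[OF S, of "inv_word Q" Q] Q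
        by auto
    from CL_Hs[OF this] have H: "red (S @ inv_word Q @ inv_word S) \<in> Hs"
        by (simp add: lollipops_def)
    \<comment> \<open>Removing the stem changes the element by a commutator of \<open>S\<close> with
      an element of \<open>Pn\<close>, which is trivial in the quotient.\<close>
    have "ev (red (S @ inv_word Q @ inv_word S)) \<otimes> inv (ev (red (inv_word Q))) = ev S \<otimes> ev (inv_word Q) \<otimes> inv (ev S) \<otimes> inv (ev (inv_word Q))"
      using S iQ by (simp add: ev_red ev_append ev_inv_word[OF S] m_assoc)
    then have 1: "proj (red (S @ inv_word Q @ inv_word S)) = proj (red (inv_word Q))"
      using proj_eq_iff[OF H iQ(1)] Cm_comm(2)[OF iQ' ev_closed[OF S]] by simp
    show ?thesis
    proof (cases "Q \<in> Rplus")
      case True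
      have "proj (red (inv_word Q)) = inv\<^bsub>Qg\<^esub> (proj (red Q))"
      proof -
        have "inv\<^bsub>Hg\<^esub> (red Q) = red (inv_word Q)"
          using group.m_inv_consistent[OF group_free_group Hs_subgroup Rplus_Hs(1)[OF True]] red_inv[OF iQ(2)] by simp
        then show ?thesis using p.hom_inv[of "red Q"] Rplus_Hs(1)[OF True] by simp
      qed
      moreover have "h (- frag_of Q) = inv\<^bsub>Qg\<^esub> (h (frag_of Q))"
        using h.hom_inv[of "frag_of Q"] True by simp
      ultimately show ?thesis unfolding 1 gen_frag_def using True h(2) by simp
    next
      case False
      then show ?thesis unfolding 1 gen_frag_def using Q h(2) by simp
    qed
  qed
  have "h (list_frag L) = proj (red (lollipops L))" if "L \<in> CL" for L
    using that
  proof (induction L)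
    case Nil
    have "h 0 = \<one>\<^bsub>Qg\<^esub>" using h.hom_one by simp
    moreover have "proj [] = \<one>\<^bsub>Qg\<^esub>" using p.hom_one by simp
    ultimately show ?case by (simp add: list_frag_def lollipops_def)
  next
    case (Cons SQ L)
    obtain S Q where SQ: "SQ = (S, Q)" by (cases SQ)
    have SQ': "S \<in> words A" "Q \<in> Rplus \<or> inv_word Q \<in> Rplus"
        using CL_mem[OF Cons.prems, of S Q] SQ by simp_all
    have L: "L \<in> CL" using Cons.prems by (simp add: conj_lists_def)
    have "[(S, Q)] \<in> CL" using Cons.prems SQ by (simp add: conj_lists_def)
    from CL_Hs[OF this] have H: "red (S @ inv_word Q @ inv_word S) \<in> Hs"
        by (simp add: lollipops_def)
    have "h (gen_frag Q + list_frag L) = h (gen_frag Q) \<otimes>\<^bsub>Qg\<^esub> h (list_frag L)"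
      using h.hom_mult[of "gen_frag Q"
        "list_frag L"] gen_frag_props(1)[OF SQ'(2)] list_frag_props(1)[OF L] by simp
    also have "\<dots> = proj (red (S @ inv_word Q @ inv_word S)) \<otimes>\<^bsub>Qg\<^esub> proj (red (lollipops L))"
      using gf[OF SQ'] Cons.IH[OF L] by simp
    also have "\<dots> = proj (red (S @ inv_word Q @ inv_word S) \<otimes>\<^bsub>F\<^esub> red (lollipops L))"
      using p.hom_mult[of "red (S @ inv_word Q @ inv_word S)" "red (lollipops L)"] H CL_Hs[OF L]
        by simp
    finally show ?case unfolding red_mult SQ lollipops_Cons list_frag_Cons .
  qed
  then show ?thesis using h by blast
qed

text \<open>From zero sums the claim is formal: the list represents 0 in the free abelian group,
  whose image in the quotient is trivial. The converse is \<open>esum_Cm\<close>, which rests on the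
  torus argument.\<close>

lemma Cm_iff_esum:
  assumes "L \<in> CL"
  shows "ev (lollipops L) \<in> Cm \<longleftrightarrow> (\<forall>r\<in>Rplus. esum L r = 0)"
proof
  assume "\<forall>r\<in>Rplus. esum L r = 0"
  then have 0: "list_frag L = 0" by (intro list_frag_eqI[OF assms]) simp_all
  obtain h where h: "h \<in> hom (free_Abelian_group Rplus) Qg"
      "\<forall>L\<in>CL. h (list_frag L) = proj (red (lollipops L))" using ex_basis_hom by blast
  have "[] \<in> CL" "list_frag [] = 0" by (simp_all add: conj_lists_def list_frag_def)
  then have "proj (red (lollipops L)) = proj (red (lollipops []))" using h(2) assms 0 by metis
  then have "ev (red (lollipops L)) \<otimes> inv (ev (red (lollipops []))) \<in> Cm"
    using proj_eq_iff[OF CL_Hs[OF assms] CL_Hs[OF \<open>[] \<in> CL\<close>]] by blast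
  then show "ev (lollipops L) \<in> Cm" using CL_words[OF assms]
      by (simp add: ev_red lollipops_def[of "[]"])
qed (use esum_Cm[OF assms] in blast)

text \<open>Injectivity is the invariance of exponent sums: lists with the same class have the same
  sums, hence the same coefficients. Surjectivity holds because every element of \<open>Hs\<close>
  has the value of some list of lollipops.\<close>

lemma free_abelian_quotient: "free_abelian_with_basis Qg Rplus (\<lambda>r. Ks #>\<^bsub>F\<^esub> red r)"
proof -
  obtain h where h: "h \<in> hom (free_Abelian_group Rplus) Qg" "\<forall>r\<in>Rplus. h (frag_of r) = proj (red r)"
    "\<And>L. L \<in> CL \<Longrightarrow> h (list_frag L) = proj (red (lollipops L))" using ex_basis_hom by blast
  have "inj_on h (carrier (free_Abelian_group Rplus))"
  proof (rule inj_onI)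
    fix c c' assume c: "c \<in> carrier (free_Abelian_group Rplus)"
      "c' \<in> carrier (free_Abelian_group Rplus)" "h c = h c'"
    then obtain L L' where L: "L \<in> CL" "list_frag L = c" "L' \<in> CL" "list_frag L' = c'"
        using list_frag_surj by (metis carrier_free_Abelian_group_iff)
    have LL: "L @ inv_list L' \<in> CL" by (rule CL_append[OF L(1) inv_list_conj_lists[OF L(3)]])
    have "proj (red (lollipops L)) = proj (red (lollipops L'))"
        using h(3)[OF L(1)] h(3)[OF L(3)] c(3) L by simp
    then have "ev (red (lollipops L)) \<otimes> inv (ev (red (lollipops L'))) \<in> Cm"
      using proj_eq_iff[OF CL_Hs[OF L(1)] CL_Hs[OF L(3)]] by blast
    then have "ev (lollipops (L @ inv_list L')) \<in> Cm"
      using ev_CL_append[OF L(1) inv_list_conj_lists[OF L(3)]] ev_CL_inv_list[OF L(3)] CL_words L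
        by (simp add: ev_red)
    then have e: "esum (L @ inv_list L') r = 0" if "r \<in> Rplus" for r using esum_Cm[OF LL _ that]
        by blast
    have "list_frag L = list_frag L'"
    proof (rule list_frag_eqI[OF L(1) list_frag_props(1)[OF L(3)]])
      fix r assume r: "r \<in> Rplus"
      show "Poly_Mapping.lookup (list_frag L') r = - esum L r"
        using e[OF r] esum_inv_list[OF L(3) r] list_frag_props(2)[OF L(3) r]
          by (simp add: esum_append)
    qed
    then show "c = c'" using L by simp
  qed
  moreover have "h ` carrier (free_Abelian_group Rplus) = carrier Qg"
  proof
    show "h ` carrier (free_Abelian_group Rplus) \<subseteq> carrier Qg" using h(1) by (auto simp: hom_def)
    show "carrier Qg \<subseteq> h ` carrier (free_Abelian_group Rplus)"
    proof
      fix X assume "X \<in> carrier Qg"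
      then obtain x where x: "x \<in> Hs" "X = proj x" using Qg_elem by blast
      then obtain L where L: "L \<in> CL" "ev x = ev (lollipops L)" unfolding Hs_def conj_prods_def
          by blast
      have "ev x \<otimes> inv (ev (red (lollipops L))) = \<one>" unfolding L(2) using CL_words[OF L(1)]
          by (simp add: ev_red)
      then have "X = proj (red (lollipops L))"
          using proj_eq_iff[OF x(1) CL_Hs[OF L(1)]] subgroup.one_closed[OF Cm_subgroup] x(2) by simp
      then have "X = h (list_frag L)" using h(3)[OF L(1)] by simp
      moreover have "list_frag L \<in> carrier (free_Abelian_group Rplus)"
          using list_frag_props(1)[OF L(1)] by simp
      ultimately show "X \<in> h ` carrier (free_Abelian_group Rplus)" by blast
    qed
  qed
  ultimately have "h \<in> iso (free_Abelian_group Rplus) Qg" using h(1)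
      by (simp add: iso_def bij_betw_def)
  then show ?thesis unfolding free_abelian_with_basis_def using Qg_comm h(2)
      by (auto simp: proj_def)
qed

text \<open>The first isomorphism theorem for \<open>ev\<close> from \<open>Hs\<close> onto
  \<open>Pn\<close> followed by the projection modulo \<open>Cm\<close>; its kernel is
  \<open>Ks\<close> by definition as a preimage.\<close>

lemma quotient_iso: "(G\<lparr>carrier := Pn\<rparr>) Mod Cm \<cong> Qg"
proof -
  interpret h: group_hom F G ev by (rule ev_group_hom)
  let ?P = "G\<lparr>carrier := Pn\<rparr>"
  let ?f = "\<lambda>x. Cm #>\<^bsub>?P\<^esub> ev x"
  have CmP: "Cm \<lhd> ?P" by (rule normal_restrict_supergroup[OF Pn_subgroup Cm_normal Cm_subset])
  have P: "group ?P" by (rule subgroup.subgroup_is_group[OF Pn_subgroup is_group])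
  have Q: "group (?P Mod Cm)" by (rule normal.factorgroup_is_group[OF CmP])
  have evh: "ev \<in> hom Hg ?P"
      by (rule homI) (auto simp: Hs_def h.hom_mult simp del: free_group_simps(2))
  have f: "?f \<in> hom Hg (?P Mod Cm)"
    using Group.hom_compose[OF evh normal.r_coset_hom_Mod[OF CmP]] by (simp add: comp_def)
  have gh: "group_hom Hg (?P Mod Cm) ?f" using Hg_group Q f
      by (simp add: group_hom_def group_hom_axioms_def)
  have img: "ev ` Hs = Pn"
  proof
    show "ev ` Hs \<subseteq> Pn" unfolding Hs_def by blast
    show "Pn \<subseteq> ev ` Hs"
    proof
      fix x assume "x \<in> Pn"
      then obtain w where "w \<in> NR" "x = ev w" using ev_NR by blast
      then show "x \<in> ev ` Hs" using NR_carrier \<open>x \<in> Pn\<close> unfolding Hs_def by blast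
    qed
  qed
  have surj: "?f ` carrier Hg = carrier (?P Mod Cm)"
  proof -
    have "?f ` Hs = (\<lambda>a. Cm #>\<^bsub>?P\<^esub> a) ` (ev ` Hs)" by (simp add: image_image)
    then show ?thesis unfolding img by (auto simp: FactGroup_def RCOSETS_def)
  qed
  have ker: "kernel Hg (?P Mod Cm) ?f = Ks"
  proof -
    have "Cm #>\<^bsub>?P\<^esub> g = Cm \<longleftrightarrow> g \<in> Cm" if "g \<in> Pn" for g
    proof
      assume "Cm #>\<^bsub>?P\<^esub> g = Cm"
      moreover have "g \<in> Cm #>\<^bsub>?P\<^esub> g"
          by (rule group.rcos_self[OF P]) (use that CmP in \<open>simp_all add: normal_def\<close>)
      ultimately show "g \<in> Cm" by simp
    next
      assume "g \<in> Cm"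
      then show "Cm #>\<^bsub>?P\<^esub> g = Cm"
          by (intro group.coset_join2[OF P]) (use that CmP in \<open>simp_all add: normal_def\<close>)
    qed
    then show ?thesis unfolding kernel_def Ks_def using Cm_subset
        by (auto simp: Hs_def FactGroup_def)
  qed
  have "Qg \<cong> ?P Mod Cm" using group_hom.FactGroup_iso[OF gh surj] unfolding ker .
  then show ?thesis using group.iso_sym[OF normal.factorgroup_is_group[OF Ks_normal]] by blast
qed

section \<open>Expressions given as products of conjugates\<close>

text \<open>Exponent 1 is encoded by the inverse relator and exponent -1 by the relator, since a
  lollipop inverts its second component. The sign in the comparison of \<open>exponent_sum\<close>
  with \<open>esum\<close> stems from this.\<close>

definition expr_list :: "('a word \<times> 'a word \<times> int) list \<Rightarrow> ('a word \<times> 'a word) list"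
  where "expr_list E = map (\<lambda>(S, r, e). (S, if e = 1 then inv_word r else r)) E"

lemma expr_list_props:
  assumes "\<forall>(S, r, e)\<in>set E. S \<in> carrier F \<and> r \<in> Rplus \<and> e \<in> {1, -1}"
  shows "expr_list E \<in> CL \<and> conjugate_product A E \<in> carrier F \<and>
    ev (conjugate_product A E) = ev (lollipops (expr_list E)) \<and>
    (\<forall>r\<in>Rplus. exponent_sum E r = - esum (expr_list E) r)"
  using assms
proof (induction E)
  case Nil
  then show ?case
      by (simp add: expr_list_def conj_lists_def conjugate_product_def lollipops_def exponent_sum_def esum_def freely_reduced_def)
next
  case (Cons t E)
  interpret h: group_hom F G ev by (rule ev_group_hom)
  obtain S s e where t: "t = (S, s, e)" by (cases t)
  have S: "S \<in> carrier F" "s \<in> Rplus" "e = 1 \<or> e = -1" using Cons.prems t by auto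
  have Sw: "S \<in> words A" using S by simp
  have sw: "s \<in> words A" using Rplus_Hs S by blast
  have rs: "red s \<in> carrier F" by (rule red_in_free_group[OF sw])
  have IH: "expr_list E \<in> CL" "conjugate_product A E \<in> carrier F"
      "ev (conjugate_product A E) = ev (lollipops (expr_list E))"
    "\<And>r. r \<in> Rplus \<Longrightarrow> exponent_sum E r = - esum (expr_list E) r" using Cons.IH Cons.prems by simp_all
  define Q where "Q = (if e = 1 then inv_word s else s)"
  have Qw: "Q \<in> words A" using sw by (simp add: Q_def)
  have EL: "expr_list (t # E) = [(S, Q)] @ expr_list E" by (simp add: expr_list_def t Q_def)
  have cl: "[(S, Q)] \<in> CL" by (rule CL_singleton[OF Sw S(2)]) (auto simp: Q_def)
  have CP: "conjugate_product A (t # E) = S \<otimes>\<^bsub>F\<^esub> (red s [^]\<^bsub>F\<^esub> e) \<otimes>\<^bsub>F\<^esub> inv\<^bsub>F\<^esub> S \<otimes>\<^bsub>F\<^esub> conjugate_product A E"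
    by (simp add: conjugate_product_def t del: free_group_simps)
  have pe: "red s [^]\<^bsub>F\<^esub> e = red (inv_word Q)"
    using S(3)
  proof
    assume "e = 1" then show ?thesis using h.G.int_pow_1[OF rs]
      by (simp add: Q_def del: free_group_simps)
  next
    assume "e = -1" then show ?thesis
      using h.G.int_pow_neg[OF rs, of 1] h.G.int_pow_1[OF rs] red_inv[OF sw]
      by (simp add: Q_def del: free_group_simps)
  qed
  have rq: "red (inv_word Q) \<in> carrier F" by (rule red_in_free_group) (use Qw in simp)
  have "conjugate_product A (t # E) \<in> carrier F" unfolding CP pe using S(1) rq IH(2)
      by (simp del: free_group_simps)
  moreover have "ev (conjugate_product A (t # E)) = ev (lollipops (expr_list (t # E)))"
  proof -
    have "ev (conjugate_product A (t # E)) = ev S \<otimes> ev (red (inv_word Q)) \<otimes> inv (ev S) \<otimes> ev (lollipops (expr_list E))"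
      unfolding CP pe using S(1) rq IH(2,3) by (simp del: free_group_simps)
    also have "\<dots> = ev (lollipops (expr_list (t # E)))"
      unfolding EL ev_CL_append[OF cl IH(1)] using Sw Qw CL_words[OF IH(1)]
      by (simp add: lollipops_def[of "[(S, Q)]"] ev_red ev_append ev_inv_word m_assoc)
    finally show ?thesis .
  qed
  moreover have "exponent_sum (t # E) r = - esum (expr_list (t # E)) r" if r: "r \<in> Rplus" for r
  proof -
    have "exponent_sum (t # E) r = (if s = r then e else 0) + exponent_sum E r"
        by (simp add: exponent_sum_def t)
    moreover have "esum [(S, Q)] r = - (if s = r then e else 0)"
      using sign_of_Rplus[OF r S(2)] S(3) by (auto simp: esum_def Q_def)
    ultimately show ?thesis unfolding EL esum_append using IH(4)[OF r] by simp
  qed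
  ultimately show ?case using CL_append[OF cl IH(1)] unfolding EL by blast
qed

text \<open>The factor \<open>Z\<close> is trivial in G, and membership in \<open>Ks\<close> depends
  only on the value in G; so the question is one about the list of lollipops of the
  expression.\<close>

lemma Ks_iff_exponent_sums:
  assumes "W \<in> words A" "Z \<in> kernel F G ev"
      "\<forall>(S, r, e)\<in>set E. S \<in> carrier F \<and> r \<in> Rplus \<and> e \<in> {1, -1}"
    "red W = Z \<otimes>\<^bsub>F\<^esub> conjugate_product A E"
  shows "red W \<in> Ks \<longleftrightarrow> (\<forall>r\<in>Rplus. exponent_sum E r = 0)"
proof -
  interpret h: group_hom F G ev by (rule ev_group_hom)
  note p = expr_list_props[OF assms(3)]
  have Z: "Z \<in> carrier F" "ev Z = \<one>" using assms(2) unfolding kernel_def by blast+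
  have "ev (red W) = ev (lollipops (expr_list E))"
    unfolding assms(4) using Z p CL_words by (simp del: free_group_simps)
  then have "red W \<in> Ks \<longleftrightarrow> ev (lollipops (expr_list E)) \<in> Cm"
    unfolding Ks_def using red_in_free_group[OF assms(1)] by simp
  also have "\<dots> \<longleftrightarrow> (\<forall>r\<in>Rplus. esum (expr_list E) r = 0)" using Cm_iff_esum p by blast
  also have "\<dots> \<longleftrightarrow> (\<forall>r\<in>Rplus. exponent_sum E r = 0)" using p by simp
  finally show ?thesis .
qed

end

theorem theorem1:
  fixes G :: "('g, 'm) monoid_scheme"
    and \<A> :: "'a set" and \<gamma> :: "'a \<Rightarrow> 'g"
    and \<R> \<R>p :: "nat \<Rightarrow> 'a word set"
    and \<O> Rplus F N NR NbarR K
  assumes "group G"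
    and "\<gamma> ` \<A> \<subseteq> carrier G" and "generate G (\<gamma> ` \<A>) = carrier G"
    and "\<O> = relators G \<gamma> \<A>"
    and "graded_relators \<A> \<O> \<R>"
    and "\<forall>i\<ge>1. condition_star \<A> \<O> \<R> i"
    and "\<forall>i\<ge>1. reduced_relators \<A> \<O> \<R> i (\<R>p i)"
    and "aspherical \<A> \<O> \<R> \<R>p"
    and "atorical \<A> \<O> \<R> \<R>p"
    and "Rplus = (\<Union>i\<in>{1..}. \<R>p i)"
    and "F = free_group \<A>"
    and "N = kernel F G (eval_word G \<gamma>)"
    and "NR = normal_closure F (red ` (\<Union>i\<in>{1..}. \<R> i))"
    and "NbarR = eval_word G \<gamma> ` NR"
    and "K = commutator_subgroup F NR (carrier F) <#>\<^bsub>F\<^esub> N"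
  shows "(\<forall>W\<in>words \<A>. \<forall>Z\<in>N. \<forall>E.
        red W \<in> NR <#>\<^bsub>F\<^esub> N \<longrightarrow>
        (\<forall>(S, R, e)\<in>set E. S \<in> carrier F \<and> R \<in> Rplus \<and> e \<in> {1, -1}) \<longrightarrow>
        red W = Z \<otimes>\<^bsub>F\<^esub> conjugate_product \<A> E \<longrightarrow>
        (red W \<in> K \<longleftrightarrow> (\<forall>R\<in>Rplus. exponent_sum E R = 0)))
    \<and> (G\<lparr>carrier := NbarR\<rparr>) Mod (commutator_subgroup G NbarR (carrier G))
        \<cong> (F\<lparr>carrier := NR <#>\<^bsub>F\<^esub> N\<rparr>) Mod K
    \<and> free_abelian_with_basis ((F\<lparr>carrier := NR <#>\<^bsub>F\<^esub> N\<rparr>) Mod K) Rplus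
        (\<lambda>R. K #>\<^bsub>F\<^esub> red R)"
proof -
  interpret gg: generated_group G \<gamma> \<A>
    by (rule generated_group.intro) (use assms in \<open>simp_all add: generated_group_axioms_def\<close>)
  have O: "\<O> = gg.relset" using assms(4) by (simp add: gg.relset_def)
  interpret ap: atorical_presentation G \<gamma> \<A> \<R> \<R>p
  proof (intro atorical_presentation.intro graded_presentation.intro gg.generated_group_axioms
      graded_presentation_axioms.intro atorical_presentation_axioms.intro)
    show "graded_relators \<A> gg.relset \<R>" using assms(5) unfolding O .
    show "\<And>i. 1 \<le> i \<Longrightarrow> reduced_relators \<A> gg.relset \<R> i (\<R>p i)" using assms(7) unfolding O by blast
    show "atorical \<A> gg.relset \<R> \<R>p" using assms(9) unfolding O .
  qed
  \<comment> \<open>All sets in the statement are identified with \<open>Pn\<close> or with the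
    preimages \<open>Hs\<close> and \<open>Ks\<close>, for which the three claims are already
    known.\<close>
  have NR: "NR = ap.NR" using assms(11,13) by (simp add: ap.NR_def)
  have Nb: "NbarR = ap.Pn" unfolding assms(14) NR by (rule ap.ev_NR)
  have H: "NR <#>\<^bsub>F\<^esub> N = ap.Hs" unfolding NR assms(11,12) by (rule ap.Hs_eq)
  have K: "K = ap.Ks" unfolding assms(15) NR assms(11,12) by (rule ap.Ks_eq)
  have Rp: "Rplus = ap.Rplus" unfolding assms(10) ap.Rplus_def ..
  have "red W \<in> K \<longleftrightarrow> (\<forall>R\<in>Rplus. exponent_sum E R = 0)"
    if "W \<in> words \<A>" "Z \<in> N" "\<forall>(S, R, e)\<in>set E. S \<in> carrier F \<and> R \<in> Rplus \<and> e \<in> {1, -1}"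
      "red W = Z \<otimes>\<^bsub>F\<^esub> conjugate_product \<A> E" for W Z E
    using that unfolding K Rp assms(11,12) by (rule ap.Ks_iff_exponent_sums)
  moreover have "(G\<lparr>carrier := NbarR\<rparr>) Mod (commutator_subgroup G NbarR (carrier G))
      \<cong> (F\<lparr>carrier := NR <#>\<^bsub>F\<^esub> N\<rparr>) Mod K"
    unfolding H K Nb unfolding assms(11) by (rule ap.quotient_iso[unfolded ap.Cm_def])
  moreover have "free_abelian_with_basis ((F\<lparr>carrier := NR <#>\<^bsub>F\<^esub> N\<rparr>) Mod K) Rplus (\<lambda>R. K #>\<^bsub>F\<^esub> red R)"
    unfolding H K Rp unfolding assms(11) by (rule ap.free_abelian_quotient)
  ultimately show ?thesis by blast
qed

end
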